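(* Let $H$ be a maximal plane graph of diameter $d$, and let $\alpha\geq d$ be an integer. Then there exists a maximal plane graph $G$ containing $H$ as a plane subgraph such that $V(H)\subseteq \mathcal{E}_G(\alpha)$ if and only if for every vertex $u$ of $H$ with $e_H(u)<\alpha$ there exists a face $f$ of $H$ such that $u\in\mathrm{qcc}_H(H[f])$.
   Context: A maximal plane graph is a plane embedding of a maximal planar graph (a planar graph to which no edge can be added while preserving planarity). All graphs are finite and simple; $d_G(u,v)$ is the usual graph distance and $d_G(A,B)=\min\{d_G(a,b):a\in A,b\in B\}$ for vertex sets. The eccentricity is $e_G(u)=\max_{x\in V(G)} d_G(u,x)$, and $\mathcal{E}_G(i)=\{v\in V(G): e_G(v)=i\}$. For a face $f$ of a plane graph $H$, $H[f]$ is the subgraph formed by the vertices and edges on the boundary of $f$. For $S\subseteq V(H)$, $\mathrm{qcc}_H(S)=\{u\in V(H): \forall v\in V(H)\ \exists s\in S \text{ with } d_H(u,s)\geq d_H(v,s)\}$ (for a subgraph, use its vertex set). *)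

theory Defs
  imports "HOL-Analysis.Analysis"
begin

section \<open>Finite simple graphs\<close>

record 'a sgraph =
  verts :: "'a set"
  edges :: "'a set set"

definition simple_graph :: "'a sgraph \<Rightarrow> bool" where
  "simple_graph G \<longleftrightarrow> finite (verts G) \<and> (\<forall>e\<in>edges G. e \<subseteq> verts G \<and> card e = 2)"

definition graph_iso :: "'a sgraph \<Rightarrow> 'b sgraph \<Rightarrow> bool" where
  "graph_iso G K \<longleftrightarrow>
     (\<exists>\<phi>. bij_betw \<phi> (verts G) (verts K) \<and> edges K = (\<lambda>e. \<phi> ` e) ` edges G)"

definition walk :: "'a sgraph \<Rightarrow> 'a list \<Rightarrow> bool" where
  "walk G xs \<longleftrightarrow>
     xs \<noteq> [] \<and> set xs \<subseteq> verts G \<and> successively (\<lambda>x y. {x, y} \<in> edges G) xs"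

text \<open>Distances are extended naturals: the infimum of the empty set is \<open>\<infinity>\<close>, so
  vertices in different components have distance \<open>\<infinity>\<close>.\<close>

definition gdist :: "'a sgraph \<Rightarrow> 'a \<Rightarrow> 'a \<Rightarrow> enat" where
  "gdist G u v = (INF xs \<in> {xs. walk G xs \<and> hd xs = u \<and> last xs = v}. enat (length xs - 1))"

definition ecc :: "'a sgraph \<Rightarrow> 'a \<Rightarrow> enat" where
  "ecc G u = (SUP x\<in>verts G. gdist G u x)"

definition ecc_class :: "'a sgraph \<Rightarrow> nat \<Rightarrow> 'a set" where
  "ecc_class G i = {v \<in> verts G. ecc G v = enat i}"

definition gdiam :: "'a sgraph \<Rightarrow> enat" where
  "gdiam G = (SUP u\<in>verts G. ecc G u)"

definition qcc :: "'a sgraph \<Rightarrow> 'a set \<Rightarrow> 'a set" where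
  "qcc G S = {u \<in> verts G. \<forall>v\<in>verts G. \<exists>s\<in>S. gdist G u s \<ge> gdist G v s}"


section \<open>Plane graphs\<close>

text \<open>The plane is the type \<^typ>\<open>complex\<close>. A plane graph has points as vertices and
  (the point sets of) arbitrary simple arcs as edges.\<close>

record plane_graph =
  pverts :: "complex set"
  parcs :: "complex set set"

text \<open>The equation on \<open>A \<inter> V\<close> says both that the endpoints of the arc are vertices and
  that its interior contains no vertex. Hence \<open>A \<inter> V\<close> is the set of the two ends of the
  edge \<open>A\<close>.\<close>

definition plane_edge :: "complex set \<Rightarrow> complex set \<Rightarrow> bool" where
  "plane_edge V A \<longleftrightarrow>
     (\<exists>g. arc g \<and> path_image g = A \<and> A \<inter> V = {pathstart g, pathfinish g})"

text \<open>Two edges meet at most in common ends, and no two edges have the same ends.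
  Loops are excluded because an arc has distinct endpoints.\<close>

definition is_plane_graph :: "plane_graph \<Rightarrow> bool" where
  "is_plane_graph P \<longleftrightarrow>
     finite (pverts P) \<and> finite (parcs P) \<and>
     (\<forall>A\<in>parcs P. plane_edge (pverts P) A) \<and>
     (\<forall>A\<in>parcs P. \<forall>B\<in>parcs P. A \<noteq> B \<longrightarrow>
        A \<inter> B \<subseteq> pverts P \<and> A \<inter> pverts P \<noteq> B \<inter> pverts P)"

definition skeleton :: "plane_graph \<Rightarrow> complex sgraph" where
  "skeleton P = \<lparr>verts = pverts P, edges = (\<lambda>A. A \<inter> pverts P) ` parcs P\<rparr>"

definition plane_subgraph :: "plane_graph \<Rightarrow> plane_graph \<Rightarrow> bool" where
  "plane_subgraph H G \<longleftrightarrow> pverts H \<subseteq> pverts G \<and> parcs H \<subseteq> parcs G"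

definition faces :: "plane_graph \<Rightarrow> complex set set" where
  "faces P = components (- (pverts P \<union> \<Union>(parcs P)))"

definition face_boundary :: "plane_graph \<Rightarrow> complex set \<Rightarrow> plane_graph" where
  "face_boundary P f =
     \<lparr>pverts = pverts P \<inter> frontier f, parcs = {A \<in> parcs P. A \<subseteq> frontier f}\<rparr>"


section \<open>Maximal planar and maximal plane graphs\<close>

definition planar :: "'a sgraph \<Rightarrow> bool" where
  "planar G \<longleftrightarrow> simple_graph G \<and> (\<exists>P. is_plane_graph P \<and> graph_iso G (skeleton P))"

definition maximal_planar :: "'a sgraph \<Rightarrow> bool" where
  "maximal_planar G \<longleftrightarrow> planar G \<and>
     (\<forall>u\<in>verts G. \<forall>v\<in>verts G. u \<noteq> v \<and> {u, v} \<notin> edges G \<longrightarrow>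
        \<not> planar (G\<lparr>edges := insert {u, v} (edges G)\<rparr>))"

definition maximal_plane :: "plane_graph \<Rightarrow> bool" where
  "maximal_plane P \<longleftrightarrow> is_plane_graph P \<and> maximal_planar (skeleton P)"

end

theory Submission
  imports Defs
begin

text \<open>Sufficiency: new vertices are stacked one at a time into triangular faces. If the
  distances from \<open>u\<close> to the corners of a face are not all exceeded by those from any other vertex
  \<open>v\<close> of \<open>H\<close>, this persists on the triangle in which the corner nearest to \<open>u\<close> is replaced by
  the new vertex, and the sum of the distances from \<open>u\<close> to the corners grows by one. As long as
  \<open>u\<close> has eccentricity below \<open>\<alpha>\<close>, stacking does not push any \<open>v\<close> beyond \<open>\<alpha>\<close>, so the process
  ends with every vertex of \<open>H\<close> at eccentricity \<open>\<alpha>\<close>.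
  Necessity: a vertex \<open>w\<close> of \<open>G\<close> at distance \<open>\<alpha>\<close> from \<open>u\<close> lies in a face of \<open>H\<close>, and a shortest
  path from any \<open>v\<close> to \<open>w\<close> last leaves \<open>H\<close> at a corner of that face. Distances in \<open>H\<close> and \<open>G\<close>
  agree because maximality joins the ends of every detour through a face.

  As edges are arbitrary arcs, the topology rests on Janiszewski's theorem: an arc on the boundary
  of a complementary region lies on it entirely and has only two sides, hence vertices are
  accessible from their faces and no face of a plane \<open>K\<^sub>4\<close> touches all four vertices. The latter
  bounds faces by triangles and shows that stacked graphs remain maximal planar.\<close>

section \<open>Arcs in the plane\<close>

text \<open>Maximal planarity speaks of the abstract graph. It yields an edge only after an arc for
  it has been drawn, which is why corners must be reachable from inside a face; and to see that a
  stacked graph is maximal, arbitrary drawings of it with one more edge have to be excluded, where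
  nothing is known about faces. The K4 obstruction is therefore formulated for a connected set with
  the four vertices in its closure. The nearest corner is the right one to give up: with s nearest
  to u, the new vertex x has distance d(u,s) + 1 from u, and d(v,x) \<le> d(v,s) + 1 for every v, so
  d(v,s) \<le> d(u,s) turns into d(v,x) \<le> d(u,x). The distances to the three corners stay at
  most \<alpha>, so their sum is at most 3\<alpha>, which limits the stacking. All this needs
  triangular faces; a graph with one or two vertices is first extended to a triangle, where every
  vertex lies on every face and is its own witness.\<close>

lemma connected_subset_singleton:
  assumes "A \<subseteq> {a}" shows "connected A"
  using subset_singletonD[OF assms] by auto

lemma path_image_arc_ends:
  "path_image g - {pathstart g, pathfinish g} \<subseteq> g ` {0<..<1}"
  by (force simp: path_image_def pathstart_def pathfinish_def less_eq_real_def)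

lemma arc_interior_image:
  assumes "arc g"
  shows "g ` {0<..<1} = path_image g - {pathstart g, pathfinish g}"
proof
  show "g ` {0<..<1} \<subseteq> path_image g - {pathstart g, pathfinish g}"
    using arc_imp_inj_on[OF assms]
    by (force simp: path_image_def pathstart_def pathfinish_def inj_on_def)
qed (rule path_image_arc_ends)

lemma arc_eq_iff:
  assumes "arc g" "x \<in> {0..1}" "y \<in> {0..1}"
  shows "g x = g y \<longleftrightarrow> x = y"
  using arc_imp_inj_on[OF assms(1)] assms(2,3) by (auto simp: inj_on_def)

lemma arc_segment:
  assumes "arc g" "0 \<le> a" "a \<le> b" "b \<le> 1"
  shows "compact (g ` {a..b})" "connected (g ` {a..b})" "g ` {a..b} \<subseteq> path_image g"
proof -
  have "continuous_on {a..b} g"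
    by (rule continuous_on_subset[of "{0..1}"])
      (use assms in \<open>auto simp: arc_def path_def\<close>)
  then show "compact (g ` {a..b})" "connected (g ` {a..b})"
    by (auto intro: compact_continuous_image connected_continuous_image)
  show "g ` {a..b} \<subseteq> path_image g"
    using assms by (auto simp: path_image_def)
qed

lemma connected_arc_segment_complement:
  fixes g :: "real \<Rightarrow> complex"
  assumes "arc g" "0 \<le> a" "a \<le> b" "b \<le> 1"
  shows "connected (- (g ` {a..b}))"
proof (cases "a = b")
  case True
  then show ?thesis by (simp add: connected_punctured_universe)
next
  case False
  then have "arc (subpath a b g)"
    using assms arc_subpath_arc[OF assms(1)] arc_imp_inj_on[OF assms(1)]
    by (intro arc_subpath_arc) (auto simp: inj_on_def)
  moreover have "path_image (subpath a b g) = g ` {a..b}"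
    using assms by (simp add: path_image_subpath)
  ultimately show ?thesis
    using connected_arc_complement[of "subpath a b g"] by simp
qed

text \<open>If the component missed some point of the arc in its closure, a small gap of the arc
  around that point could be opened without separating the component from the gap: by
  Janiszewski's theorem the two remaining pieces of the arc, each meeting the rest in at most
  one point, separate nothing.\<close>

lemma arc_subset_frontier_component:
  fixes g :: "real \<Rightarrow> complex"
  assumes "closed X" "arc g" and gX: "path_image g \<inter> X \<subseteq> {pathstart g, pathfinish g}"
    and p: "p \<notin> X \<union> path_image g" and t: "0 < t" "t < 1"
    and pt: "connected_component (- X) p (g t)"
  shows "path_image g \<subseteq> frontier (connected_component_set (- (X \<union> path_image g)) p)"
proof -
  define A where "A = path_image g"
  define C where "C = connected_component_set (- (X \<union> A)) p"
  have inj: "\<And>x y. \<lbrakk>x \<in> {0..1}; y \<in> {0..1}; g x = g y\<rbrakk> \<Longrightarrow> x = y"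
    using arc_imp_inj_on[OF \<open>arc g\<close>] by (auto simp: inj_on_def)
  have contg: "continuous_on {0..1} g"
    using \<open>arc g\<close> by (simp add: arc_def path_def)
  have gX': "s = 0 \<or> s = 1" if "g s \<in> X" "0 \<le> s" "s \<le> 1" for s
  proof -
    have "g s \<in> {pathstart g, pathfinish g}"
      using gX that by (force simp: path_image_def)
    then show ?thesis
      using inj[of s 0] inj[of s 1] that by (auto simp: pathstart_def pathfinish_def)
  qed
  have clA: "closed A" by (simp add: A_def \<open>arc g\<close> closed_arc_image)
  have frC: "frontier C \<subseteq> X \<union> A"
    unfolding C_def
    by (metis Un_absorb assms(1) clA closed_Un components_iff ComplI p A_def frontier_of_components_closed_complement)
  have pC: "p \<in> C" unfolding C_def A_def using p by simp
  have main: "g s \<in> frontier C" if s: "0 < s" "s < 1" for s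
  proof (rule ccontr)
    assume n: "g s \<notin> frontier C"
    have "open (- frontier C)" by (simp add: open_Compl frontier_closed)
    then have "openin (top_of_set {0..1}) ({0..1} \<inter> g -` (- frontier C))"
      using contg continuous_openin_preimage_gen by blast
    then obtain e where "e > 0" and e: "ball s e \<inter> {0..1} \<subseteq> {0..1} \<inter> g -` (- frontier C)"
      using s n unfolding openin_contains_ball
      by (metis ComplI IntI atLeastAtMost_iff less_eq_real_def vimageI)
    \<comment> \<open>Halving makes the closed gap from \<open>a\<close> to \<open>b\<close> fit
      strictly inside both the open parameter interval and the part free of
      \<open>frontier C\<close>.\<close>
    define d where "d = min e (min s (1 - s)) / 2"
    have d: "0 < d" "d < e" "d < s" "d < 1 - s"
      using s \<open>e > 0\<close> by (auto simp: d_def min_def)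
    define a where "a = s - d"
    define b where "b = s + d"
    have ab: "0 < a" "a < s" "s < b" "b < 1" using d by (auto simp: a_def b_def)
    have gab: "g r \<notin> frontier C" if "a \<le> r" "r \<le> b" for r
    proof -
      have "r \<in> ball s e \<inter> {0..1}"
        using that d unfolding a_def b_def by (auto simp: dist_real_def)
      with e show ?thesis by blast
    qed
    have cX: "connected_component (- X) p (g s)"
    proof -
      have "connected (g ` {0<..<1})"
        by (intro connected_continuous_image continuous_on_subset[OF contg]) auto
      moreover have "g ` {0<..<1} \<subseteq> - X" using gX' by force
      ultimately have "connected_component (- X) (g t) (g s)"
        using s t unfolding connected_component_def
        by (intro exI[of _ "g ` {0<..<1}"]) auto
      with pt show ?thesis by (rule connected_component_trans)
    qed
    have nA: "p \<notin> A" "p \<notin> X" using p by (auto simp: A_def)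
    have seg: "connected_component (- (g ` {c..d})) p (g s)"
      if "0 \<le> c" "c \<le> d" "d \<le> 1" "s \<notin> {c..d}" for c d
    proof -
      have "g s \<notin> g ` {c..d}" using that s by (auto simp: arc_eq_iff[OF \<open>arc g\<close>])
      moreover have "p \<notin> g ` {c..d}" using nA that by (auto simp: A_def path_image_def)
      ultimately show ?thesis
        using connected_arc_segment_complement[OF \<open>arc g\<close> that(1-3)]
        unfolding connected_component_def by blast
    qed
    \<comment> \<open>The two remaining pieces of the arc are removed one after the other. Neither
      piece alone separates \<open>p\<close> from \<open>g s\<close>, and each meets what was
      removed before in at most an end of the arc.\<close>
    have 1: "connected_component (- (g ` {0..a} \<union> X)) p (g s)"
    proof (rule Janiszewski)
      have "g ` {0..a} \<inter> X \<subseteq> {g 0}" using gX' ab by force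
      then show "connected (g ` {0..a} \<inter> X)" by (rule connected_subset_singleton)
    qed (use ab s \<open>closed X\<close> \<open>arc g\<close> cX in \<open>auto intro!: arc_segment seg\<close>)
    have 2: "connected_component (- (g ` {b..1} \<union> (g ` {0..a} \<union> X))) p (g s)"
    proof (rule Janiszewski)
      have "g ` {b..1} \<inter> g ` {0..a} = {}" using ab s by (auto simp: arc_eq_iff[OF \<open>arc g\<close>])
      then have "g ` {b..1} \<inter> (g ` {0..a} \<union> X) \<subseteq> {g 1}" using gX' ab by force
      then show "connected (g ` {b..1} \<inter> (g ` {0..a} \<union> X))" by (rule connected_subset_singleton)
      show "closed (g ` {0..a} \<union> X)"
        using ab s \<open>closed X\<close> \<open>arc g\<close> by (intro closed_Un[OF compact_imp_closed[OF arc_segment(1)]]) auto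
    qed (use ab s \<open>closed X\<close> \<open>arc g\<close> 1 in \<open>auto intro!: arc_segment seg\<close>)
    then obtain Z where Z: "connected Z" "Z \<subseteq> - (g ` {b..1} \<union> (g ` {0..a} \<union> X))" "p \<in> Z" "g s \<in> Z"
      unfolding connected_component_def by blast
    have "g s \<notin> C"
      using s unfolding C_def A_def by (auto simp: path_image_def dest!: connected_component_in)
    \<comment> \<open>The connection leaves \<open>C\<close> on its way to \<open>g s\<close>, at a
      point of \<open>X \<union> A\<close>. As it avoids \<open>X\<close> and both pieces, this
      point would have to lie in the gap.\<close>
    then obtain z where z: "z \<in> Z" "z \<in> frontier C"
      using connected_Int_frontier[OF Z(1), of C] Z pC by blast
    then have "z \<in> A" using frC Z(2) by blast
    then obtain r where r: "z = g r" "0 \<le> r" "r \<le> 1" by (auto simp: A_def path_image_def)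
    then have "a \<le> r" "r \<le> b" using z Z(2) ab
      by (metis ComplD UnI1 UnI2 atLeastAtMost_iff imageI linear subsetD)+
    with gab z r show False by blast
  qed
  have "g ` {0<..<1} \<subseteq> frontier C" using main by auto
  \<comment> \<open>The frontier is closed, so the ends of the arc follow by continuity.\<close>
  then have "closure (g ` {0<..<1}) \<subseteq> frontier C"
    by (simp add: closure_minimal frontier_closed)
  moreover have "g ` closure {0<..<1} \<subseteq> closure (g ` {0<..<1})"
    using contg by (intro image_closure_subset) (auto simp: closure_subset)
  ultimately show ?thesis
    unfolding C_def A_def path_image_def by auto
qed

text \<open>The case of an empty \<open>X\<close>: the complement of an arc is connected, so the
  component of any point is the whole complement.\<close>

lemma frontier_arc_complement:
  fixes g :: "real \<Rightarrow> complex"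
  assumes "arc g" shows "frontier (- path_image g) = path_image g"
proof
  show "frontier (- path_image g) \<subseteq> path_image g"
    using assms by (simp add: closed_arc_image frontier_subset_closed)
  obtain p where p: "p \<notin> path_image g"
    using assms bounded_arc_image not_bounded_UNIV by (metis UNIV_eq_I)
  have "path_image g \<subseteq> frontier (connected_component_set (- ({} \<union> path_image g)) p)"
    by (rule arc_subset_frontier_component[of _ _ _ "1/2"])
      (use assms p in \<open>auto simp: connected_component_def\<close>)
  moreover have "connected_component_set (- path_image g) p = - path_image g"
    using p assms by (metis ComplI DIM_complex connected_arc_complement connected_component_eq_self order_refl)
  ultimately show "path_image g \<subseteq> frontier (- path_image g)" by simp
qed

lemma arc_near_point:
  fixes g :: "real \<Rightarrow> 'a::metric_space"
  assumes "path g" "0 < t" "t < 1" "0 < e"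
  obtains a b where "0 < a" "a < t" "t < b" "b < 1" "g ` {a..b} \<subseteq> ball (g t) e"
proof -
  have "continuous_on {0..1} g"
    using \<open>path g\<close> by (simp add: path_def)
  then obtain d where "d > 0" and d: "\<And>x. \<lbrakk>x \<in> {0..1}; dist x t < d\<rbrakk> \<Longrightarrow> dist (g x) (g t) < e"
    using assms unfolding continuous_on_iff by (metis atLeastAtMost_iff less_eq_real_def)
  define k where "k = min d (min t (1 - t)) / 2"
  have k: "0 < k" "k < d" "k < t" "k < 1 - t"
    using assms \<open>d > 0\<close> by (auto simp: k_def min_def)
  have "g ` {t - k..t + k} \<subseteq> ball (g t) e"
  proof
    fix z assume "z \<in> g ` {t - k..t + k}"
    then obtain x where x: "z = g x" "t - k \<le> x" "x \<le> t + k" by auto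
    then have "x \<in> {0..1}" "dist x t < d" using k by (auto simp: dist_real_def)
    then have "dist (g x) (g t) < e" by (rule d)
    then show "z \<in> ball (g t) e" by (simp add: x dist_commute)
  qed
  with k show thesis by (intro that[of "t - k" "t + k"]) auto
qed

text \<open>The middle of the arc is completed to a Jordan curve through its (connected) complement.
  For points near \<open>g t\<close> lying on the same side of that curve, Janiszewski's theorem confines a
  connection to the small ball.\<close>

lemma arc_locally_two_sided:
  fixes g :: "real \<Rightarrow> complex"
  assumes "arc g" "0 < t" "t < 1" "0 < e"
  obtains d where "0 < d"
    "\<And>p q r. \<lbrakk>p \<in> ball (g t) d - path_image g; q \<in> ball (g t) d - path_image g;
               r \<in> ball (g t) d - path_image g\<rbrakk>
      \<Longrightarrow> connected_component (ball (g t) e - path_image g) p q \<or>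
          connected_component (ball (g t) e - path_image g) q r \<or>
          connected_component (ball (g t) e - path_image g) p r"
proof -
  define A where "A = path_image g"
  note eq = arc_eq_iff[OF \<open>arc g\<close>]
  have Ag: "A = g ` {0..1}" by (simp add: A_def path_image_def)
  have frA: "frontier (- A) = A" unfolding A_def by (rule frontier_arc_complement[OF \<open>arc g\<close>])
  have opA: "open (- A)" unfolding A_def
    by (simp add: \<open>arc g\<close> closed_arc_image open_Compl)
  have coA: "connected (- A)" unfolding A_def
    using \<open>arc g\<close> by (simp add: connected_arc_complement)
  \<comment> \<open>\<open>U\<close> and \<open>V\<close> are the open parts of the arc before and
    after \<open>g t\<close>. Accessible frontier points are dense, so both parts contain one, and a
    crosscut \<open>h\<close> through the complement closes the arc up around
    \<open>g t\<close>.\<close>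
  define U where "U = g ` {0<..<t}"
  define V where "V = g ` {t<..<1}"
  have U_eq: "U = A - (g ` {t..1} \<union> {g 0})"
  proof
    show "U \<subseteq> A - (g ` {t..1} \<union> {g 0})"
      using assms by (auto simp: U_def Ag eq)
    show "A - (g ` {t..1} \<union> {g 0}) \<subseteq> U"
    proof
      fix z assume z: "z \<in> A - (g ` {t..1} \<union> {g 0})"
      then obtain x where x: "z = g x" "0 \<le> x" "x \<le> 1" by (auto simp: Ag)
      then have "x \<noteq> 0" "\<not> t \<le> x" using z by auto
      with x show "z \<in> U" by (auto simp: U_def)
    qed
  qed
  have V_eq: "V = A - (g ` {0..t} \<union> {g 1})"
  proof
    show "V \<subseteq> A - (g ` {0..t} \<union> {g 1})"
      using assms by (auto simp: V_def Ag eq)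
    show "A - (g ` {0..t} \<union> {g 1}) \<subseteq> V"
    proof
      fix z assume z: "z \<in> A - (g ` {0..t} \<union> {g 1})"
      then obtain x where x: "z = g x" "0 \<le> x" "x \<le> 1" by (auto simp: Ag)
      then have "x \<noteq> 1" "\<not> x \<le> t" using z by auto
      with x show "z \<in> V" by (auto simp: V_def)
    qed
  qed
  have segcl: "closed (g ` {a..b})" if "0 \<le> a" "a \<le> b" "b \<le> 1" for a b
    using arc_segment(1)[OF \<open>arc g\<close> that] by (rule compact_imp_closed)
  have opU: "openin (top_of_set (frontier (- A))) U"
    unfolding frA U_eq using assms
    by (intro openin_diff openin_subtopology_self closed_subset closed_Un segcl) (auto simp: Ag)
  have opV: "openin (top_of_set (frontier (- A))) V"
    unfolding frA V_eq using assms
    by (intro openin_diff openin_subtopology_self closed_subset closed_Un segcl) (auto simp: Ag)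
  have ne: "U \<noteq> {}" "V \<noteq> {}" using assms by (auto simp: U_def V_def)
  have "g (t/2) \<in> U" "g (t/2) \<notin> V"
    using assms by (auto simp: U_def V_def eq)
  then have "U \<noteq> V" by blast
  then obtain h where h: "arc h" "pathstart h \<in> U" "pathfinish h \<in> V" "h ` {0<..<1} \<subseteq> - A"
    using dense_accessible_frontier_point_pairs[OF opA coA opU opV ne] by metis
  obtain s1 where s1: "0 < s1" "s1 < t" "pathstart h = g s1" using h(2) by (auto simp: U_def)
  obtain s2 where s2: "t < s2" "s2 < 1" "pathfinish h = g s2" using h(3) by (auto simp: V_def)
  define H where "H = path_image h"
  have H_int: "H \<inter> A \<subseteq> {g s1, g s2}"
    using path_image_arc_ends[of h] h(4) s1 s2 by (auto simp: H_def)
  define M where "M = g ` {s1..s2}"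
  have sub: "arc (subpath s1 s2 g)" "path_image (subpath s1 s2 g) = M"
    using s1 s2 arc_imp_inj_on[OF \<open>arc g\<close>]
    by (auto simp: M_def path_image_subpath intro!: arc_subpath_arc \<open>arc g\<close>)
  define c where "c = subpath s1 s2 g +++ reversepath h"
  define C where "C = path_image c"
  have MA: "M \<subseteq> A" using s1 s2 by (auto simp: M_def Ag)
  have simp_c: "simple_path c" unfolding c_def
  proof (rule simple_path_join_loop)
    show "path_image (subpath s1 s2 g) \<inter> path_image (reversepath h)
          \<subseteq> {pathstart (subpath s1 s2 g), pathstart (reversepath h)}"
      using H_int MA sub by (auto simp: H_def s1 s2)
  qed (use sub h s1 s2 in \<open>auto simp: arc_reversepath\<close>)
  have loop: "pathfinish c = pathstart c" by (simp add: c_def s1)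
  have C_eq: "C = M \<union> H"
    unfolding C_def c_def H_def using sub by (subst path_image_join) (auto simp: s2)
  have gt: "g t \<notin> H \<union> g ` {0..s1} \<union> g ` {s2..1}"
    using H_int s1 s2 assms by (auto simp: eq Ag)
  have clF: "closed (H \<union> g ` {0..s1} \<union> g ` {s2..1})"
    unfolding H_def using h s1 s2
    by (intro closed_Un segcl) (auto simp: closed_arc_image)
  \<comment> \<open>Inside this ball the arc and the Jordan curve \<open>C\<close> coincide, because
    the crosscut and both outer parts of the arc are kept out.\<close>
  then obtain e0 where "e0 > 0" and e0: "ball (g t) e0 \<inter> (H \<union> g ` {0..s1} \<union> g ` {s2..1}) = {}"
    using gt by (metis Int_commute closed_def ComplI open_contains_ball disjoint_eq_subset_Compl)
  define e1 where "e1 = min e e0"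
  have "e1 > 0" using assms \<open>e0 > 0\<close> by (simp add: e1_def)
  obtain a0 b0 where ab0: "0 < a0" "a0 < t" "t < b0" "b0 < 1" "g ` {a0..b0} \<subseteq> ball (g t) e1"
    using arc_near_point[OF arc_imp_path[OF \<open>arc g\<close>] _ _ \<open>e1 > 0\<close>, of t] assms by auto
  define a where "a = max a0 s1"
  define b where "b = min b0 s2"
  have ab: "s1 \<le> a" "a < t" "t < b" "b \<le> s2" "g ` {a..b} \<subseteq> ball (g t) e1"
    using ab0 s1 s2 by (auto simp: a_def b_def)
  \<comment> \<open>The part of \<open>C\<close> away from \<open>g t\<close>. The crosscut keeps it
    connected, and connectedness is what Janiszewski's theorem requires of the intersection
    below.\<close>
  define R where "R = H \<union> g ` {s1..a} \<union> g ` {b..s2}"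
  have conR: "connected R"
  proof -
    have "g s1 \<in> H" "g s2 \<in> H"
      using s1 s2 by (auto simp: H_def) (metis pathstart_in_path_image pathfinish_in_path_image)+
    moreover have "connected H" unfolding H_def by (simp add: h(1) connected_arc_image)
    ultimately show ?thesis unfolding R_def
      using s1 s2 ab by (intro connected_Un arc_segment[OF \<open>arc g\<close>]) auto
  qed
  have clR: "closed R"
    unfolding R_def H_def using h s1 s2 ab
    by (intro closed_Un segcl) (auto simp: closed_arc_image)
  have gtR: "g t \<notin> R"
    using gt s1 s2 ab assms by (auto simp: R_def eq)
  then obtain d0 where "d0 > 0" and d0: "ball (g t) d0 \<inter> R = {}"
    using clR by (metis Int_commute closed_def ComplI open_contains_ball disjoint_eq_subset_Compl)
  define d where "d = min d0 e1"
  have "d > 0" using \<open>d0 > 0\<close> \<open>e1 > 0\<close> by (simp add: d_def)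
  have CR: "C - R \<subseteq> ball (g t) e1"
  proof
    fix z assume z: "z \<in> C - R"
    then obtain x where x: "z = g x" "s1 \<le> x" "x \<le> s2" by (auto simp: C_eq M_def R_def)
    then have "\<not> x \<le> a" "\<not> b \<le> x" using z by (auto simp: R_def)
    with x ab show "z \<in> ball (g t) e1" by (auto simp: image_subset_iff)
  qed
  have RC: "R \<subseteq> C" using s1 s2 ab by (auto simp: R_def C_eq M_def)
  have key: "connected_component (ball (g t) e - A) p q"
    if pq: "p \<in> ball (g t) d - A" "q \<in> ball (g t) d - A" "connected_component (- C) p q" for p q
  proof -
    \<comment> \<open>Two closed sets each fail to separate \<open>p\<close> from \<open>q\<close>:
      the curve \<open>C\<close> by assumption, and \<open>R\<close> together with the outside of
      the ball because both points lie in a smaller ball. Their intersection is exactly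
      \<open>R\<close>, as the rest of \<open>C\<close> is near \<open>g t\<close>.\<close>
    have "connected_component (- (C \<union> (R \<union> - ball (g t) e1))) p q"
    proof (rule Janiszewski)
      show "compact C" unfolding C_def by (simp add: compact_simple_path_image simp_c)
      show "closed (R \<union> - ball (g t) e1)" using clR by (simp add: closed_Compl closed_Un)
      have "C \<inter> (R \<union> - ball (g t) e1) = R" using CR RC by blast
      then show "connected (C \<inter> (R \<union> - ball (g t) e1))" using conR by simp
      have "ball (g t) d \<subseteq> - (R \<union> - ball (g t) e1)" using d0 by (auto simp: d_def)
      then show "connected_component (- (R \<union> - ball (g t) e1)) p q"
        using pq unfolding connected_component_def by (meson DiffD1 connected_ball)
    qed (rule pq)
    moreover have "- (C \<union> (R \<union> - ball (g t) e1)) \<subseteq> ball (g t) e - A"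
    proof
      fix z assume z: "z \<in> - (C \<union> (R \<union> - ball (g t) e1))"
      have "z \<notin> A"
      proof
        assume "z \<in> A"
        then obtain x where x: "z = g x" "0 \<le> x" "x \<le> 1" by (auto simp: Ag)
        moreover have "\<not> (s1 \<le> x \<and> x \<le> s2)" using z x by (auto simp: C_eq M_def)
        ultimately have "z \<in> g ` {0..s1} \<union> g ` {s2..1}" by auto
        with z e0 show False by (auto simp: e1_def)
      qed
      with z show "z \<in> ball (g t) e - A" by (auto simp: e1_def)
    qed
    ultimately show ?thesis by (rule connected_component_of_subset)
  qed
  obtain I J where IJ: "connected I" "connected J" "I \<union> J = - C"
    using Jordan_curve[OF simp_c loop] unfolding C_def by metis
  have dC: "ball (g t) d - A \<subseteq> - C"
    using e0 by (auto simp: C_eq d_def e1_def dest: subsetD[OF MA])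
  show thesis
  proof (rule that[OF \<open>d > 0\<close>])
    fix p q r
    assume *: "p \<in> ball (g t) d - path_image g" "q \<in> ball (g t) d - path_image g"
      "r \<in> ball (g t) d - path_image g"
    have same: "connected_component (- C) x y" if "x \<in> I \<and> y \<in> I \<or> x \<in> J \<and> y \<in> J" for x y
      using that IJ unfolding connected_component_def by blast
    have "p \<in> I \<union> J" "q \<in> I \<union> J" "r \<in> I \<union> J" using * dC IJ(3) unfolding A_def by blast+
    then have "connected_component (- C) p q \<or> connected_component (- C) q r \<or> connected_component (- C) p r"
      using same by blast
    then show "connected_component (ball (g t) e - path_image g) p q \<or>
          connected_component (ball (g t) e - path_image g) q r \<or>
          connected_component (ball (g t) e - path_image g) p r"
      using key * unfolding A_def by blast
  qed
qed

text \<open>Were the three points pairwise separated, the arc would lie on the frontier of three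
  different components. All three would come arbitrarily close to \<open>g t\<close>, where the arc
  has only two sides.\<close>

lemma arc_splits_component_in_two:
  fixes g :: "real \<Rightarrow> complex"
  assumes "closed X" "arc g" and gX: "path_image g \<inter> X \<subseteq> {pathstart g, pathfinish g}"
    and pqr: "p \<notin> X \<union> path_image g" "q \<notin> X \<union> path_image g" "r \<notin> X \<union> path_image g"
    and t: "0 < t" "t < 1"
    and cc: "connected_component (- X) p (g t)" "connected_component (- X) q (g t)"
      "connected_component (- X) r (g t)"
  shows "connected_component (- (X \<union> path_image g)) p q \<or>
    connected_component (- (X \<union> path_image g)) q r \<or>
    connected_component (- (X \<union> path_image g)) p r"
proof -
  have gt: "g t \<notin> X" using cc(1) connected_component_in by fastforce
  then obtain e where e: "e > 0" "ball (g t) e \<inter> X = {}"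
    using \<open>closed X\<close> by (metis Int_commute closed_def ComplI open_contains_ball disjoint_eq_subset_Compl)
  obtain d where d: "d > 0"
    "\<And>p q r. \<lbrakk>p \<in> ball (g t) d - path_image g; q \<in> ball (g t) d - path_image g;
               r \<in> ball (g t) d - path_image g\<rbrakk>
      \<Longrightarrow> connected_component (ball (g t) e - path_image g) p q \<or>
          connected_component (ball (g t) e - path_image g) q r \<or>
          connected_component (ball (g t) e - path_image g) p r"
    using arc_locally_two_sided[OF \<open>arc g\<close> t \<open>e > 0\<close>] by metis
  have near: "\<exists>x'. connected_component (- (X \<union> path_image g)) x x' \<and> x' \<in> ball (g t) d - path_image g"
    if "x \<notin> X \<union> path_image g" "connected_component (- X) x (g t)" for x
  proof -
    have "path_image g \<subseteq> frontier (connected_component_set (- (X \<union> path_image g)) x)"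
      by (rule arc_subset_frontier_component[OF \<open>closed X\<close> \<open>arc g\<close> gX that(1) t that(2)])
    moreover have "g t \<in> path_image g" using t by (simp add: path_image_def)
    ultimately have "g t \<in> closure (connected_component_set (- (X \<union> path_image g)) x)"
      by (auto simp: frontier_def)
    then obtain x' where "x' \<in> connected_component_set (- (X \<union> path_image g)) x" "dist x' (g t) < d"
      using \<open>d > 0\<close> by (auto simp: closure_approachable)
    then show ?thesis
      using connected_component_in[of _ x x'] by (auto simp: dist_commute)
  qed
  obtain p' q' r' where
    n: "connected_component (- (X \<union> path_image g)) p p'" "p' \<in> ball (g t) d - path_image g"
      "connected_component (- (X \<union> path_image g)) q q'" "q' \<in> ball (g t) d - path_image g"
      "connected_component (- (X \<union> path_image g)) r r'" "r' \<in> ball (g t) d - path_image g"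
    using near[OF pqr(1) cc(1)] near[OF pqr(2) cc(2)] near[OF pqr(3) cc(3)] by blast
  have sub: "ball (g t) e - path_image g \<subseteq> - (X \<union> path_image g)" using e by blast
  have "connected_component (- (X \<union> path_image g)) p' q' \<or>
    connected_component (- (X \<union> path_image g)) q' r' \<or>
    connected_component (- (X \<union> path_image g)) p' r'"
    using d(2)[OF n(2,4,6)] connected_component_of_subset[OF _ sub] by blast
  then show ?thesis
    using n(1,3,5) by (metis connected_component_sym connected_component_trans)
qed

text \<open>Edges of plane graphs are point sets, so arcs are handled through their image and ends;
  a parametrisation is chosen only inside proofs.\<close>

definition arc_between :: "complex set \<Rightarrow> complex \<Rightarrow> complex \<Rightarrow> bool" where
  "arc_between A u v \<longleftrightarrow> (\<exists>g. arc g \<and> path_image g = A \<and> pathstart g = u \<and> pathfinish g = v)"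

lemma arc_between_sym: "arc_between A u v \<Longrightarrow> arc_between A v u"
  unfolding arc_between_def
  by (metis arc_reversepath path_image_reversepath pathfinish_reversepath pathstart_reversepath)

lemma arc_between_ends:
  assumes "arc_between A u v" shows "u \<in> A" "v \<in> A" "u \<noteq> v"
  using assms unfolding arc_between_def by (auto dest: arc_distinct_ends)

lemma arc_between_compact: "arc_between A u v \<Longrightarrow> compact A"
  unfolding arc_between_def by (auto simp: compact_arc_image)

lemma arc_between_closed: "arc_between A u v \<Longrightarrow> closed A"
  by (simp add: arc_between_compact compact_imp_closed)

lemma arc_between_interior:
  assumes "arc_between A u v"
  shows "connected (A - {u, v})" "A - {u, v} \<noteq> {}" "closure (A - {u, v}) = A"
proof -
  obtain g where g: "arc g" "path_image g = A" "pathstart g = u" "pathfinish g = v"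
    using assms unfolding arc_between_def by blast
  have eq: "g ` {0<..<1} = A - {u, v}" using arc_interior_image[OF g(1)] g by simp
  have contg: "continuous_on {0..1} g"
    using \<open>arc g\<close> by (simp add: arc_def path_def)
  have "connected (g ` {0<..<1})"
    by (intro connected_continuous_image continuous_on_subset[OF contg]) auto
  then show "connected (A - {u, v})" by (simp add: eq)
  have "g (1/2) \<in> g ` {0<..<1}" by simp
  then show "A - {u, v} \<noteq> {}" unfolding eq by blast
  have "g ` closure {0<..<1} \<subseteq> closure (g ` {0<..<1})"
    using contg by (intro image_closure_subset) (auto simp: closure_subset)
  then have "A \<subseteq> closure (A - {u, v})" unfolding eq using g by (simp add: path_image_def)
  moreover have "closure (A - {u, v}) \<subseteq> A"
    using arc_between_closed[OF assms] by (simp add: closure_minimal)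
  ultimately show "closure (A - {u, v}) = A" by simp
qed

lemma arc_between_join:
  assumes "arc_between A u v" "arc_between B v w" "A \<inter> B \<subseteq> {v}"
  shows "arc_between (A \<union> B) u w"
proof -
  obtain g h where g: "arc g" "path_image g = A" "pathstart g = u" "pathfinish g = v"
    and h: "arc h" "path_image h = B" "pathstart h = v" "pathfinish h = w"
    using assms unfolding arc_between_def by blast
  have "arc (g +++ h)" using assms(3) g h by (intro arc_join) auto
  then show ?thesis unfolding arc_between_def
    using g h by (intro exI[of _ "g +++ h"]) (simp add: path_image_join)
qed

section \<open>Jordan curves, theta graphs and the plane K4\<close>

lemma connected_subset_if_disjoint_frontier:
  assumes "connected Z" "Z \<inter> W \<noteq> {}" "Z \<inter> frontier W = {}"
  shows "Z \<subseteq> W"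
  using connected_Int_frontier[OF assms(1,2)] assms(3) by blast

lemma jordan_curve_arcs:
  assumes "arc_between P a b" "arc_between Q a b" "P \<inter> Q = {a, b}"
  obtains I J where "open I" "connected I" "I \<noteq> {}" "frontier I = P \<union> Q"
    "open J" "connected J" "J \<noteq> {}" "frontier J = P \<union> Q"
    "I \<inter> J = {}" "I \<union> J = - (P \<union> Q)"
proof -
  obtain g h where g: "arc g" "path_image g = P" "pathstart g = a" "pathfinish g = b"
    and h: "arc h" "path_image h = Q" "pathstart h = a" "pathfinish h = b"
    using assms unfolding arc_between_def by blast
  have s: "simple_path (g +++ reversepath h)"
    by (rule simple_path_join_loop) (use g h assms in \<open>auto simp: arc_reversepath\<close>)
  have l: "pathfinish (g +++ reversepath h) = pathstart (g +++ reversepath h)" using g h by simp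
  have im: "path_image (g +++ reversepath h) = P \<union> Q" using g h by (simp add: path_image_join)
  show thesis
    using Jordan_curve[OF s l, unfolded im] that by metis
qed

text \<open>The connected set lies on one side of the Jordan curve, so the other side will do: its
  closure adds only the curve itself.\<close>

lemma jordan_side_avoiding:
  assumes "arc_between P a b" "arc_between Q a b" "P \<inter> Q = {a, b}"
    and "connected S" "S \<inter> (P \<union> Q) = {}"
  obtains W where "open W" "connected W" "W \<noteq> {}" "frontier W = P \<union> Q" "W \<inter> (P \<union> Q) = {}"
    "closure W \<inter> S = {}"
proof -
  obtain I J where IJ: "open I" "connected I" "I \<noteq> {}" "frontier I = P \<union> Q"
    "open J" "connected J" "J \<noteq> {}" "frontier J = P \<union> Q"
    "I \<inter> J = {}" "I \<union> J = - (P \<union> Q)"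
    using jordan_curve_arcs[OF assms(1-3)] by metis
  have "S \<subseteq> I \<or> S \<inter> I = {}"
    using connected_subset_if_disjoint_frontier[OF assms(4), of I] IJ(4) assms(5) by blast
  then show thesis
  proof
    assume "S \<subseteq> I"
    moreover have "closure J = J \<union> (P \<union> Q)" using IJ by (metis closure_Un_frontier)
    ultimately show thesis using IJ assms(5) by (intro that[of J]) auto
  next
    assume "S \<inter> I = {}"
    moreover have "closure I = I \<union> (P \<union> Q)" using IJ by (metis closure_Un_frontier)
    ultimately show thesis using IJ assms(5) by (intro that[of I]) auto
  qed
qed

text \<open>Adding \<open>P1\<close> to the Jordan curve \<open>P2 \<union> P3\<close> splits only one of its sides, and only into
  two: the side of \<open>P1 \<union> P2\<close> away from \<open>P3\<close> and the side of \<open>P1 \<union> P3\<close> away from \<open>P2\<close>.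
  Neither of them has points of both \<open>P2\<close> and \<open>P3\<close> on its boundary.\<close>

lemma theta_graph_face:
  assumes P: "arc_between P1 a b" "arc_between P2 a b" "arc_between P3 a b"
    and P12: "P1 \<inter> P2 = {a, b}" and P13: "P1 \<inter> P3 = {a, b}" and P23: "P2 \<inter> P3 = {a, b}"
    and C: "connected C" "C \<inter> (P1 \<union> P2 \<union> P3) = {}"
    and x2: "x2 \<in> closure C" "x2 \<in> P2 - {a, b}"
    and x3: "x3 \<in> closure C" "x3 \<in> P3 - {a, b}"
    and p: "p \<in> C" and y: "y \<in> P1 - {a, b}"
  shows "\<not> connected_component (- (P2 \<union> P3)) p y"
proof
  assume py: "connected_component (- (P2 \<union> P3)) p y"
  obtain W2 where W2: "open W2" "connected W2" "W2 \<noteq> {}" "frontier W2 = P1 \<union> P2"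
    "W2 \<inter> (P1 \<union> P2) = {}" "closure W2 \<inter> (P3 - {a, b}) = {}"
    by (rule jordan_side_avoiding[OF P(1,2) P12 arc_between_interior(1)[OF P(3)]])
       (use P13 P23 in blast)+
  obtain W3 where W3: "open W3" "connected W3" "W3 \<noteq> {}" "frontier W3 = P1 \<union> P3"
    "W3 \<inter> (P1 \<union> P3) = {}" "closure W3 \<inter> (P2 - {a, b}) = {}"
    by (rule jordan_side_avoiding[OF P(1,3) P13 arc_between_interior(1)[OF P(2)]])
       (use P12 P23 in blast)+
  have W2c: "W2 \<inter> (P1 \<union> P2 \<union> P3) = {}"
    using W2(5,6) P12 closure_subset[of W2] by blast
  have W3c: "W3 \<inter> (P1 \<union> P2 \<union> P3) = {}"
    using W3(5,6) P13 closure_subset[of W3] by blast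
  obtain q where q: "q \<in> W2" using W2 by blast
  obtain r where r: "r \<in> W3" using W3 by blast
  obtain g where g: "arc g" "path_image g = P1" "pathstart g = a" "pathfinish g = b"
    using P(1) unfolding arc_between_def by blast
  have "y \<in> g ` {0<..<1}" using arc_interior_image[OF g(1)] g y by simp
  then obtain t where t: "0 < t" "t < 1" "y = g t" by auto
  \<comment> \<open>A point \<open>y\<close> inside \<open>P1\<close> belongs to the closure of each
    side bounded by \<open>P1\<close>, and it misses \<open>P2\<close> and \<open>P3\<close>. Hence
    both sides lie in the component of \<open>y\<close> before \<open>P1\<close> is added.\<close>
  have reach: "connected_component (- (P2 \<union> P3)) z (g t)"
    if "connected W" "P1 \<subseteq> frontier W" "W \<inter> (P1 \<union> P2 \<union> P3) = {}" "z \<in> W" for W z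
  proof -
    have "y \<in> closure W" using that(2) y by (auto simp: frontier_def)
    then have "connected (insert y W)"
      using closure_subset by (intro connected_intermediate_closure[OF that(1)]) auto
    moreover have "insert y W \<subseteq> - (P2 \<union> P3)" using that(3) y P12 P13 by auto
    ultimately show ?thesis
      unfolding connected_component_def using that(4) t by (intro exI[of _ "insert y W"]) auto
  qed
  \<comment> \<open>\<open>p\<close>, \<open>q\<close> and \<open>r\<close> share a component before
    \<open>P1\<close> is added, so two of them still do afterwards. In each case a connected set is
    trapped in a side whose closure misses the interior of \<open>P2\<close> or of
    \<open>P3\<close>.\<close>
  have "connected_component (- ((P2 \<union> P3) \<union> path_image g)) p q \<or>
    connected_component (- ((P2 \<union> P3) \<union> path_image g)) q r \<or>
    connected_component (- ((P2 \<union> P3) \<union> path_image g)) p r"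
  proof (rule arc_splits_component_in_two[OF _ g(1) _ _ _ _ t(1,2)])
    show "connected_component (- (P2 \<union> P3)) q (g t)"
      by (rule reach[OF W2(2) _ W2c q]) (simp add: W2(4))
    show "connected_component (- (P2 \<union> P3)) r (g t)"
      by (rule reach[OF W3(2) _ W3c r]) (simp add: W3(4))
    show "connected_component (- (P2 \<union> P3)) p (g t)" using py t by simp
    show "closed (P2 \<union> P3)" using P by (intro closed_Un arc_between_closed)
    show "path_image g \<inter> (P2 \<union> P3) \<subseteq> {pathstart g, pathfinish g}" using g P12 P13 by auto
    show "p \<notin> P2 \<union> P3 \<union> path_image g" "q \<notin> P2 \<union> P3 \<union> path_image g" "r \<notin> P2 \<union> P3 \<union> path_image g"
      using C p q r W2c W3c g by auto
  qed
  moreover have False if pq: "connected_component (- ((P2 \<union> P3) \<union> path_image g)) p q"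
  proof -
    obtain Z where Z: "connected Z" "Z \<subseteq> - ((P2 \<union> P3) \<union> path_image g)" "p \<in> Z" "q \<in> Z"
      using pq unfolding connected_component_def by blast
    have "connected (C \<union> Z)" using C Z p by (intro connected_Un) auto
    then have "C \<union> Z \<subseteq> W2"
      using Z q C g W2(4) by (intro connected_subset_if_disjoint_frontier) auto
    then have "closure C \<subseteq> closure W2" by (intro closure_mono) auto
    with x3 W2(6) show False by blast
  qed
  moreover have False if pr: "connected_component (- ((P2 \<union> P3) \<union> path_image g)) p r"
  proof -
    obtain Z where Z: "connected Z" "Z \<subseteq> - ((P2 \<union> P3) \<union> path_image g)" "p \<in> Z" "r \<in> Z"
      using pr unfolding connected_component_def by blast
    have "connected (C \<union> Z)" using C Z p by (intro connected_Un) auto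
    then have "C \<union> Z \<subseteq> W3"
      using Z r C g W3(4) by (intro connected_subset_if_disjoint_frontier) auto
    then have "closure C \<subseteq> closure W3" by (intro closure_mono) auto
    with x2 W3(6) show False by blast
  qed
  moreover have False if qr: "connected_component (- ((P2 \<union> P3) \<union> path_image g)) q r"
  proof -
    obtain Z where Z: "connected Z" "Z \<subseteq> - ((P2 \<union> P3) \<union> path_image g)" "q \<in> Z" "r \<in> Z"
      using qr unfolding connected_component_def by blast
    have "connected (W3 \<union> Z)" using W3 Z r by (intro connected_Un) auto
    then have "W3 \<union> Z \<subseteq> W2"
      using Z q W3c g W2(4) by (intro connected_subset_if_disjoint_frontier) auto
    then have "closure W3 \<subseteq> closure W2" by (intro closure_mono) auto
    moreover have "x3 \<in> closure W3" using x3 W3(4) by (auto simp: frontier_def)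
    ultimately show False using x3 W2(6) by blast
  qed
  ultimately show False by blast
qed

text \<open>With \<open>Q\<close> the four-cycle \<open>a c b d\<close>, the theta graphs \<open>Q \<union> ab\<close> and \<open>Q \<union> cd\<close> show that
  \<open>C\<close> and the interiors of \<open>ab\<close> and \<open>cd\<close> lie in three different components of the complement of
  the Jordan curve \<open>Q\<close>.\<close>

lemma plane_K4_face:
  assumes ends: "arc_between Aab a b" "arc_between Aac a c" "arc_between Aad a d"
      "arc_between Abc b c" "arc_between Abd b d" "arc_between Acd c d"
    and dist: "distinct [a, b, c, d]"
    and opp: "Aab \<inter> Acd = {}" "Aac \<inter> Abd = {}" "Aad \<inter> Abc = {}"
    and adj: "Aab \<inter> Aac = {a}" "Aab \<inter> Aad = {a}" "Aac \<inter> Aad = {a}"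
      "Aab \<inter> Abc = {b}" "Aab \<inter> Abd = {b}" "Abc \<inter> Abd = {b}"
      "Aac \<inter> Abc = {c}" "Aac \<inter> Acd = {c}" "Abc \<inter> Acd = {c}"
      "Aad \<inter> Abd = {d}" "Aad \<inter> Acd = {d}" "Abd \<inter> Acd = {d}"
    and C: "connected C" "C \<inter> (Aab \<union> Aac \<union> Aad \<union> Abc \<union> Abd \<union> Acd) = {}"
    and cl: "{a, b, c, d} \<subseteq> closure C"
  shows False
proof -
  define Q where "Q = Aac \<union> Abc \<union> (Aad \<union> Abd)"
  have mem: "a \<in> Aab" "b \<in> Aab" "a \<in> Aac" "c \<in> Aac" "a \<in> Aad" "d \<in> Aad" "b \<in> Abc" "c \<in> Abc"
    "b \<in> Abd" "d \<in> Abd" "c \<in> Acd" "d \<in> Acd"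
    using arc_between_ends[OF ends(1)] arc_between_ends[OF ends(2)] arc_between_ends[OF ends(3)]
      arc_between_ends[OF ends(4)] arc_between_ends[OF ends(5)] arc_between_ends[OF ends(6)] by auto
  have acb: "arc_between (Aac \<union> Abc) a b"
    by (rule arc_between_join[OF ends(2) arc_between_sym[OF ends(4)]]) (simp add: adj)
  have adb: "arc_between (Aad \<union> Abd) a b"
    by (rule arc_between_join[OF ends(3) arc_between_sym[OF ends(5)]]) (simp add: adj)
  have cad: "arc_between (Aac \<union> Aad) c d"
    by (rule arc_between_join[OF arc_between_sym[OF ends(2)] ends(3)]) (simp add: adj)
  have cbd: "arc_between (Abc \<union> Abd) c d"
    by (rule arc_between_join[OF arc_between_sym[OF ends(4)] ends(5)]) (simp add: adj)
  have Q2: "Q = Aac \<union> Aad \<union> (Abc \<union> Abd)" by (auto simp: Q_def)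
  have com: "Abc \<inter> Aad = {}" "Acd \<inter> Aac = {c}" "Acd \<inter> Abc = {c}" "Acd \<inter> Aad = {d}" "Acd \<inter> Abd = {d}"
    using opp adj by (simp_all add: Int_commute)
  have i1: "Aab \<inter> (Aac \<union> Abc) = {a, b}" "Aab \<inter> (Aad \<union> Abd) = {a, b}"
    "(Aac \<union> Abc) \<inter> (Aad \<union> Abd) = {a, b}"
    by (auto simp: Int_Un_distrib Int_Un_distrib2 adj opp com)
  have i2: "Acd \<inter> (Aac \<union> Aad) = {c, d}" "Acd \<inter> (Abc \<union> Abd) = {c, d}"
    "(Aac \<union> Aad) \<inter> (Abc \<union> Abd) = {c, d}"
    by (auto simp: Int_Un_distrib Int_Un_distrib2 adj opp com)
  define I where "I = Aab - {a, b}"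
  define J where "J = Acd - {c, d}"
  have IJ: "connected I" "connected J" "I \<noteq> {}" "J \<noteq> {}" "closure J = Acd"
    unfolding I_def J_def using arc_between_interior[OF ends(1)] arc_between_interior[OF ends(6)] by auto
  have "C \<noteq> {}" using cl by auto
  then obtain p where p: "p \<in> C" by blast
  obtain y where y: "y \<in> I" using IJ by blast
  obtain z where z: "z \<in> J" using IJ by blast
  have n1: "\<not> connected_component (- Q) p y"
    unfolding Q_def
    by (rule theta_graph_face[OF ends(1) acb adb i1 C(1), where ?x2.0 = c and ?x3.0 = d])
       (use C cl mem dist p y in \<open>auto simp: I_def\<close>)
  \<comment> \<open>Here \<open>J\<close> plays the role of \<open>C\<close>: the closure of the
    open arc from \<open>c\<close> to \<open>d\<close> contains both these points.\<close>
  have n2: "\<not> connected_component (- Q) z y"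
    unfolding Q_def
  proof (rule theta_graph_face[OF ends(1) acb adb i1 IJ(2), where ?x2.0 = c and ?x3.0 = d])
    show "J \<inter> (Aab \<union> (Aac \<union> Abc) \<union> (Aad \<union> Abd)) = {}"
      using i2 opp(1) unfolding J_def by blast
  qed (use IJ mem dist y z in \<open>auto simp: I_def\<close>)
  have n3: "\<not> connected_component (- Q) p z"
    unfolding Q2
    by (rule theta_graph_face[OF ends(6) cad cbd i2 C(1), where ?x2.0 = a and ?x3.0 = b])
       (use C cl mem dist p z in \<open>auto simp: J_def\<close>)
  obtain U V where UV: "connected U" "connected V" "U \<union> V = - Q"
    using jordan_curve_arcs[OF acb adb i1(3)] unfolding Q_def by metis
  have "p \<in> - Q" using C p by (auto simp: Q_def)
  moreover have "y \<in> - Q" using y i1 by (auto simp: Q_def I_def)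
  moreover have "z \<in> - Q" using z i2 by (auto simp: Q2 J_def)
  ultimately have UV3: "p \<in> U \<union> V" "y \<in> U \<union> V" "z \<in> U \<union> V" by (simp_all add: UV(3))
  have same: "connected_component (- Q) u v" if "u \<in> U \<and> v \<in> U \<or> u \<in> V \<and> v \<in> V" for u v
    using that UV unfolding connected_component_def by blast
  show False using UV3 n1 n2 n3 same[of p y] same[of z y] same[of p z] by blast
qed

section \<open>Accessibility of boundary points\<close>

text \<open>The components counted are the sectors into which \<open>X\<close> cuts a neighbourhood
  of \<open>s\<close>. Only those reaching into a smaller ball count, since an arc can cut off
  infinitely many pockets near the rim of the larger one.\<close>

definition finitely_many_corners :: "complex set \<Rightarrow> complex \<Rightarrow> bool" where
  "finitely_many_corners X s \<longleftrightarrow>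
     (\<forall>e>0. \<exists>d>0. finite (connected_component_set (ball s e - X) ` (ball s d - X)))"

lemma finite_image_factor:
  assumes "finite (f ` A)" "\<And>p q. \<lbrakk>p \<in> A; q \<in> A; f p = f q\<rbrakk> \<Longrightarrow> h p = h q"
  shows "finite (h ` A)"
proof -
  have "h ` A \<subseteq> (\<lambda>c. h (SOME p. p \<in> A \<and> f p = c)) ` f ` A"
  proof
    fix z assume "z \<in> h ` A"
    then obtain p where p: "p \<in> A" "z = h p" by auto
    have "(SOME x. x \<in> A \<and> f x = f p) \<in> A \<and> f (SOME x. x \<in> A \<and> f x = f p) = f p"
      by (rule someI[of _ p]) (simp add: p)
    then have "h (SOME x. x \<in> A \<and> f x = f p) = h p" using assms(2) p by blast
    with p show "z \<in> (\<lambda>c. h (SOME p. p \<in> A \<and> f p = c)) ` f ` A" by force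
  qed
  then show ?thesis using assms(1) finite_surj by blast
qed

lemma finite_no_three:
  assumes "\<And>x y z. \<lbrakk>x \<in> S; y \<in> S; z \<in> S\<rbrakk> \<Longrightarrow> x = y \<or> y = z \<or> x = z"
  shows "finite S"
proof (rule ccontr)
  assume "infinite S"
  then obtain T where T: "T \<subseteq> S" "card T = 3" using infinite_arbitrarily_large by blast
  then obtain x y z where "T = {x, y, z}" "x \<noteq> y" "y \<noteq> z" "x \<noteq> z" by (auto simp: card_3_iff)
  with assms T show False by (metis insertCI subset_iff)
qed

lemma connected_component_set_mono_eq:
  assumes "connected_component_set S p = connected_component_set S q" "p \<in> S" "q \<in> S" "S \<subseteq> T"
  shows "connected_component_set T p = connected_component_set T q"
proof -
  have "connected_component S p q"
    using assms connected_component_refl by (metis mem_Collect_eq)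
  then show ?thesis
    using assms(4) connected_component_eq connected_component_of_subset by (metis mem_Collect_eq)
qed

text \<open>In a ball where \<open>X\<close> and \<open>Y\<close> agree the components are the same,
  and enlarging the outer ball can only merge them.\<close>

lemma finitely_many_corners_cong:
  assumes "finitely_many_corners X s" "r > 0" "X \<inter> ball s r = Y \<inter> ball s r"
  shows "finitely_many_corners Y s"
  unfolding finitely_many_corners_def
proof (intro allI impI)
  fix e :: real assume "e > 0"
  define e' where "e' = min e r"
  have "e' > 0" using \<open>e > 0\<close> \<open>r > 0\<close> by (simp add: e'_def)
  then obtain d where d: "d > 0" "finite (connected_component_set (ball s e' - X) ` (ball s d - X))"
    using assms(1) unfolding finitely_many_corners_def by blast
  define d' where "d' = min d e'"
  have "d' > 0" using d \<open>e' > 0\<close> by (simp add: d'_def)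
  have b: "ball s d' \<subseteq> ball s d" "ball s d' \<subseteq> ball s e'" "ball s e' \<subseteq> ball s e" "ball s e' \<subseteq> ball s r"
    by (auto simp: d'_def e'_def)
  have XY: "ball s e' - X = ball s e' - Y" "ball s d' - X = ball s d' - Y" using assms(3) b by blast+
  have "finite (connected_component_set (ball s e' - X) ` (ball s d' - X))"
    by (rule finite_subset[OF _ d(2)]) (use b in blast)
  then have "finite (connected_component_set (ball s e' - Y) ` (ball s d' - Y))" unfolding XY .
  then have "finite (connected_component_set (ball s e - Y) ` (ball s d' - Y))"
    by (rule finite_image_factor) (erule connected_component_set_mono_eq; use b in blast)
  with \<open>d' > 0\<close> show "\<exists>d>0. finite (connected_component_set (ball s e - Y) ` (ball s d - Y))" by blast
qed

lemma finitely_many_corners_singleton: "finitely_many_corners {s} s"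
  unfolding finitely_many_corners_def
proof (intro allI impI)
  fix e :: real assume "e > 0"
  have "connected (ball s e - {s})" by (rule connected_punctured_ball) simp
  then have "connected_component_set (ball s e - {s}) ` (ball s e - {s}) \<subseteq> {ball s e - {s}}"
    using connected_component_eq_self by blast
  then have "finite (connected_component_set (ball s e - {s}) ` (ball s e - {s}))"
    using finite_subset by blast
  with \<open>e > 0\<close> show "\<exists>d>0. finite (connected_component_set (ball s e - {s}) ` (ball s d - {s}))" by blast
qed

text \<open>A component of \<open>- X\<close> that contains the open arc breaks into at most two,
  and every other component avoids the arc and survives unchanged. Whether the open arc is inside
  can be tested at \<open>g (1/2)\<close>, as it is connected and disjoint from
  \<open>X\<close>.\<close>

lemma finite_components_minus_arc:
  fixes g :: "real \<Rightarrow> complex"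
  assumes "closed X" "arc g" and gX: "path_image g \<inter> X \<subseteq> {pathstart g, pathfinish g}"
    and "B \<inter> (X \<union> path_image g) = {}" and fin: "finite (connected_component_set (- X) ` B)"
  shows "finite (connected_component_set (- (X \<union> path_image g)) ` B)"
proof -
  define f where "f = connected_component_set (- X)"
  define h where "h = connected_component_set (- (X \<union> path_image g))"
  have "finite (h ` {p \<in> B. f p = F})" if "F \<in> f ` B" for F
  proof (cases "g (1/2) \<in> F")
    case True
    show ?thesis
    proof (rule finite_no_three)
      fix x y z assume "x \<in> h ` {p \<in> B. f p = F}" "y \<in> h ` {p \<in> B. f p = F}" "z \<in> h ` {p \<in> B. f p = F}"
      then obtain p q r where pqr: "p \<in> B" "q \<in> B" "r \<in> B" "f p = F" "f q = F" "f r = F"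
        and xyz: "x = h p" "y = h q" "z = h r" by auto
      have "connected_component (- (X \<union> path_image g)) p q \<or>
        connected_component (- (X \<union> path_image g)) q r \<or> connected_component (- (X \<union> path_image g)) p r"
        by (rule arc_splits_component_in_two[OF \<open>closed X\<close> \<open>arc g\<close> gX, of _ _ _ "1/2"])
           (use True assms(4) pqr in \<open>auto simp: f_def\<close>)
      then show "x = y \<or> y = z \<or> x = z"
        unfolding xyz h_def using connected_component_eq by (metis mem_Collect_eq)
    qed
  next
    case False
    have "h p = F" if p: "p \<in> B" "f p = F" for p
    proof -
      have pX: "p \<in> - (X \<union> path_image g)" using p assms(4) by blast
      have FX: "F \<subseteq> - X" "connected F" "p \<in> F"
        using p pX by (auto simp: f_def connected_component_subset dest: connected_component_in)
      \<comment> \<open>\<open>F\<close> is open, so even a meeting at an end of the arc would bring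
        in interior points, and with them the whole open arc.\<close>
      have "F \<inter> path_image g = {}"
      proof (rule ccontr)
        assume "F \<inter> path_image g \<noteq> {}"
        then obtain w where w: "w \<in> F" "w \<in> path_image g" by blast
        define S where "S = F \<union> g ` {0<..<1}"
        have gi: "connected (g ` {0<..<1})"
          using arc_between_interior(1) arc_interior_image[OF \<open>arc g\<close>] \<open>arc g\<close>
          unfolding arc_between_def by metis
        have gX': "g ` {0<..<1} \<inter> X = {}" using arc_interior_image[OF \<open>arc g\<close>] gX by blast
        have op: "open F" using \<open>closed X\<close> p(2) unfolding f_def by (metis open_Compl open_connected_component)
        have "F \<inter> g ` {0<..<1} \<noteq> {}"
        proof -
          have "w \<in> closure (g ` {0<..<1})"
            using arc_between_interior(3)[of "path_image g" "pathstart g" "pathfinish g"] w(2)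
              arc_interior_image[OF \<open>arc g\<close>] \<open>arc g\<close> unfolding arc_between_def by auto
          with op w show ?thesis using open_Int_closure_eq_empty[OF op] by blast
        qed
        then have "connected S" unfolding S_def using FX gi by (intro connected_Un) auto
        moreover have "S \<subseteq> - X" using FX gX' by (auto simp: S_def)
        ultimately have "S \<subseteq> F"
          using FX p unfolding f_def S_def by (metis UnI1 connected_component_maximal)
        then have "g (1/2) \<in> F" by (force simp: S_def)
        with False show False ..
      qed
      then have "F \<subseteq> - (X \<union> path_image g)" using FX by blast
      then have "F \<subseteq> h p" using FX unfolding h_def by (simp add: connected_component_maximal)
      moreover have "h p \<subseteq> f p" unfolding h_def f_def by (rule connected_component_mono) auto
      ultimately show ?thesis using p by simp
    qed
    then have "h ` {p \<in> B. f p = F} \<subseteq> {F}" by auto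
    then show ?thesis using finite_subset by blast
  qed
  then have "finite (\<Union>F\<in>f ` B. h ` {p \<in> B. f p = F})" using fin unfolding f_def by blast
  moreover have "h ` B \<subseteq> (\<Union>F\<in>f ` B. h ` {p \<in> B. f p = F})" by auto
  ultimately show ?thesis unfolding h_def using finite_subset by blast
qed

text \<open>Only an initial piece of the arc matters near \<open>s\<close>. The remainder has
  positive distance from \<open>s\<close> and leaves the corners there unchanged.\<close>

lemma finitely_many_corners_Un_arc:
  fixes g :: "real \<Rightarrow> complex"
  assumes X: "finitely_many_corners X s" "closed X" and "arc g" "pathstart g = s"
    and gX: "path_image g \<inter> X \<subseteq> {s}"
  shows "finitely_many_corners (X \<union> path_image g) s"
  unfolding finitely_many_corners_def
proof (intro allI impI)
  fix e :: real assume "e > 0"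
  have g0: "g 0 = s" using assms by (simp add: pathstart_def)
  have "continuous_on {0..1} g" using \<open>arc g\<close> by (simp add: arc_def path_def)
  then obtain k where "k > 0" and k: "\<And>x. \<lbrakk>x \<in> {0..1}; dist x 0 < k\<rbrakk> \<Longrightarrow> dist (g x) (g 0) < e"
    using \<open>e > 0\<close> unfolding continuous_on_iff by (metis atLeastAtMost_iff order_refl zero_le_one)
  define t where "t = min k 1 / 2"
  have t: "0 < t" "t < 1" "t < k" using \<open>k > 0\<close> by (auto simp: t_def min_def)
  define A' where "A' = g ` {0..t}"
  define A'' where "A'' = g ` {t..1}"
  have A: "path_image g = A' \<union> A''" using t by (force simp: A'_def A''_def path_image_def)
  have A'e: "A' \<subseteq> ball s e"
  proof
    fix z assume "z \<in> A'"
    then obtain x where "z = g x" "0 \<le> x" "x \<le> t" by (auto simp: A'_def)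
    then show "z \<in> ball s e" using k[of x] t g0 by (simp add: dist_commute)
  qed
  have sA'': "s \<notin> A''" using t g0[symmetric] by (auto simp: A''_def arc_eq_iff[OF \<open>arc g\<close>])
  have clA'': "closed A''" unfolding A''_def using t by (intro compact_imp_closed arc_segment \<open>arc g\<close>) auto
  then obtain r where "r > 0" "ball s r \<inter> A'' = {}"
    using sA'' by (metis Int_commute closed_def ComplI open_contains_ball disjoint_eq_subset_Compl)
  then have "finitely_many_corners (X \<union> A'') s"
    by (intro finitely_many_corners_cong[OF X(1)]) auto
  then obtain d where d: "d > 0" "finite (connected_component_set (ball s e - (X \<union> A'')) ` (ball s d - (X \<union> A'')))"
    using \<open>e > 0\<close> unfolding finitely_many_corners_def by blast
  define d' where "d' = min d e"
  have "d' > 0" using d \<open>e > 0\<close> by (simp add: d'_def)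
  \<comment> \<open>With the outside of the ball made part of the closed set, components inside the
    ball become components of a complement, to which the count for a single arc applies.\<close>
  define Y where "Y = X \<union> A'' \<union> - ball s e"
  define g' where "g' = subpath 0 t g"
  have g': "arc g'" "path_image g' = A'" "pathstart g' = s" "pathfinish g' = g t"
    using t g0 arc_imp_inj_on[OF \<open>arc g\<close>]
    by (auto simp: g'_def A'_def path_image_subpath intro!: arc_subpath_arc \<open>arc g\<close>)
  have "finite (connected_component_set (- (Y \<union> path_image g')) ` (ball s d' - (X \<union> path_image g)))"
  proof (rule finite_components_minus_arc)
    show "closed Y" unfolding Y_def using X clA'' by (simp add: closed_Un closed_Compl)
    have "A' \<inter> A'' \<subseteq> {g t}" using t by (auto simp: A'_def A''_def arc_eq_iff[OF \<open>arc g\<close>])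
    then show "path_image g' \<inter> Y \<subseteq> {pathstart g', pathfinish g'}"
      using gX[unfolded A] A'e unfolding g'(2-4) Y_def by blast
    show "(ball s d' - (X \<union> path_image g)) \<inter> (Y \<union> path_image g') = {}"
      unfolding A g'(2) Y_def by (auto simp: d'_def)
    have "- Y = ball s e - (X \<union> A'')" unfolding Y_def by blast
    then show "finite (connected_component_set (- Y) ` (ball s d' - (X \<union> path_image g)))"
      using A by (intro finite_subset[OF _ d(2)]) (auto simp: d'_def)
  qed (rule g')
  moreover have "- (Y \<union> path_image g') = ball s e - (X \<union> path_image g)"
    unfolding A g'(2) Y_def by blast
  ultimately show "\<exists>d>0. finite (connected_component_set (ball s e - (X \<union> path_image g)) ` (ball s d - (X \<union> path_image g)))"
    using \<open>d' > 0\<close> by auto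
qed

lemma finitely_many_corners_star:
  assumes "finite \<A>" "\<And>A. A \<in> \<A> \<Longrightarrow> \<exists>v. arc_between A s v"
    "\<And>A B. \<lbrakk>A \<in> \<A>; B \<in> \<A>; A \<noteq> B\<rbrakk> \<Longrightarrow> A \<inter> B \<subseteq> {s}"
  shows "finitely_many_corners (insert s (\<Union>\<A>)) s"
  using assms
proof (induction \<A>)
  case empty
  then show ?case by (simp add: finitely_many_corners_singleton)
next
  case (insert A \<A>)
  obtain v g where g: "arc g" "path_image g = A" "pathstart g = s" "pathfinish g = v"
    using insert.prems(1)[of A] unfolding arc_between_def by blast
  have "finitely_many_corners (insert s (\<Union>\<A>) \<union> path_image g) s"
  proof (rule finitely_many_corners_Un_arc[OF _ _ g(1,3)])
    show "finitely_many_corners (insert s (\<Union>\<A>)) s" using insert by simp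
    have "closed B" if "B \<in> \<A>" for B using insert.prems(1)[of B] that arc_between_closed by blast
    then show "closed (insert s (\<Union>\<A>))" using insert.hyps by (intro closed_insert closed_Union) auto
    have "A \<inter> B \<subseteq> {s}" if "B \<in> \<A>" for B using insert.prems(2)[of A B] insert.hyps that by auto
    then show "path_image g \<inter> insert s (\<Union>\<A>) \<subseteq> {s}" using g by blast
  qed
  moreover have "insert s (\<Union>\<A>) \<union> path_image g = insert s (\<Union>(insert A \<A>))" using g by auto
  ultimately show ?case by simp
qed

text \<open>The pieces are run through on the half-line, one unit of time each, and
  \<open>1/t - 1\<close> compresses the half-line into the unit interval. Continuity at
  \<open>0\<close>, where the value is \<open>s\<close>, holds because the pieces shrink to
  \<open>s\<close>.\<close>

lemma path_concat_infinite:
  fixes q :: "nat \<Rightarrow> real \<Rightarrow> complex"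
  assumes q: "\<And>n. path (q n)" "\<And>n. pathfinish (q n) = pathstart (q (Suc n))"
    and lim: "\<And>e. e > 0 \<Longrightarrow> \<exists>N. \<forall>n\<ge>N. path_image (q n) \<subseteq> ball s e"
  obtains g where "path g" "pathstart g = s" "pathfinish g = pathstart (q 0)"
    "path_image g \<subseteq> insert s (\<Union>n. path_image (q n))"
proof -
  define G where "G x = q (nat \<lfloor>x\<rfloor>) (x - of_int \<lfloor>x\<rfloor>)" for x :: real
  \<comment> \<open>At a joint the two neighbouring pieces have the same value, so the formula also
    holds at the right end of the time interval.\<close>
  have Gn: "G x = q n (x - real n)" if "real n \<le> x" "x \<le> real n + 1" for n x
  proof (cases "x = real n + 1")
    case True
    then have "\<lfloor>x\<rfloor> = int (Suc n)" by simp
    then show ?thesis using q(2)[of n] True by (simp add: G_def pathstart_def pathfinish_def nat_add_distrib)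
  next
    case False
    then have "\<lfloor>x\<rfloor> = int n" using that by (simp add: floor_unique)
    then show ?thesis by (simp add: G_def)
  qed
  have G_cont: "continuous_on {0..real n} G" for n
  proof (induction n)
    case 0
    then show ?case by simp
  next
    case (Suc n)
    have "continuous_on {real n..real n + 1} (\<lambda>x. q n (x - real n))"
    proof (rule continuous_on_compose2[of "{0..1}" "q n"])
      show "continuous_on {0..1} (q n)" using q(1) by (simp add: path_def)
    qed (auto intro!: continuous_intros)
    then have "continuous_on {real n..real n + 1} G"
      by (rule continuous_on_eq) (use Gn in auto)
    then have "continuous_on ({0..real n} \<union> {real n..real n + 1}) G"
      using Suc by (intro continuous_on_closed_Un) auto
    moreover have "{0..real n} \<union> {real n..real n + 1} = {0..real (Suc n)}" by auto
    ultimately show ?case by simp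
  qed
  have G_im: "\<exists>n. real n \<le> x \<and> x \<le> real n + 1 \<and> G x \<in> path_image (q n)" if "x \<ge> 0" for x
  proof -
    define n where "n = nat \<lfloor>x\<rfloor>"
    have n: "real n \<le> x" "x \<le> real n + 1" using that by (auto simp: n_def)
    then have "G x \<in> path_image (q n)" using Gn[OF n] by (simp add: path_image_def)
    with n show ?thesis by blast
  qed
  define g where "g t = (if t = 0 then s else G (1/t - 1))" for t :: real
  have "continuous (at t within {0..1}) g" if t: "t \<in> {0..1}" for t
  proof (cases "t = 0")
    case False
    \<comment> \<open>On the interval from \<open>t/2\<close> to \<open>1\<close> the time is at
      most \<open>2/t - 1\<close>, so only finitely many pieces are involved there.\<close>
    obtain n where n: "2/t - 1 \<le> real n" using real_arch_simple by blast
    have "t > 0" using t False by simp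
    have "continuous_on {t/2..1} (\<lambda>t. G (1/t - 1))"
    proof (rule continuous_on_compose2[OF G_cont[of n]])
      show "continuous_on {t/2..1} (\<lambda>t. 1/t - 1)" using \<open>t > 0\<close> by (intro continuous_intros) auto
      show "(\<lambda>t. 1 / t - 1) ` {t / 2..1} \<subseteq> {0..real n}"
      proof
        fix z assume "z \<in> (\<lambda>t. 1 / t - 1) ` {t / 2..1}"
        then obtain x where x: "z = 1/x - 1" "t/2 \<le> x" "x \<le> 1" by auto
        then have "1/x \<ge> 1" using \<open>t > 0\<close> by simp
        moreover have "1/x \<le> 2/t" using x \<open>t > 0\<close> by (simp add: field_simps)
        ultimately show "z \<in> {0..real n}" using x n by simp
      qed
    qed
    then have "continuous_on {t/2..1} g"
      by (rule continuous_on_eq) (use \<open>t > 0\<close> in \<open>auto simp: g_def\<close>)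
    then have "continuous (at t within {t/2..1}) g"
      using t \<open>t > 0\<close> by (auto simp: continuous_on_eq_continuous_within)
    moreover have "at t within {0..1} = at t within {t/2..1}"
      by (rule at_within_nhd[of _ "{t/2<..}"]) (use \<open>t > 0\<close> in auto)
    ultimately show ?thesis by simp
  next
    case True
    show ?thesis
      unfolding continuous_within_eps_delta
    proof (intro allI impI)
      fix e :: real assume "e > 0"
      then obtain N where N: "\<And>n. n \<ge> N \<Longrightarrow> path_image (q n) \<subseteq> ball s e" using lim by blast
      show "\<exists>d>0. \<forall>x'\<in>{0..1}. dist x' t < d \<longrightarrow> dist (g x') (g t) < e"
      proof (intro exI conjI ballI impI)
        \<comment> \<open>For \<open>x\<close> below this bound the time \<open>1/x - 1\<close>
          exceeds \<open>N + 1\<close>, so the piece in use has index at least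
          \<open>N\<close>.\<close>
        show "0 < 1 / (real N + 2)" by simp
        fix x :: real assume x: "x \<in> {0..1}" "dist x t < 1 / (real N + 2)"
        show "dist (g x) (g t) < e"
        proof (cases "x = 0")
          case False
          then have "x > 0" "x < 1 / (real N + 2)" using x True by auto
          then have "1/x > real N + 2" by (simp add: field_simps)
          moreover obtain n where n: "1/x - 1 \<le> real n + 1" "G (1/x - 1) \<in> path_image (q n)"
            using G_im[of "1/x - 1"] calculation by auto
          ultimately have "n \<ge> N" by linarith
          then show ?thesis using subsetD[OF N n(2)] False True by (simp add: g_def dist_commute)
        qed (use True \<open>e > 0\<close> in simp)
      qed
    qed
  qed
  then have "path g" by (simp add: path_def continuous_on_eq_continuous_within)
  moreover have "pathfinish g = pathstart (q 0)" using Gn[of 0 0] by (simp add: g_def pathfinish_def pathstart_def)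
  moreover have "path_image g \<subseteq> insert s (\<Union>n. path_image (q n))"
  proof
    fix z assume "z \<in> path_image g"
    then obtain t where t: "z = g t" "0 \<le> t" "t \<le> 1" by (auto simp: path_image_def)
    then show "z \<in> insert s (\<Union>n. path_image (q n))"
      using G_im[of "1/t - 1"] by (cases "t = 0") (auto simp: g_def)
  qed
  ultimately show thesis using that[of g] by (simp add: g_def pathstart_def)
qed

text \<open>Among the finitely many corners at \<open>s\<close> one is approached by the given set, so corners of
  ever smaller balls can be nested; an access path runs through all of them.\<close>

lemma accessible_at_finitely_many_corners:
  assumes "closed K" "finitely_many_corners K s" "f \<in> components (- K)" "s \<in> frontier f"
  obtains g where "arc g" "pathstart g = s" "path_image g - {s} \<subseteq> f"
proof -
  define c where "c e = connected_component_set (ball s e - K)" for e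
  have sK: "s \<in> K" using assms frontier_of_components_closed_complement by blast
  \<comment> \<open>Otherwise the closures of the finitely many corners met by \<open>W\<close> near
    \<open>s\<close> would form a closed set without \<open>s\<close>, although this set contains
    all points of \<open>W\<close> near \<open>s\<close>.\<close>
  have step: "\<exists>p \<in> W \<inter> ball s e. s \<in> closure (c e p)"
    if W: "s \<in> closure W" "W \<inter> K = {}" and "e > 0" for W e
  proof (rule ccontr)
    assume *: "\<not> ?thesis"
    obtain d where d: "d > 0" "finite (c e ` (ball s d - K))"
      using assms(2) \<open>e > 0\<close> unfolding finitely_many_corners_def c_def by blast
    define d' where "d' = min d e"
    have "d' > 0" using d \<open>e > 0\<close> by (simp add: d'_def)
    define F where "F = closure ` c e ` (W \<inter> ball s d')"
    have "c e ` (W \<inter> ball s d') \<subseteq> c e ` (ball s d - K)" using W by (auto simp: d'_def)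
    then have "finite F" unfolding F_def using d(2) finite_subset by blast
    then have "closed (\<Union>F)" unfolding F_def by (intro closed_Union) auto
    moreover have "s \<notin> \<Union>F" using * by (auto simp: F_def d'_def)
    ultimately obtain k where k: "k > 0" "ball s k \<inter> \<Union>F = {}"
      by (metis Int_commute closed_def ComplI open_contains_ball disjoint_eq_subset_Compl)
    obtain w where w: "w \<in> W" "dist w s < min k d'"
      using W(1) k \<open>d' > 0\<close> closure_approachable by (metis min_less_iff_conj)
    then have "w \<in> W \<inter> ball s d'" "w \<in> ball s e - K" using W(2) by (auto simp: dist_commute d'_def)
    moreover from this have "w \<in> closure (c e w)"
      using closure_subset unfolding c_def by (metis connected_component_refl mem_Collect_eq subsetD)
    ultimately have "w \<in> \<Union>F" unfolding F_def by blast
    with k w show False by (auto simp: dist_commute)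
  qed
  define r where "r n = inverse (real (Suc n))" for n
  have r: "r n > 0" for n by (simp add: r_def)
  have fK: "f \<inter> K = {}" "connected f" using assms(3) in_components_subset in_components_connected by blast+
  have csub: "c e p \<inter> K = {}" "c e p \<subseteq> ball s e" for e p
    using connected_component_subset unfolding c_def by fastforce+
  have cf: "c e p \<subseteq> f" if "p \<in> f" for e p
  proof (cases "p \<in> ball s e")
    case True
    then have "p \<in> c e p" using that fK unfolding c_def by auto
    moreover have "connected (c e p)" unfolding c_def by (rule connected_connected_component)
    ultimately show ?thesis
      using csub that by (intro components_maximal[OF assms(3)]) auto
  next
    case False
    then have "c e p = {}" unfolding c_def by (metis DiffD1 connected_component_eq_empty)
    then show ?thesis by simp
  qed
  \<comment> \<open>Here \<open>step\<close> is applied to the corner chosen before, so that the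
    next point can be reached without leaving that corner.\<close>
  have "\<exists>p. \<forall>n. (p n \<in> f \<and> p n \<in> ball s (r n) \<and> s \<in> closure (c (r n) (p n))) \<and> p (Suc n) \<in> c (r n) (p n)"
  proof (rule dependent_nat_choice)
    show "\<exists>x. x \<in> f \<and> x \<in> ball s (r 0) \<and> s \<in> closure (c (r 0) x)"
      using step[of f "r 0"] assms(4) fK r by (auto simp: frontier_def)
  next
    fix x n assume *: "x \<in> f \<and> x \<in> ball s (r n) \<and> s \<in> closure (c (r n) x)"
    then obtain y where y: "y \<in> c (r n) x \<inter> ball s (r (Suc n))" "s \<in> closure (c (r (Suc n)) y)"
      using step[of "c (r n) x" "r (Suc n)"] csub r by blast
    then show "\<exists>y. (y \<in> f \<and> y \<in> ball s (r (Suc n)) \<and> s \<in> closure (c (r (Suc n)) y)) \<and> y \<in> c (r n) x"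
      using cf * by blast
  qed
  then obtain p where p: "\<And>n. p n \<in> f" "\<And>n. p n \<in> ball s (r n)" "\<And>n. p (Suc n) \<in> c (r n) (p n)"
    by blast
  have "\<exists>q. path q \<and> path_image q \<subseteq> c (r n) (p n) \<and> pathstart q = p n \<and> pathfinish q = p (Suc n)" for n
  proof -
    have "open (c (r n) (p n))" "connected (c (r n) (p n))"
      unfolding c_def using assms(1) by (auto intro!: open_connected_component open_Diff)
    then have "path_connected (c (r n) (p n))" by (rule connected_open_path_connected)
    moreover have "p n \<in> c (r n) (p n)" using p fK unfolding c_def by auto
    ultimately show ?thesis using p(3)[of n] unfolding path_connected_def by blast
  qed
  then obtain q where q: "\<And>n. path (q n)" "\<And>n. path_image (q n) \<subseteq> c (r n) (p n)"
    "\<And>n. pathstart (q n) = p n" "\<And>n. pathfinish (q n) = p (Suc n)" by metis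
  have "\<exists>N. \<forall>n\<ge>N. path_image (q n) \<subseteq> ball s e" if "e > 0" for e
  proof -
    obtain N where N: "r N < e" using reals_Archimedean[OF \<open>e > 0\<close>] unfolding r_def by blast
    have "r n \<le> r N" if "n \<ge> N" for n using that by (simp add: r_def)
    then show ?thesis using q(2) csub(2) N by (intro exI[of _ N]) (force simp: subset_iff)
  qed
  then obtain g where g: "path g" "pathstart g = s" "pathfinish g = p 0"
    "path_image g \<subseteq> insert s (\<Union>n. path_image (q n))"
    using path_concat_infinite[of q s] q by metis
  have "p 0 \<noteq> s" using p(1)[of 0] sK fK by blast
  then obtain h where h: "arc h" "path_image h \<subseteq> path_image g" "pathstart h = s" "pathfinish h = p 0"
    using path_contains_arc[OF g(1-3)] by metis
  have "path_image (q n) \<subseteq> f" for n using q(2)[of n] cf[OF p(1)[of n]] by blast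
  then have "path_image h - {s} \<subseteq> f" using h g by blast
  with h show thesis using that by blast
qed

section \<open>Plane graphs\<close>

definition support :: "plane_graph \<Rightarrow> complex set" where
  "support P = pverts P \<union> \<Union>(parcs P)"

lemma verts_skeleton [simp]: "verts (skeleton P) = pverts P"
  by (simp add: skeleton_def)

lemma edges_skeleton: "edges (skeleton P) = (\<lambda>A. A \<inter> pverts P) ` parcs P"
  by (simp add: skeleton_def)

lemma plane_graph_arc:
  assumes "is_plane_graph P" "A \<in> parcs P"
  obtains u v where "arc_between A u v" "A \<inter> pverts P = {u, v}" "u \<in> pverts P" "v \<in> pverts P"
proof -
  have "plane_edge (pverts P) A" using assms by (simp add: is_plane_graph_def)
  then obtain g where g: "arc g" "path_image g = A" "A \<inter> pverts P = {pathstart g, pathfinish g}"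
    unfolding plane_edge_def by blast
  then show thesis using that[of "pathstart g" "pathfinish g"] unfolding arc_between_def by blast
qed

lemma skeleton_edgeE:
  assumes "is_plane_graph P" "{u, v} \<in> edges (skeleton P)"
  obtains A where "A \<in> parcs P" "arc_between A u v" "A \<inter> pverts P = {u, v}"
proof -
  obtain A where A: "A \<in> parcs P" "A \<inter> pverts P = {u, v}"
    using assms(2) unfolding edges_skeleton by auto
  obtain x y where "arc_between A x y" "A \<inter> pverts P = {x, y}"
    using plane_graph_arc[OF assms(1) A(1)] by metis
  then have "arc_between A u v"
    using A(2) arc_between_sym by (metis doubleton_eq_iff)
  with A show thesis using that by blast
qed

lemma simple_graph_skeleton:
  assumes "is_plane_graph P" shows "simple_graph (skeleton P)"
  unfolding simple_graph_def
proof (intro conjI ballI)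
  show "finite (verts (skeleton P))" using assms by (simp add: is_plane_graph_def)
  fix e assume "e \<in> edges (skeleton P)"
  then obtain A where A: "A \<in> parcs P" "e = A \<inter> pverts P" by (auto simp: edges_skeleton)
  obtain u v where uv: "arc_between A u v" "A \<inter> pverts P = {u, v}" "u \<in> pverts P" "v \<in> pverts P"
    using plane_graph_arc[OF assms A(1)] by metis
  then show "e \<subseteq> verts (skeleton P)" "card e = 2"
    using A arc_between_ends[OF uv(1)] by auto
qed

lemma closed_support:
  assumes "is_plane_graph P" shows "closed (support P)"
proof -
  have "closed A" if "A \<in> parcs P" for A
    using plane_graph_arc[OF assms that] arc_between_closed by metis
  then have "closed (\<Union>(parcs P))" using assms by (auto simp: is_plane_graph_def)
  then show ?thesis unfolding support_def using assms
    by (auto simp: is_plane_graph_def finite_imp_closed)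
qed

lemma plane_arcs_inter:
  assumes "is_plane_graph P" "A \<in> parcs P" "B \<in> parcs P" "A \<noteq> B"
  shows "A \<inter> B = (A \<inter> pverts P) \<inter> (B \<inter> pverts P)"
  using assms unfolding is_plane_graph_def by blast

lemma faces_support: "faces P = components (- support P)"
  by (simp add: faces_def support_def)

lemma face_props:
  assumes "is_plane_graph P" "f \<in> faces P"
  shows "open f" "connected f" "f \<noteq> {}" "f \<inter> support P = {}" "frontier f \<subseteq> support P"
  using assms closed_support[OF assms(1)] unfolding faces_support
  by (auto simp: open_Compl in_components_nonempty dest: in_components_subset
      intro: open_components in_components_connected)
     (metis frontier_of_components_closed_complement subsetD)

lemma plane_graph_add_arc:
  assumes P: "is_plane_graph P" and uv: "u \<in> pverts P" "v \<in> pverts P"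
    and A: "arc_between A u v" "A \<inter> support P = {u, v}" "{u, v} \<notin> edges (skeleton P)"
  defines "P' \<equiv> P\<lparr>parcs := insert A (parcs P)\<rparr>"
  shows "is_plane_graph P'" "skeleton P' = (skeleton P)\<lparr>edges := insert {u, v} (edges (skeleton P))\<rparr>"
proof -
  have AV: "A \<inter> pverts P = {u, v}" using A(2) uv by (auto simp: support_def)
  have pe: "plane_edge (pverts P) A"
    using A(1) AV unfolding plane_edge_def arc_between_def by metis
  have new: "A \<inter> B \<subseteq> pverts P" "A \<inter> pverts P \<noteq> B \<inter> pverts P" if "B \<in> parcs P" for B
  proof -
    have "A \<inter> B \<subseteq> {u, v}" using A(2) that by (auto simp: support_def)
    then show "A \<inter> B \<subseteq> pverts P" using uv by blast
    show "A \<inter> pverts P \<noteq> B \<inter> pverts P" using A(3) AV that unfolding edges_skeleton by auto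
  qed
  have old: "finite (pverts P)" "finite (parcs P)" "\<And>B. B \<in> parcs P \<Longrightarrow> plane_edge (pverts P) B"
    "\<And>B C. \<lbrakk>B \<in> parcs P; C \<in> parcs P; B \<noteq> C\<rbrakk> \<Longrightarrow> B \<inter> C \<subseteq> pverts P \<and> B \<inter> pverts P \<noteq> C \<inter> pverts P"
    using P unfolding is_plane_graph_def by auto
  have sel: "pverts P' = pverts P" "parcs P' = insert A (parcs P)" by (simp_all add: P'_def)
  show "is_plane_graph P'"
    unfolding is_plane_graph_def sel
  proof (intro conjI ballI impI)
    fix B assume "B \<in> insert A (parcs P)"
    then show "plane_edge (pverts P) B" using pe old(3) by blast
  next
    fix B C assume BC: "B \<in> insert A (parcs P)" "C \<in> insert A (parcs P)" "B \<noteq> C"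
    then consider "B = A" "C \<in> parcs P" | "C = A" "B \<in> parcs P" | "B \<in> parcs P" "C \<in> parcs P" by blast
    then show "B \<inter> C \<subseteq> pverts P"
      by cases (use new(1) old(4) BC in \<open>auto simp: Int_commute\<close>)
    show "B \<inter> pverts P \<noteq> C \<inter> pverts P"
      using \<open>B \<noteq> C\<close> BC(1,2) new(2) old(4)[of B C] by (metis insert_iff)
  qed (use old in auto)
  show "skeleton P' = (skeleton P)\<lparr>edges := insert {u, v} (edges (skeleton P))\<rparr>"
    by (simp add: P'_def skeleton_def AV)
qed

text \<open>Near \<open>s\<close> only the edges ending at \<open>s\<close> are visible. Two of them
  meet in \<open>s\<close> alone: common points are common ends, and no two edges have both ends in
  common. The remaining part \<open>R\<close> of the drawing is closed and misses
  \<open>s\<close>.\<close>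

lemma plane_finitely_many_corners:
  assumes P: "is_plane_graph P" and s: "s \<in> pverts P"
  shows "finitely_many_corners (support P) s"
proof -
  define \<A> where "\<A> = {A \<in> parcs P. s \<in> A}"
  define R where "R = (pverts P - {s}) \<union> \<Union>{A \<in> parcs P. s \<notin> A}"
  have fin: "finite (pverts P)" "finite (parcs P)" using P by (auto simp: is_plane_graph_def)
  have ends: "\<exists>v. arc_between A s v \<and> A \<inter> pverts P = {s, v}" if "A \<in> \<A>" for A
  proof -
    have A: "A \<in> parcs P" "s \<in> A" using that by (auto simp: \<A>_def)
    obtain u v where uv: "arc_between A u v" "A \<inter> pverts P = {u, v}"
      using plane_graph_arc[OF P A(1)] by metis
    then have "s = u \<or> s = v" using A s by blast
    then show ?thesis using uv arc_between_sym by (metis insert_commute)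
  qed
  have star: "finitely_many_corners (insert s (\<Union>\<A>)) s"
  proof (rule finitely_many_corners_star)
    show "finite \<A>" using fin by (simp add: \<A>_def)
    show "\<exists>v. arc_between A s v" if "A \<in> \<A>" for A using ends[OF that] by blast
    show "A \<inter> B \<subseteq> {s}" if AB: "A \<in> \<A>" "B \<in> \<A>" "A \<noteq> B" for A B
    proof -
      obtain u v where "A \<inter> pverts P = {s, u}" "B \<inter> pverts P = {s, v}" using ends[OF AB(1)] ends[OF AB(2)] by blast
      moreover have "A \<inter> pverts P \<noteq> B \<inter> pverts P" "A \<inter> B \<subseteq> pverts P"
        using P AB unfolding is_plane_graph_def \<A>_def by blast+
      ultimately show ?thesis by blast
    qed
  qed
  have "closed A" if "A \<in> parcs P" for A
    using plane_graph_arc[OF P that] arc_between_closed by metis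
  then have "closed R" unfolding R_def using fin
    by (intro closed_Un closed_Union) (auto intro: finite_imp_closed)
  moreover have "s \<notin> R" by (auto simp: R_def)
  ultimately obtain r where "r > 0" "ball s r \<inter> R = {}"
    by (metis Int_commute closed_def ComplI open_contains_ball disjoint_eq_subset_Compl)
  moreover have "support P = insert s (\<Union>\<A>) \<union> R" using s by (auto simp: support_def \<A>_def R_def)
  ultimately show ?thesis
    by (intro finitely_many_corners_cong[OF star]) auto
qed

section \<open>Chords of faces and the edges forced by maximality\<close>

lemma face_vertex_access:
  assumes "is_plane_graph P" "f \<in> faces P" "s \<in> pverts P" "s \<in> frontier f"
  obtains g where "arc g" "pathstart g = s" "path_image g - {s} \<subseteq> f"
  using accessible_at_finitely_many_corners[OF closed_support plane_finitely_many_corners] assms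
  unfolding faces_support by metis

lemma path_to_arc_between:
  assumes "path g" "pathstart g = u" "pathfinish g = v" "u \<noteq> v"
  obtains A where "arc_between A u v" "A \<subseteq> path_image g"
  using path_contains_arc[OF assms] unfolding arc_between_def by metis

lemma access_point:
  assumes "arc g" "pathstart g = u" "path_image g - {u} \<subseteq> f"
  shows "pathfinish g \<in> f"
  using assms arc_distinct_ends by fastforce

lemma open_connected_chord:
  fixes f :: "complex set"
  assumes f: "open f" "connected f"
    and g: "arc g" "pathstart g = u" "path_image g - {u} \<subseteq> f"
    and h: "arc h" "pathstart h = v" "path_image h - {v} \<subseteq> f"
    and "u \<noteq> v"
  obtains A where "arc_between A u v" "A - {u, v} \<subseteq> f"
proof -
  have "path_connected f" using f by (simp add: connected_open_path_connected)
  then obtain m where m: "path m" "path_image m \<subseteq> f" "pathstart m = pathfinish g" "pathfinish m = pathfinish h"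
    using access_point[OF g] access_point[OF h] unfolding path_connected_def by blast
  define k where "k = g +++ m +++ reversepath h"
  have "path k" "pathstart k = u" "pathfinish k = v"
    using g h m by (auto simp: k_def arc_imp_path)
  moreover have "path_image k \<subseteq> f \<union> {u, v}"
    using g h m by (auto simp: k_def path_image_join)
  moreover from calculation obtain A where "arc_between A u v" "A \<subseteq> path_image k"
    using path_to_arc_between[of k u v] \<open>u \<noteq> v\<close> by metis
  ultimately show thesis by (intro that[of A]) auto
qed

lemma face_chord:
  assumes "is_plane_graph P" "f \<in> faces P" "u \<noteq> v"
    "u \<in> pverts P" "u \<in> frontier f" "v \<in> pverts P" "v \<in> frontier f"
  obtains A where "arc_between A u v" "A - {u, v} \<subseteq> f"
  using face_vertex_access[OF assms(1,2,4,5)] face_vertex_access[OF assms(1,2,6,7)]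
    open_connected_chord[OF face_props(1,2)[OF assms(1,2)] _ _ _ _ _ _ assms(3)] by metis

text \<open>If the edge were missing, \<open>A\<close> could be added to the drawing. The drawing
  \<open>P\<close> is tied to the graph by an explicit isomorphism because it may also be cut out of
  a drawing of a larger graph.\<close>

lemma maximal_planar_adjacent:
  assumes max: "maximal_planar \<Gamma>" and P: "is_plane_graph P"
    and \<phi>: "bij_betw \<phi> (verts \<Gamma>) (pverts P)" "edges (skeleton P) = (\<lambda>e. \<phi> ` e) ` edges \<Gamma>"
    and uv: "u \<in> verts \<Gamma>" "v \<in> verts \<Gamma>" "u \<noteq> v"
    and A: "arc_between A (\<phi> u) (\<phi> v)" "A \<inter> support P \<subseteq> {\<phi> u, \<phi> v}"
  shows "{u, v} \<in> edges \<Gamma>"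
proof (rule ccontr)
  assume n: "{u, v} \<notin> edges \<Gamma>"
  have simp\<Gamma>: "simple_graph \<Gamma>" using max by (simp add: maximal_planar_def planar_def)
  have inj: "inj_on \<phi> (verts \<Gamma>)" using \<phi>(1) by (simp add: bij_betw_def)
  have uvP: "\<phi> u \<in> pverts P" "\<phi> v \<in> pverts P" using \<phi>(1) uv by (auto simp: bij_betw_def)
  have nP: "{\<phi> u, \<phi> v} \<notin> edges (skeleton P)"
  proof
    assume "{\<phi> u, \<phi> v} \<in> edges (skeleton P)"
    then obtain e where e: "e \<in> edges \<Gamma>" "\<phi> ` {u, v} = \<phi> ` e" using \<phi>(2) by auto
    have "e \<subseteq> verts \<Gamma>" using simp\<Gamma> e by (auto simp: simple_graph_def)
    then have "{u, v} = e" using e(2) uv inj by (metis empty_subsetI insert_subset inj_on_image_eq_iff)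
    with n e show False by blast
  qed
  have "A \<inter> support P = {\<phi> u, \<phi> v}"
    using A uvP arc_between_ends[OF A(1)] by (auto simp: support_def)
  note new = plane_graph_add_arc[OF P uvP A(1) this nP]
  have "planar (\<Gamma>\<lparr>edges := insert {u, v} (edges \<Gamma>)\<rparr>)"
    unfolding planar_def graph_iso_def
  proof (intro conjI exI)
    show "simple_graph (\<Gamma>\<lparr>edges := insert {u, v} (edges \<Gamma>)\<rparr>)"
      using simp\<Gamma> uv by (auto simp: simple_graph_def)
    show "is_plane_graph (P\<lparr>parcs := insert A (parcs P)\<rparr>)" by (rule new)
    show "bij_betw \<phi> (verts (\<Gamma>\<lparr>edges := insert {u, v} (edges \<Gamma>)\<rparr>)) (verts (skeleton (P\<lparr>parcs := insert A (parcs P)\<rparr>)))"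
      using \<phi>(1) by simp
    show "edges (skeleton (P\<lparr>parcs := insert A (parcs P)\<rparr>)) = (`) \<phi> ` edges (\<Gamma>\<lparr>edges := insert {u, v} (edges \<Gamma>)\<rparr>)"
      unfolding new(2) using \<phi>(2) by simp
  qed
  with max uv n show False unfolding maximal_planar_def by blast
qed

lemma maximal_plane_adjacent:
  assumes "maximal_plane P" "u \<in> pverts P" "v \<in> pverts P" "u \<noteq> v"
    and "arc_between A u v" "A \<inter> support P \<subseteq> {u, v}"
  shows "{u, v} \<in> edges (skeleton P)"
  using maximal_planar_adjacent[of "skeleton P" P id u v A] assms
  by (auto simp: maximal_plane_def)

lemma face_vertices_adjacent:
  assumes "maximal_plane P" "f \<in> faces P" "u \<noteq> v"
    "u \<in> pverts P" "u \<in> frontier f" "v \<in> pverts P" "v \<in> frontier f"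
  shows "{u, v} \<in> edges (skeleton P)"
proof -
  have P: "is_plane_graph P" using assms by (simp add: maximal_plane_def)
  obtain A where A: "arc_between A u v" "A - {u, v} \<subseteq> f"
    using face_chord[OF P assms(2-7)] .
  then have "A \<inter> support P \<subseteq> {u, v}" using face_props(4)[OF P assms(2)] by blast
  then show ?thesis using maximal_plane_adjacent assms A by blast
qed

section \<open>Distances\<close>

text \<open>A finite infimum of extended naturals is attained, so bounds on distances become walks.
  A walk with \<open>Suc n\<close> vertices has \<open>n\<close> edges.\<close>

lemma gdist_le_iff:
  "gdist G u v \<le> enat n \<longleftrightarrow> (\<exists>xs. walk G xs \<and> hd xs = u \<and> last xs = v \<and> length xs \<le> Suc n)"
proof
  assume le: "gdist G u v \<le> enat n"
  define S where "S = (\<lambda>xs. enat (length xs - 1)) ` {xs. walk G xs \<and> hd xs = u \<and> last xs = v}"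
  have I: "gdist G u v = Inf S" by (simp add: gdist_def S_def)
  have "S \<noteq> {}" using le I by (auto simp: Inf_enat_def)
  then have "Inf S \<in> S" unfolding Inf_enat_def by (metis LeastI_ex ex_in_conv)
  then obtain xs where "walk G xs" "hd xs = u" "last xs = v" "gdist G u v = enat (length xs - 1)"
    unfolding I S_def by auto
  then show "\<exists>xs. walk G xs \<and> hd xs = u \<and> last xs = v \<and> length xs \<le> Suc n"
    using le by (intro exI[of _ xs]) auto
next
  assume "\<exists>xs. walk G xs \<and> hd xs = u \<and> last xs = v \<and> length xs \<le> Suc n"
  then obtain xs where xs: "walk G xs" "hd xs = u" "last xs = v" "length xs \<le> Suc n" by blast
  have "gdist G u v \<le> enat (length xs - 1)"
    unfolding gdist_def by (rule INF_lower) (use xs in auto)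
  also have "\<dots> \<le> enat n" using xs(4) by simp
  finally show "gdist G u v \<le> enat n" .
qed

lemma gdist_le_walk:
  assumes "walk G xs" "hd xs = u" "last xs = v" "length xs \<le> Suc n"
  shows "gdist G u v \<le> enat n"
  unfolding gdist_le_iff using assms by (intro exI[of _ xs]) simp

lemma gdist_refl: "u \<in> verts G \<Longrightarrow> gdist G u u = 0"
  using gdist_le_walk[of G "[u]" u u 0] by (simp add: walk_def zero_enat_def[symmetric])

lemma gdist_edge:
  assumes "u \<in> verts G" "v \<in> verts G" "{u, v} \<in> edges G"
  shows "gdist G u v \<le> 1"
  using gdist_le_walk[of G "[u, v]" u v 1] assms by (simp add: walk_def one_enat_def)

lemma gdist_triangle: "gdist G u w \<le> gdist G u v + gdist G v w"
proof (cases "gdist G u v" "gdist G v w" rule: enat2_cases)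
  case (enat_enat m n)
  obtain xs where xs: "walk G xs" "hd xs = u" "last xs = v" "length xs \<le> Suc m"
    using enat_enat gdist_le_iff[of G u v m] by auto
  obtain ys where ys: "walk G ys" "hd ys = v" "last ys = w" "length ys \<le> Suc n"
    using enat_enat gdist_le_iff[of G v w n] by auto
  \<comment> \<open>The common vertex \<open>v\<close> is kept only once, so that the numbers of
    edges add up.\<close>
  obtain zs where zs: "ys = v # zs" using ys by (cases ys) (auto simp: walk_def)
  have "gdist G u w \<le> enat (m + n)"
  proof (rule gdist_le_walk)
    show "walk G (xs @ zs)"
      using xs ys zs unfolding walk_def
      by (auto simp: successively_append_iff successively_Cons)
    show "hd (xs @ zs) = u" using xs by (simp add: walk_def hd_append)
    show "last (xs @ zs) = w" using xs ys zs by (auto simp: last_append split: if_splits)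
    show "length (xs @ zs) \<le> Suc (m + n)" using xs ys zs by simp
  qed
  with enat_enat show ?thesis by simp
qed auto

lemma gdist_mono:
  assumes "verts G \<subseteq> verts G'" "edges G \<subseteq> edges G'"
  shows "gdist G' u v \<le> gdist G u v"
proof (cases "gdist G u v")
  case (enat n)
  then obtain xs where xs: "walk G xs" "hd xs = u" "last xs = v" "length xs \<le> Suc n"
    using gdist_le_iff[of G u v n] by auto
  have "successively (\<lambda>x y. {x, y} \<in> edges G') xs"
    using xs(1) assms unfolding walk_def by (blast intro: successively_mono)
  then have "walk G' xs" using xs(1) assms unfolding walk_def by blast
  then show ?thesis using xs enat gdist_le_walk by metis
qed simp

lemma walk_Cons: "walk G (x # xs) \<longleftrightarrow> x \<in> verts G \<and> (xs = [] \<or> walk G xs \<and> {x, hd xs} \<in> edges G)"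
  by (cases xs) (auto simp: walk_def)

lemma walk_append_iff:
  "xs \<noteq> [] \<Longrightarrow> ys \<noteq> [] \<Longrightarrow> walk G (xs @ ys) \<longleftrightarrow> walk G xs \<and> walk G ys \<and> {last xs, hd ys} \<in> edges G"
  by (auto simp: walk_def successively_append_iff)

section \<open>Plane subgraphs of plane graphs\<close>

locale plane_extension =
  fixes H G :: plane_graph
  assumes H: "is_plane_graph H" and G: "is_plane_graph G" and HG: "plane_subgraph H G"
begin

lemma sub: "pverts H \<subseteq> pverts G" "parcs H \<subseteq> parcs G"
  using HG by (auto simp: plane_subgraph_def)

text \<open>An edge of \<open>H\<close> contains exactly two vertices of either graph, and those of
  \<open>H\<close> are among those of \<open>G\<close>. So no vertex of \<open>G\<close> lies in the
  interior of an edge of \<open>H\<close>.\<close>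

lemma sub_arc_ends:
  assumes "A \<in> parcs H" shows "A \<inter> pverts G = A \<inter> pverts H"
proof -
  have A: "A \<in> parcs G" using assms sub by blast
  obtain u v where uv: "arc_between A u v" "A \<inter> pverts H = {u, v}" using plane_graph_arc[OF H assms] by metis
  obtain x y where xy: "arc_between A x y" "A \<inter> pverts G = {x, y}" using plane_graph_arc[OF G A] by metis
  have "{u, v} \<subseteq> {x, y}" using uv(2) xy(2) sub by blast
  moreover have "u \<noteq> v" using arc_between_ends[OF uv(1)] by simp
  ultimately have "{u, v} = {x, y}" by auto
  then show ?thesis using uv(2) xy(2) by simp
qed

lemma sub_edges: "edges (skeleton H) \<subseteq> edges (skeleton G)"
proof
  fix e assume "e \<in> edges (skeleton H)"
  then obtain A where A: "A \<in> parcs H" "e = A \<inter> pverts H" by (auto simp: edges_skeleton)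
  then have "e = A \<inter> pverts G" "A \<in> parcs G" using sub sub_arc_ends[OF A(1)] by auto
  then show "e \<in> edges (skeleton G)" by (auto simp: edges_skeleton)
qed

lemma support_vertex: "w \<in> pverts G \<Longrightarrow> w \<in> support H \<Longrightarrow> w \<in> pverts H"
  using sub_arc_ends by (auto simp: support_def)

text \<open>A point shared with an edge of \<open>H\<close> is a vertex of \<open>G\<close>, and a
  vertex of \<open>G\<close> on the drawing of \<open>H\<close> is one of \<open>H\<close>. New
  edges therefore touch the old drawing only at their ends.\<close>

lemma new_arc_support:
  assumes "A \<in> parcs G" "A \<notin> parcs H"
  shows "A \<inter> support H \<subseteq> A \<inter> pverts G \<inter> pverts H"
proof
  fix z assume z: "z \<in> A \<inter> support H"
  have "z \<in> pverts G"
  proof (cases "z \<in> pverts H")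
    case False
    then obtain B where B: "B \<in> parcs H" "z \<in> B" using z by (auto simp: support_def)
    then have "A \<inter> B \<subseteq> pverts G" using plane_arcs_inter[OF G assms(1), of B] assms sub by auto
    with z B show ?thesis by blast
  qed (use sub in blast)
  then show "z \<in> A \<inter> pverts G \<inter> pverts H" using z support_vertex by blast
qed

text \<open>The bound \<open>{s} \<inter> pverts H\<close> covers two situations at once: an edge
  leaving \<open>H\<close> at \<open>s\<close>, and an edge between two outside vertices, which
  avoids the drawing of \<open>H\<close> completely.\<close>

lemma outside_edge:
  assumes "{s, x} \<in> edges (skeleton G)" "x \<notin> pverts H"
  obtains A where "arc_between A s x" "A \<inter> support H \<subseteq> {s} \<inter> pverts H"
proof -
  obtain A where A: "A \<in> parcs G" "arc_between A s x" "A \<inter> pverts G = {s, x}"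
    using skeleton_edgeE[OF G assms(1)] .
  have "x \<in> pverts G" using A(3) by blast
  have "A \<notin> parcs H"
  proof
    assume "A \<in> parcs H"
    then have "x \<in> pverts H" using sub_arc_ends[of A] A(3) by blast
    with assms show False by blast
  qed
  then show thesis using new_arc_support[OF A(1)] A assms(2) that[of A] by blast
qed

text \<open>The edges between outside vertices miss the drawing of \<open>H\<close>, so such a walk
  stays within one face.\<close>

lemma outside_walk_path:
  assumes "walk (skeleton G) xs" "set xs \<inter> pverts H = {}"
  shows "path_component (- support H) (hd xs) (last xs)"
  using assms
proof (induction xs)
  case Nil
  then show ?case by (simp add: walk_def)
next
  case (Cons x xs)
  show ?case
  proof (cases "xs = []")
    case True
    then show ?thesis using Cons.prems support_vertex[of x] by (auto simp: walk_def path_component_refl_eq)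
  next
    case False
    then have w: "walk (skeleton G) xs" "{x, hd xs} \<in> edges (skeleton G)"
      using Cons.prems by (auto simp: walk_Cons)
    obtain A where A: "arc_between A x (hd xs)" "A \<inter> support H \<subseteq> {x} \<inter> pverts H"
      using outside_edge[OF w(2)] Cons.prems(2) hd_in_set[OF False] by (metis disjoint_iff list.set_intros(2))
    then have "A \<subseteq> - support H" using Cons.prems by auto
    then have "path_component (- support H) x (hd xs)"
      using A(1) unfolding arc_between_def path_component_def by (metis arc_imp_path)
    then show ?thesis using Cons.IH[OF w(1)] Cons.prems False path_component_trans by auto
  qed
qed

text \<open>The walk cannot change faces after leaving \<open>H\<close>. Its first edge without
  \<open>s\<close> is thus a connected piece of \<open>f\<close>, and \<open>s\<close> is a limit
  point of it.\<close>

lemma outside_walk_enters_face: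
  assumes "walk (skeleton G) (s # xs)" "xs \<noteq> []" "set xs \<inter> pverts H = {}" "s \<in> pverts H"
    and f: "f \<in> faces H" "last xs \<in> f"
  shows "s \<in> frontier f"
proof -
  have w: "walk (skeleton G) xs" "{s, hd xs} \<in> edges (skeleton G)"
    using assms(1,2) by (auto simp: walk_Cons)
  obtain A where A: "arc_between A s (hd xs)" "A \<inter> support H \<subseteq> {s} \<inter> pverts H"
    using outside_edge[OF w(2)] assms by (metis disjoint_iff hd_in_set)
  have pc: "path_component (- support H) (hd xs) (last xs)"
    by (rule outside_walk_path[OF w(1) assms(3)])
  have "hd xs \<in> f"
  proof -
    have "connected_component (- support H) (last xs) (hd xs)"
      using pc path_component_subset_connected_component
      by (metis connected_component_sym mem_Collect_eq subsetD)
    then show ?thesis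
      using f unfolding faces_support components_iff by (metis connected_component_eq mem_Collect_eq)
  qed
  obtain g where g: "arc g" "path_image g = A" "pathstart g = s" "pathfinish g = hd xs"
    using A(1) unfolding arc_between_def by blast
  have con: "connected (A - {s})"
  proof (rule connected_intermediate_closure)
    show "connected (A - {s, hd xs})" by (rule arc_between_interior[OF A(1)])
    show "A - {s} \<subseteq> closure (A - {s, hd xs})" using arc_between_interior(3)[OF A(1)] by blast
  qed auto
  have "A - {s} \<subseteq> f"
  proof (rule components_maximal[of f "- support H"])
    show "f \<in> components (- support H)" using f by (simp add: faces_support)
    show "f \<inter> (A - {s}) \<noteq> {}" using \<open>hd xs \<in> f\<close> arc_between_ends[OF A(1)] by blast
  qed (use con A in auto)
  moreover have "s \<in> closure (A - {s, hd xs})"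
    using arc_between_interior(3)[OF A(1)] arc_between_ends[OF A(1)] by simp
  moreover from calculation have "closure (A - {s, hd xs}) \<subseteq> closure f" by (intro closure_mono) blast
  ultimately have "s \<in> closure f" by blast
  moreover have "s \<notin> f" using face_props(4)[OF H f(1)] assms(4) by (auto simp: support_def)
  ultimately show ?thesis using face_props(1)[OF H f(1)] by (simp add: frontier_def interior_open)
qed

text \<open>A shortest walk is cut at its last vertex in \<open>H\<close>; what follows is an
  outside walk ending in \<open>f\<close>.\<close>

lemma last_exit_to_face:
  assumes v: "v \<in> pverts H" and f: "f \<in> faces H" "w \<in> f" and w: "w \<in> pverts G"
    and fin: "gdist (skeleton G) v w \<noteq> \<infinity>"
  obtains s where "s \<in> pverts H" "s \<in> frontier f"
    "gdist (skeleton G) v s + gdist (skeleton G) s w \<le> gdist (skeleton G) v w"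
proof -
  obtain n where n: "gdist (skeleton G) v w = enat n" using fin by auto
  then obtain xs where xs: "walk (skeleton G) xs" "hd xs = v" "last xs = w" "length xs \<le> Suc n"
    using gdist_le_iff[of "skeleton G" v w n] by auto
  have "\<exists>x\<in>set xs. x \<in> pverts H" using xs v by (metis hd_in_set walk_def)
  then obtain ys s zs where split: "xs = ys @ s # zs" "s \<in> pverts H" "\<forall>z\<in>set zs. z \<notin> pverts H"
    using split_list_last_prop[of xs "\<lambda>x. x \<in> pverts H"] by blast
  have "w \<notin> pverts H" using face_props(4)[OF H f(1)] f(2) by (auto simp: support_def)
  then have zs: "zs \<noteq> []" "last zs = w" using xs split by (auto split: if_splits)
  have w2: "walk (skeleton G) (s # zs)"
    using xs(1) split(1) walk_append_iff[of ys "s # zs"] by (cases "ys = []") auto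
  have "s \<in> frontier f"
    by (rule outside_walk_enters_face[OF w2 zs(1) _ split(2) f(1)]) (use split zs f in auto)
  moreover have "gdist (skeleton G) v s \<le> enat (length ys)"
  proof (rule gdist_le_walk)
    show "walk (skeleton G) (ys @ [s])" using xs(1) unfolding split(1)
      by (auto simp: walk_def successively_append_iff)
    show "hd (ys @ [s]) = v" using xs(2) unfolding split(1) by (cases ys) auto
  qed auto
  moreover have "gdist (skeleton G) s w \<le> enat (length zs)"
    by (rule gdist_le_walk[OF w2]) (use zs in auto)
  ultimately have "gdist (skeleton G) v s + gdist (skeleton G) s w \<le> enat (length ys) + enat (length zs)"
    by (intro add_mono)
  also have "\<dots> \<le> enat n" using xs(4) split(1) by simp
  finally show thesis using that \<open>s \<in> frontier f\<close> split(2) n by simp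
qed

text \<open>The two end edges and the path between them form a connection that touches the drawing
  of \<open>H\<close> only in \<open>u\<close> and \<open>v\<close>. An arc inside it could be added
  to \<open>H\<close>, so maximality makes the ends adjacent.\<close>

lemma outside_detour_adjacent:
  assumes max: "maximal_plane H" and walk: "walk (skeleton G) (u # ys @ [v])"
    and ys: "set ys \<inter> pverts H = {}" and uv: "u \<in> pverts H" "v \<in> pverts H" "u \<noteq> v"
  shows "{u, v} \<in> edges (skeleton H)"
proof (cases "ys = []")
  case True
  then have "{u, v} \<in> edges (skeleton G)" using walk by (simp add: walk_Cons)
  then obtain A where A: "A \<in> parcs G" "arc_between A u v" "A \<inter> pverts G = {u, v}"
    using skeleton_edgeE[OF G] by metis
  show ?thesis
  proof (cases "A \<in> parcs H")
    case True
    then have "{u, v} = A \<inter> pverts H" using A(3) sub_arc_ends[OF True] by simp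
    then show ?thesis using True unfolding edges_skeleton by (rule image_eqI)
  next
    case False
    then have "A \<inter> support H \<subseteq> {u, v}" using new_arc_support[OF A(1)] A by blast
    then show ?thesis using maximal_plane_adjacent[OF max uv A(2)] by blast
  qed
next
  case False
  have w: "walk (skeleton G) ys" "{u, hd ys} \<in> edges (skeleton G)" "{v, last ys} \<in> edges (skeleton G)"
    using walk False walk_append_iff[of ys "[v]"] by (auto simp: walk_Cons insert_commute)
  obtain A where A: "arc_between A u (hd ys)" "A \<inter> support H \<subseteq> {u} \<inter> pverts H"
    using outside_edge[OF w(2)] ys False by (metis disjoint_iff hd_in_set)
  obtain B where B: "arc_between B v (last ys)" "B \<inter> support H \<subseteq> {v} \<inter> pverts H"
    using outside_edge[OF w(3)] ys False by (metis disjoint_iff last_in_set)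
  obtain g where g: "arc g" "path_image g = A" "pathstart g = u" "pathfinish g = hd ys"
    using A(1) unfolding arc_between_def by blast
  obtain h where h: "arc h" "path_image h = B" "pathstart h = v" "pathfinish h = last ys"
    using B(1) unfolding arc_between_def by blast
  obtain m where m: "path m" "path_image m \<subseteq> - support H" "pathstart m = hd ys" "pathfinish m = last ys"
    using outside_walk_path[OF w(1) ys] unfolding path_component_def by blast
  define k where "k = g +++ m +++ reversepath h"
  have "path k" "pathstart k = u" "pathfinish k = v"
    using g h m by (auto simp: k_def arc_imp_path)
  then obtain C where C: "arc_between C u v" "C \<subseteq> path_image k"
    using path_to_arc_between[of k u v] uv by metis
  have "path_image k = A \<union> (path_image m \<union> B)"
    using g h m by (simp add: k_def path_image_join)
  then have "C \<inter> support H \<subseteq> {u, v}" using C(2) A(2) B(2) m(2) by blast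
  then show ?thesis using maximal_plane_adjacent[OF max uv C(1)] by blast
qed

text \<open>Each excursion outside \<open>H\<close> is replaced by a single edge between its ends,
  or dropped when it returns to its start; neither lengthens the walk.\<close>

lemma walk_retract:
  assumes max: "maximal_plane H"
  shows "\<lbrakk>walk (skeleton G) xs; hd xs \<in> pverts H; last xs \<in> pverts H\<rbrakk> \<Longrightarrow>
    \<exists>ys. walk (skeleton H) ys \<and> hd ys = hd xs \<and> last ys = last xs \<and> length ys \<le> length xs"
proof (induction xs rule: length_induct)
  case (1 xs)
  obtain u zs where xs: "xs = u # zs" using 1 by (cases xs) (auto simp: walk_def)
  show ?case
  proof (cases "zs = []")
    case True
    then show ?thesis using 1 xs by (intro exI[of _ "[u]"]) (auto simp: walk_def)
  next
    case False
    have "\<exists>x\<in>set zs. x \<in> pverts H" using 1(4) xs False last_in_set by (metis last_ConsR)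
    then obtain ys v ws where split: "zs = ys @ v # ws" "v \<in> pverts H" "\<forall>y\<in>set ys. y \<notin> pverts H"
      using split_list_first_prop[of zs "\<lambda>x. x \<in> pverts H"] by blast
    have w2: "walk (skeleton G) (v # ws)"
      using 1(2) walk_append_iff[of "u # ys" "v # ws"] by (auto simp: xs split)
    have l: "last (v # ws) = last xs" by (simp add: xs split)
    obtain ts where ts: "walk (skeleton H) ts" "hd ts = v" "last ts = last xs" "length ts \<le> Suc (length ws)"
      using 1(1)[rule_format, of "v # ws"] w2 split(2) l 1(4) by (auto simp: xs split)
    show ?thesis
    proof (cases "u = v")
      case True
      then show ?thesis using ts by (intro exI[of _ ts]) (auto simp: xs split)
    next
      case False
      have "walk (skeleton G) (u # ys @ [v])"
        using 1(2) walk_append_iff[of "u # ys @ [v]" ws]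
        by (cases "ws = []") (auto simp: xs split)
      then have "{u, v} \<in> edges (skeleton H)"
        by (rule outside_detour_adjacent[OF max]) (use split 1(3) xs False in auto)
      then have "walk (skeleton H) (u # ts)" using ts 1(3) xs by (auto simp: walk_Cons)
      moreover have "ts \<noteq> []" using ts by (auto simp: walk_def)
      ultimately show ?thesis using ts by (intro exI[of _ "u # ts"]) (auto simp: xs split)
    qed
  qed
qed

lemma gdist_eq:
  assumes "maximal_plane H" "u \<in> pverts H" "v \<in> pverts H"
  shows "gdist (skeleton G) u v = gdist (skeleton H) u v"
proof (rule antisym)
  show "gdist (skeleton G) u v \<le> gdist (skeleton H) u v"
    by (intro gdist_mono sub_edges) (use sub in auto)
  show "gdist (skeleton H) u v \<le> gdist (skeleton G) u v"
  proof (cases "gdist (skeleton G) u v")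
    case (enat n)
    then obtain xs where xs: "walk (skeleton G) xs" "hd xs = u" "last xs = v" "length xs \<le> Suc n"
      using gdist_le_iff[of "skeleton G" u v n] by auto
    then obtain ys where "walk (skeleton H) ys" "hd ys = u" "last ys = v" "length ys \<le> length xs"
      using walk_retract[OF assms(1) xs(1)] assms by auto
    then show ?thesis using gdist_le_walk xs(4) enat by (metis order_trans)
  qed simp
qed

end

section \<open>Eccentricities and the necessity of the condition\<close>

lemma ecc_ge: "x \<in> verts G \<Longrightarrow> gdist G u x \<le> ecc G u"
  unfolding ecc_def by (rule SUP_upper)

lemma ecc_attained:
  assumes "finite (verts G)" "verts G \<noteq> {}"
  obtains x where "x \<in> verts G" "gdist G u x = ecc G u"
proof -
  have "ecc G u \<in> gdist G u ` verts G"
    unfolding ecc_def using assms by (metis Max_in Max_Sup finite_imageI image_is_empty)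
  then show thesis using that by auto
qed

lemma eccentric_extension_imp_qcc:
  assumes H: "maximal_plane H" and G: "maximal_plane G" and HG: "plane_subgraph H G"
    and ecc: "pverts H \<subseteq> ecc_class (skeleton G) \<alpha>"
    and u: "u \<in> pverts H" "ecc (skeleton H) u < enat \<alpha>"
  shows "\<exists>f\<in>faces H. u \<in> qcc (skeleton H) (pverts (face_boundary H f))"
proof -
  interpret plane_extension H G
    using H G HG by unfold_locales (auto simp: maximal_plane_def)
  have fin: "finite (verts (skeleton G))" "verts (skeleton G) \<noteq> {}"
    using maximal_plane_def[of G] assms(2) u sub by (auto simp: is_plane_graph_def)
  have eccG: "ecc (skeleton G) v = enat \<alpha>" if "v \<in> pverts H" for v
    using that ecc by (auto simp: ecc_class_def)
  obtain w where w: "w \<in> pverts G" "gdist (skeleton G) u w = enat \<alpha>"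
    using ecc_attained[OF fin, of u] eccG[OF u(1)] by auto
  have "w \<notin> pverts H"
  proof
    assume wH: "w \<in> pverts H"
    then have "gdist (skeleton G) u w \<le> ecc (skeleton H) u"
      using gdist_eq[OF assms(1) u(1) wH] ecc_ge[of w "skeleton H" u] by simp
    with u(2) w(2) show False by simp
  qed
  then have "w \<in> - support H" using support_vertex w(1) by blast
  then obtain f where f: "f \<in> faces H" "w \<in> f"
    unfolding faces_support by (metis Union_components UnionE)
  have "\<exists>s\<in>pverts H \<inter> frontier f. gdist (skeleton H) v s \<le> gdist (skeleton H) u s" if v: "v \<in> pverts H" for v
  proof -
    have le: "gdist (skeleton G) v w \<le> enat \<alpha>" using ecc_ge[of w "skeleton G" v] eccG[OF v] w by simp
    then have "gdist (skeleton G) v w \<noteq> \<infinity>" by (cases "gdist (skeleton G) v w") auto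
    then obtain s where s: "s \<in> pverts H" "s \<in> frontier f"
      "gdist (skeleton G) v s + gdist (skeleton G) s w \<le> gdist (skeleton G) v w"
      using last_exit_to_face[OF v f w(1)] by metis
    \<comment> \<open>The route from \<open>v\<close> to \<open>w\<close> through \<open>s\<close>
      has length at most \<alpha>, and by the triangle inequality \<alpha> is at most the length of
      the route from \<open>u\<close> to \<open>w\<close> through \<open>s\<close>. The common part
      from \<open>s\<close> to \<open>w\<close> is finite and cancels.\<close>
    have "gdist (skeleton G) v s + gdist (skeleton G) s w \<le> gdist (skeleton G) u s + gdist (skeleton G) s w"
      using s(3) le w(2) gdist_triangle[of "skeleton G" u w s] by (metis order_trans)
    moreover have "gdist (skeleton G) s w \<noteq> \<infinity>"
      using s(3) le by (cases "gdist (skeleton G) s w") auto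
    ultimately have "gdist (skeleton G) v s \<le> gdist (skeleton G) u s"
      by (cases "gdist (skeleton G) v s"; cases "gdist (skeleton G) u s"; cases "gdist (skeleton G) s w") auto
    then show ?thesis using s gdist_eq[OF assms(1)] u(1) v by (intro bexI[of _ s]) auto
  qed
  then have "u \<in> qcc (skeleton H) (pverts (face_boundary H f))"
    using u(1) by (auto simp: qcc_def face_boundary_def)
  with f show ?thesis by blast
qed

section \<open>Faces of maximal plane graphs are triangles\<close>

text \<open>\<open>C\<close> has to avoid only the edges among the four vertices. It may meet other
  edges of \<open>P\<close>, as it does when it is the star of a further vertex.\<close>

lemma plane_graph_K4_face:
  assumes P: "is_plane_graph P" and dist: "distinct [a, b, c, d]"
    and E: "{a, b} \<in> edges (skeleton P)" "{a, c} \<in> edges (skeleton P)" "{a, d} \<in> edges (skeleton P)"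
      "{b, c} \<in> edges (skeleton P)" "{b, d} \<in> edges (skeleton P)" "{c, d} \<in> edges (skeleton P)"
    and C: "connected C" "\<And>A. \<lbrakk>A \<in> parcs P; A \<inter> pverts P \<subseteq> {a, b, c, d}\<rbrakk> \<Longrightarrow> C \<inter> A = {}"
    and cl: "{a, b, c, d} \<subseteq> closure C"
  shows False
proof -
  obtain Aab where ab: "Aab \<in> parcs P" "arc_between Aab a b" "Aab \<inter> pverts P = {a, b}" using skeleton_edgeE[OF P E(1)] .
  obtain Aac where ac: "Aac \<in> parcs P" "arc_between Aac a c" "Aac \<inter> pverts P = {a, c}" using skeleton_edgeE[OF P E(2)] .
  obtain Aad where ad: "Aad \<in> parcs P" "arc_between Aad a d" "Aad \<inter> pverts P = {a, d}" using skeleton_edgeE[OF P E(3)] .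
  obtain Abc where bc: "Abc \<in> parcs P" "arc_between Abc b c" "Abc \<inter> pverts P = {b, c}" using skeleton_edgeE[OF P E(4)] .
  obtain Abd where bd: "Abd \<in> parcs P" "arc_between Abd b d" "Abd \<inter> pverts P = {b, d}" using skeleton_edgeE[OF P E(5)] .
  obtain Acd where cd: "Acd \<in> parcs P" "arc_between Acd c d" "Acd \<inter> pverts P = {c, d}" using skeleton_edgeE[OF P E(6)] .
  note V = ab(3) ac(3) ad(3) bc(3) bd(3) cd(3)
  have int: "A \<inter> B = (A \<inter> pverts P) \<inter> (B \<inter> pverts P)"
    if "A \<in> parcs P" "B \<in> parcs P" "A \<inter> pverts P \<noteq> B \<inter> pverts P" for A B
    using plane_arcs_inter[OF P that(1,2)] that(3) by blast
  have opp: "Aab \<inter> Acd = {}" "Aac \<inter> Abd = {}" "Aad \<inter> Abc = {}"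
    using dist by (subst int; auto simp: V ab ac ad bc bd cd doubleton_eq_iff)+
  have adj: "Aab \<inter> Aac = {a}" "Aab \<inter> Aad = {a}" "Aac \<inter> Aad = {a}"
      "Aab \<inter> Abc = {b}" "Aab \<inter> Abd = {b}" "Abc \<inter> Abd = {b}"
      "Aac \<inter> Abc = {c}" "Aac \<inter> Acd = {c}" "Abc \<inter> Acd = {c}"
      "Aad \<inter> Abd = {d}" "Aad \<inter> Acd = {d}" "Abd \<inter> Acd = {d}"
    using dist by (subst int; auto simp: V ab ac ad bc bd cd doubleton_eq_iff)+
  have "C \<inter> Aab = {}" "C \<inter> Aac = {}" "C \<inter> Aad = {}" "C \<inter> Abc = {}" "C \<inter> Abd = {}" "C \<inter> Acd = {}"
    using C(2)[OF ab(1)] C(2)[OF ac(1)] C(2)[OF ad(1)] C(2)[OF bc(1)] C(2)[OF bd(1)] C(2)[OF cd(1)]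
    unfolding V by simp_all
  then have "C \<inter> (Aab \<union> Aac \<union> Aad \<union> Abc \<union> Abd \<union> Acd) = {}" by (simp add: Int_Un_distrib)
  then show False
    by (rule plane_K4_face[OF ab(2) ac(2) ad(2) bc(2) bd(2) cd(2) dist opp adj C(1) _ cl])
qed

text \<open>Vertices on a common face are pairwise adjacent, so four of them would span a K4 all of
  whose vertices are touched by \<open>f\<close>.\<close>

lemma face_vertices_card_le_3:
  assumes P: "maximal_plane P" and f: "f \<in> faces P"
  shows "card (pverts P \<inter> frontier f) \<le> 3"
proof (rule ccontr)
  assume "\<not> ?thesis"
  then have "4 \<le> card (pverts P \<inter> frontier f)" by simp
  then obtain T where T: "T \<subseteq> pverts P \<inter> frontier f" "card T = 4" by (metis obtain_subset_with_card_n)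
  then obtain xs where xs: "set xs = T" "distinct xs" "length xs = 4"
    by (metis card.infinite distinct_card finite_distinct_list zero_neq_numeral)
  then obtain a b c d where abcd: "xs = [a, b, c, d]"
    by (auto simp: numeral_eq_Suc length_Suc_conv)
  have pl: "is_plane_graph P" using P by (simp add: maximal_plane_def)
  have S: "{a, b, c, d} \<subseteq> pverts P \<inter> frontier f" using T xs abcd by auto
  have adj: "{u, v} \<in> edges (skeleton P)" if "u \<in> {a, b, c, d}" "v \<in> {a, b, c, d}" "u \<noteq> v" for u v
    using face_vertices_adjacent[OF P f that(3)] that S by blast
  have dist: "distinct [a, b, c, d]" using xs abcd by simp
  show False
  proof (rule plane_graph_K4_face[OF pl dist])
    show "connected f" using face_props[OF pl f] by blast
    show "f \<inter> A = {}" if "A \<in> parcs P" for A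
      using face_props(4)[OF pl f] that by (auto simp: support_def)
    show "{a, b, c, d} \<subseteq> closure f" using S by (auto simp: frontier_def)
  qed (use adj dist in auto)
qed

text \<open>\<open>X\<close> is the drawing without the interior of \<open>A\<close>. It is closed
  and misses \<open>z\<close>, so a disc about \<open>z\<close> joins a point of \<open>f\<close> to
  \<open>z\<close> off \<open>X\<close>, and the frontier result for arcs applies.\<close>

lemma face_frontier_contains_arc:
  assumes P: "is_plane_graph P" and f: "f \<in> faces P" and A: "A \<in> parcs P"
    and z: "z \<in> A - pverts P" "z \<in> frontier f"
  shows "A \<subseteq> frontier f"
proof -
  define X where "X = pverts P \<union> \<Union>(parcs P - {A})"
  have fin: "finite (pverts P)" "finite (parcs P)" using P by (auto simp: is_plane_graph_def)
  have clX: "closed X"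
  proof -
    have "closed B" if B: "B \<in> parcs P" for B
      using plane_graph_arc[OF P B] arc_between_closed by metis
    then show ?thesis unfolding X_def using fin
      by (intro closed_Un closed_Union) (auto intro: finite_imp_closed)
  qed
  have AX: "A \<inter> X = A \<inter> pverts P"
    using plane_arcs_inter[OF P A] by (auto simp: X_def)
  obtain u v where uv: "arc_between A u v" "A \<inter> pverts P = {u, v}" using plane_graph_arc[OF P A] by metis
  obtain g where g: "arc g" "path_image g = A" "pathstart g = u" "pathfinish g = v"
    using uv unfolding arc_between_def by blast
  have "z \<in> g ` {0<..<1}" using arc_interior_image[OF g(1)] g z uv by blast
  then obtain t where t: "0 < t" "t < 1" "z = g t" by auto
  have "z \<notin> X" using z AX by blast
  then obtain r where r: "r > 0" "ball z r \<subseteq> - X" using clX by (metis ComplI open_Compl open_contains_ball)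
  have "z \<in> closure f" using z by (simp add: frontier_def)
  then obtain p where p: "p \<in> f" "p \<in> ball z r"
    using r(1) by (metis closure_approachable dist_commute mem_ball)
  have sup: "X \<union> A = support P" using A by (auto simp: X_def support_def)
  have "path_image g \<subseteq> frontier (connected_component_set (- (X \<union> path_image g)) p)"
  proof (rule arc_subset_frontier_component[OF clX g(1) _ _ t(1,2)])
    show "path_image g \<inter> X \<subseteq> {pathstart g, pathfinish g}" using AX uv g by auto
    show "p \<notin> X \<union> path_image g" unfolding g(2) sup using p face_props(4)[OF P f] by blast
    show "connected_component (- X) p (g t)"
      unfolding connected_component_def using r p t by (intro exI[of _ "ball z r"]) auto
  qed
  moreover have "connected_component_set (- support P) p = f"
    using f p(1) unfolding faces_support components_iff by (metis connected_component_eq)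
  ultimately show ?thesis unfolding g(2) sup by simp
qed

text \<open>With at most two vertices on it, the frontier of \<open>f\<close> would be contained in
  a set \<open>D\<close> that does not separate the plane: a single edge, or at most two points.
  Then \<open>f\<close> is all of \<open>- D\<close>, which leaves no place for a third
  vertex.\<close>

lemma face_vertices_card_ge_3:
  assumes P: "is_plane_graph P" and f: "f \<in> faces P" and V: "3 \<le> card (pverts P)"
  shows "3 \<le> card (pverts P \<inter> frontier f)"
proof (rule ccontr)
  assume "\<not> ?thesis"
  define S where "S = pverts P \<inter> frontier f"
  have cS: "card S \<le> 2" using \<open>\<not> _\<close> by (simp add: S_def)
  have fin: "finite (pverts P)" "finite (parcs P)" using P by (auto simp: is_plane_graph_def)
  have finS: "finite S" using fin by (simp add: S_def)
  have arcs: "A \<inter> pverts P \<subseteq> S" if "A \<in> parcs P" "z \<in> A" "z \<in> frontier f" "z \<notin> pverts P" for A z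
    using face_frontier_contains_arc[OF P f that(1), of z] that by (auto simp: S_def)
  \<comment> \<open>An edge has two ends, so these fill the set \<open>S\<close> of at most two
    elements; hence only one edge can have its ends in \<open>S\<close>.\<close>
  have eqS: "A \<inter> pverts P = S" if A: "A \<in> parcs P" "A \<inter> pverts P \<subseteq> S" for A
  proof -
    obtain u v where "arc_between A u v" "A \<inter> pverts P = {u, v}" using plane_graph_arc[OF P A(1)] by metis
    then have "card (A \<inter> pverts P) = 2" using arc_between_ends by auto
    then show ?thesis using card_seteq[OF finS A(2)] cS by simp
  qed
  obtain D where D: "frontier f \<subseteq> D" "connected (- D)" "D \<inter> pverts P \<subseteq> S" "f \<inter> D = {}"
  proof (cases "\<exists>A\<in>parcs P. A \<inter> pverts P \<subseteq> S")
    case True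
    then obtain A where A: "A \<in> parcs P" "A \<inter> pverts P \<subseteq> S" by blast
    obtain u v g where uv: "arc_between A u v" using plane_graph_arc[OF P A(1)] by metis
    have "frontier f \<subseteq> A"
    proof
      fix z assume z: "z \<in> frontier f"
      show "z \<in> A"
      proof (cases "z \<in> pverts P")
        case True
        then show ?thesis using z eqS[OF A] by (auto simp: S_def)
      next
        case False
        then obtain B where B: "B \<in> parcs P" "z \<in> B"
          using face_props(5)[OF P f] z by (auto simp: support_def)
        then have "B \<inter> pverts P = S" using arcs[OF B z False] eqS by blast
        then have "A = B" using A(1) B(1) eqS[OF A] P unfolding is_plane_graph_def by blast
        with B show ?thesis by simp
      qed
    qed
    moreover have "connected (- A)"
      using uv connected_arc_complement unfolding arc_between_def by (metis DIM_complex order_refl)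
    moreover have "f \<inter> A = {}" using face_props(4)[OF P f] A(1) by (auto simp: support_def)
    ultimately show thesis using that[of A] A by blast
  next
    case False
    have "frontier f \<subseteq> S"
    proof
      fix z assume z: "z \<in> frontier f"
      show "z \<in> S"
      proof (rule ccontr)
        assume "z \<notin> S"
        then have zV: "z \<notin> pverts P" using z by (simp add: S_def)
        then obtain B where B: "B \<in> parcs P" "z \<in> B"
          using face_props(5)[OF P f] z by (auto simp: support_def)
        then show False using arcs[OF B z zV] False by blast
      qed
    qed
    moreover have "connected (UNIV - S)"
      by (rule connected_open_delete_finite) (auto simp: finS)
    moreover have "f \<inter> S = {}" using face_props(4)[OF P f] by (auto simp: support_def S_def)
    ultimately show thesis using that[of S] by (simp add: Compl_eq_Diff_UNIV)
  qed
  have "- D \<subseteq> f"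
    by (rule connected_subset_if_disjoint_frontier[OF D(2)]) (use D face_props(3)[OF P f] in blast)+
  then have "pverts P \<subseteq> S" using D face_props(4)[OF P f] by (auto simp: support_def)
  then have "card (pverts P) \<le> card S" by (rule card_mono[OF finS])
  with V cS show False by simp
qed

lemma triangular_face:
  assumes P: "maximal_plane P" and f: "f \<in> faces P" and V: "3 \<le> card (pverts P)"
  shows "card (pverts P \<inter> frontier f) = 3"
  using face_vertices_card_le_3[OF P f] face_vertices_card_ge_3[OF _ f V] P
  by (force simp: maximal_plane_def)

section \<open>Stacking a vertex into a face\<close>

lemma arc_between_split:
  assumes "arc_between A u v" "x \<in> A" "x \<noteq> u" "x \<noteq> v"
  obtains B C where "arc_between B u x" "arc_between C x v" "B \<union> C = A" "B \<inter> C = {x}"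
proof -
  obtain g where g: "arc g" "path_image g = A" "pathstart g = u" "pathfinish g = v"
    using assms unfolding arc_between_def by blast
  have "x \<in> g ` {0<..<1}" using arc_interior_image[OF g(1)] g assms by blast
  then obtain t where t: "0 < t" "t < 1" "x = g t" by auto
  have inj: "\<And>a b. \<lbrakk>a \<in> {0..1}; b \<in> {0..1}; a \<noteq> b\<rbrakk> \<Longrightarrow> g a \<noteq> g b" using arc_eq_iff[OF g(1)] by blast
  have sub: "arc (subpath a b g) \<and> path_image (subpath a b g) = g ` {a..b}" if "0 \<le> a" "a < b" "b \<le> 1" for a b
    using that inj[of a b] g(1) by (auto simp: path_image_subpath intro!: arc_subpath_arc)
  have g01: "g 0 = u" "g 1 = v" using g by (auto simp: pathstart_def pathfinish_def)
  have "arc_between (g ` {0..t}) u x"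
    unfolding arc_between_def using sub[of 0 t] t g01 by (intro exI[of _ "subpath 0 t g"]) auto
  moreover have "arc_between (g ` {t..1}) x v"
    unfolding arc_between_def using sub[of t 1] t g01 by (intro exI[of _ "subpath t 1 g"]) auto
  moreover have "g ` {0..t} \<union> g ` {t..1} = A"
    using t g(2) by (auto simp: path_image_def image_Un[symmetric] ivl_disj_un)
  moreover have "g ` {0..t} \<inter> g ` {t..1} = {x}" using t by (auto simp: arc_eq_iff[OF g(1)])
  ultimately show thesis using that by blast
qed

lemma arc_between_first_hit:
  assumes "arc_between A u v" "closed B" "u \<notin> B" "v \<in> B"
  obtains C x where "arc_between C u x" "C \<subseteq> A" "C \<inter> B = {x}"
proof -
  obtain g where g: "arc g" "path_image g = A" "pathstart g = u" "pathfinish g = v"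
    using assms unfolding arc_between_def by blast
  have cont: "continuous_on {0..1} g" using g(1) by (simp add: arc_def path_def)
  define T where "T = {0..1} \<inter> g -` B"
  have "compact T" unfolding T_def
    using cont assms(2) by (metis closed_atLeastAtMost compact_Icc compact_eq_bounded_closed continuous_closed_preimage bounded_Int)
  moreover have "1 \<in> T" using g assms by (auto simp: T_def pathfinish_def)
  ultimately obtain t where t: "t \<in> T" "\<And>s. s \<in> T \<Longrightarrow> t \<le> s"
    using compact_attains_inf[of T] by blast
  have "t \<noteq> 0" using t(1) assms(3) g by (auto simp: T_def pathstart_def)
  then have t01: "0 < t" "t \<le> 1" "g t \<in> B" using t(1) by (auto simp: T_def)
  have "arc (subpath 0 t g)"
    using t01 arc_eq_iff[OF g(1), of 0 t] by (intro arc_subpath_arc[OF g(1)]) auto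
  then have "arc_between (g ` {0..t}) u (g t)"
    unfolding arc_between_def using t01 g(3)
    by (intro exI[of _ "subpath 0 t g"]) (auto simp: pathstart_def[of g] path_image_subpath)
  moreover have "g ` {0..t} \<subseteq> A" using t01 g(2) by (auto simp: path_image_def)
  moreover have "g ` {0..t} \<inter> B = {g t}"
  proof
    show "g ` {0..t} \<inter> B \<subseteq> {g t}"
    proof
      fix z assume "z \<in> g ` {0..t} \<inter> B"
      then obtain s where s: "z = g s" "0 \<le> s" "s \<le> t" "g s \<in> B" by auto
      then have "t \<le> s" using t01 by (intro t(2)) (auto simp: T_def)
      with s show "z \<in> {g t}" by simp
    qed
    show "{g t} \<subseteq> g ` {0..t} \<inter> B" using t01 by auto
  qed
  ultimately show thesis using that by blast
qed

text \<open>Two corners are joined by a chord in \<open>f\<close>. An arc from the third corner to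
  the chord is cut off where it first meets the chord, and that point is the centre
  \<open>x\<close>.\<close>

lemma face_tripod:
  assumes P: "is_plane_graph P" and f: "f \<in> faces P" and dist: "distinct [a, b, c]"
    and abc: "{a, b, c} \<subseteq> pverts P \<inter> frontier f"
  obtains x Ta Tb Tc where "x \<in> f" "arc_between Ta x a" "arc_between Tb x b" "arc_between Tc x c"
    "Ta - {a} \<subseteq> f" "Tb - {b} \<subseteq> f" "Tc - {c} \<subseteq> f" "Ta \<inter> Tb = {x}" "Ta \<inter> Tc = {x}" "Tb \<inter> Tc = {x}"
proof -
  note fp = face_props[OF P f]
  have nf: "a \<notin> f" "b \<notin> f" "c \<notin> f" using abc fp(4) by (auto simp: support_def)
  obtain B where B: "arc_between B a b" "B - {a, b} \<subseteq> f"
    using face_chord[OF P f, of a b] dist abc by auto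
  obtain y where y: "y \<in> B - {a, b}" using arc_between_interior(2)[OF B(1)] by blast
  obtain g where g: "arc g" "pathstart g = c" "path_image g - {c} \<subseteq> f"
    using face_vertex_access[OF P f, of c] abc by auto
  have "path_connected f" using fp by (simp add: connected_open_path_connected)
  then obtain m where m: "path m" "path_image m \<subseteq> f" "pathstart m = pathfinish g" "pathfinish m = y"
    using access_point[OF g] y B(2) unfolding path_connected_def by blast
  have "c \<noteq> y" using nf y B(2) by blast
  then obtain D where D: "arc_between D c y" "D \<subseteq> path_image (g +++ m)"
    using path_to_arc_between[of "g +++ m" c y] g m by (auto simp: arc_imp_path)
  then have Df: "D - {c} \<subseteq> f" using g m by (auto simp: path_image_join)
  have "c \<notin> B" using nf B(2) dist by auto
  then obtain Tc x where T: "arc_between Tc c x" "Tc \<subseteq> D" "Tc \<inter> B = {x}"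
    using arc_between_first_hit[OF D(1) arc_between_closed[OF B(1)]] y by blast
  \<comment> \<open>The meeting point lies in \<open>f\<close>, so it is not an end of the chord and
    splits it into two legs.\<close>
  have xf: "x \<in> f" using T Df arc_between_ends[OF T(1)] by blast
  then have "x \<noteq> a" "x \<noteq> b" "x \<in> B" using nf T by auto
  then obtain Ta Tb where TB: "arc_between Ta a x" "arc_between Tb x b" "Ta \<union> Tb = B" "Ta \<inter> Tb = {x}"
    using arc_between_split[OF B(1)] by metis
  have "b \<notin> Ta" "a \<notin> Tb"
    using TB(4) arc_between_ends[OF TB(1)] arc_between_ends[OF TB(2)] by (metis IntI singletonD)+
  then show thesis
  proof (intro that[OF xf arc_between_sym[OF TB(1)] TB(2) arc_between_sym[OF T(1)]])
    show "Ta - {a} \<subseteq> f" "Tb - {b} \<subseteq> f" using B(2) TB(3) \<open>b \<notin> Ta\<close> \<open>a \<notin> Tb\<close> by blast+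
    show "Tc - {c} \<subseteq> f" using T Df by blast
    show "Ta \<inter> Tb = {x}" by (rule TB)
    show "Ta \<inter> Tc = {x}" "Tb \<inter> Tc = {x}"
      using T(3) TB(3) arc_between_ends[OF TB(1)] arc_between_ends[OF TB(2)] by blast+
  qed
qed

text \<open>In an embedding of the enlarged graph plus an edge \<open>xw\<close>, the star of \<open>x\<close> makes \<open>w\<close>
  adjacent to \<open>a\<close>, \<open>b\<close>, \<open>c\<close> in the old graph, and then has all four of them in its closure.\<close>

lemma maximal_planar_stack:
  assumes max: "maximal_planar \<Gamma>" and x: "x \<notin> verts \<Gamma>"
    and abc: "{a, b} \<in> edges \<Gamma>" "{a, c} \<in> edges \<Gamma>" "{b, c} \<in> edges \<Gamma>" "distinct [a, b, c]"
    and \<Gamma>': "\<Gamma>' = \<lparr>verts = insert x (verts \<Gamma>), edges = edges \<Gamma> \<union> {{x, a}, {x, b}, {x, c}}\<rparr>"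
    and planar: "planar \<Gamma>'"
  shows "maximal_planar \<Gamma>'"
  unfolding maximal_planar_def
proof (intro conjI ballI impI)
  fix u v assume uv: "u \<in> verts \<Gamma>'" "v \<in> verts \<Gamma>'" "u \<noteq> v \<and> {u, v} \<notin> edges \<Gamma>'"
  have sg: "simple_graph \<Gamma>" using max by (simp add: maximal_planar_def planar_def)
  have eV: "e \<subseteq> verts \<Gamma>" if "e \<in> edges \<Gamma>" for e using sg that by (auto simp: simple_graph_def)
  have xE: "x \<notin> e" if "e \<in> edges \<Gamma>" for e using eV[OF that] x by blast
  show "\<not> planar (\<Gamma>'\<lparr>edges := insert {u, v} (edges \<Gamma>')\<rparr>)"
  proof
    assume "planar (\<Gamma>'\<lparr>edges := insert {u, v} (edges \<Gamma>')\<rparr>)"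
    then obtain Q where Q: "is_plane_graph Q"
      and "graph_iso (\<Gamma>'\<lparr>edges := insert {u, v} (edges \<Gamma>')\<rparr>) (skeleton Q)"
      unfolding planar_def by blast
    then obtain \<phi> where bij: "bij_betw \<phi> (insert x (verts \<Gamma>)) (pverts Q)"
      and EQ: "edges (skeleton Q) = (`) \<phi> ` (insert {u, v} (edges \<Gamma> \<union> {{x, a}, {x, b}, {x, c}}))"
      unfolding graph_iso_def \<Gamma>' by auto
    have inj: "inj_on \<phi> (insert x (verts \<Gamma>))" using bij by (simp add: bij_betw_def)
    have \<phi>x: "\<phi> w \<noteq> \<phi> x" if "w \<in> verts \<Gamma>" for w
      using inj x that by (metis inj_on_contraD insertCI)
    \<comment> \<open>Removing the image of \<open>x\<close> with its edges from the hypothetical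
      drawing leaves a drawing of the old graph, with the edge \<open>{u, v}\<close> added if that
      edge is not at \<open>x\<close>.\<close>
    define R where "R = \<lparr>pverts = pverts Q - {\<phi> x}, parcs = {A \<in> parcs Q. \<phi> x \<notin> A}\<rparr>"
    have AR: "A \<inter> pverts R = A \<inter> pverts Q" if "A \<in> parcs R" for A using that by (auto simp: R_def)
    have R: "is_plane_graph R"
      unfolding is_plane_graph_def
    proof (intro conjI ballI impI)
      show "finite (pverts R)" "finite (parcs R)" using Q by (auto simp: R_def is_plane_graph_def)
      fix A assume A: "A \<in> parcs R"
      then have AQ: "A \<in> parcs Q" by (simp add: R_def)
      then have "plane_edge (pverts Q) A" using Q by (simp add: is_plane_graph_def)
      then show "plane_edge (pverts R) A" unfolding plane_edge_def AR[OF A] .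
      fix B assume B: "B \<in> parcs R" "A \<noteq> B"
      then have BQ: "B \<in> parcs Q" by (simp add: R_def)
      have "A \<inter> B \<subseteq> A \<inter> pverts Q" "A \<inter> pverts Q \<noteq> B \<inter> pverts Q"
        using plane_arcs_inter[OF Q AQ BQ B(2)] Q AQ BQ B(2) unfolding is_plane_graph_def by blast+
      then show "A \<inter> B \<subseteq> pverts R" "A \<inter> pverts R \<noteq> B \<inter> pverts R"
        using AR[OF A] AR[OF B(1)] by auto
    qed
    have ER: "edges (skeleton R) = {e \<in> edges (skeleton Q). \<phi> x \<notin> e}"
    proof -
      have "\<phi> x \<in> pverts Q" using bij by (auto simp: bij_betw_def)
      then have "parcs R = {A \<in> parcs Q. \<phi> x \<notin> A \<inter> pverts Q}" by (simp add: R_def)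
      moreover have "edges (skeleton R) = (\<lambda>A. A \<inter> pverts Q) ` parcs R"
        unfolding edges_skeleton by (rule image_cong) (use AR in auto)
      ultimately show ?thesis by (auto simp: edges_skeleton)
    qed
    have bijR: "bij_betw \<phi> (verts \<Gamma>) (pverts R)"
      unfolding bij_betw_def
    proof
      show "inj_on \<phi> (verts \<Gamma>)" using inj by (rule inj_on_subset) auto
      have "\<phi> x \<notin> \<phi> ` verts \<Gamma>" using \<phi>x by force
      moreover have "pverts Q = insert (\<phi> x) (\<phi> ` verts \<Gamma>)" using bij by (auto simp: bij_betw_def)
      ultimately show "\<phi> ` verts \<Gamma> = pverts R" by (simp add: R_def)
    qed
    have \<phi>e: "\<phi> x \<notin> \<phi> ` e" if "e \<subseteq> verts \<Gamma>" for e
      using \<phi>x that by (metis imageE subsetD)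
    show False
    proof (cases "x \<in> {u, v}")
      case False
      then have uv\<Gamma>: "u \<in> verts \<Gamma>" "v \<in> verts \<Gamma>" "u \<noteq> v" "{u, v} \<notin> edges \<Gamma>"
        using uv by (auto simp: \<Gamma>')
      have "edges (skeleton R) = (`) \<phi> ` insert {u, v} (edges \<Gamma>)"
      proof -
        have "\<phi> x \<notin> \<phi> ` e" if "e \<in> insert {u, v} (edges \<Gamma>)" for e
          using \<phi>e[of e] eV that uv\<Gamma> by auto
        then show ?thesis unfolding ER EQ by auto
      qed
      then have "planar (\<Gamma>\<lparr>edges := insert {u, v} (edges \<Gamma>)\<rparr>)"
        unfolding planar_def graph_iso_def using R bijR sg uv\<Gamma>
        by (auto simp: simple_graph_def intro!: exI[of _ R] exI[of _ \<phi>])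
      then show False using max uv\<Gamma> unfolding maximal_planar_def by blast
    next
      case True
      then obtain w where w: "{u, v} = {x, w}" "w \<in> verts \<Gamma>" using uv by (auto simp: \<Gamma>')
      have wabc: "w \<notin> {a, b, c}" using uv(3) unfolding \<Gamma>' w by auto
      have ER': "edges (skeleton R) = (`) \<phi> ` edges \<Gamma>"
      proof -
        have "\<phi> x \<notin> \<phi> ` e" if "e \<in> edges \<Gamma>" for e using \<phi>e[of e] eV that by auto
        then show ?thesis unfolding ER EQ w by auto
      qed
      have abcV: "a \<in> verts \<Gamma>" "b \<in> verts \<Gamma>" "c \<in> verts \<Gamma>" using eV abc by blast+
      have xs: "\<exists>A. A \<in> parcs Q \<and> arc_between A (\<phi> s) (\<phi> x) \<and> A \<inter> pverts Q = {\<phi> s, \<phi> x}"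
        if "s \<in> {a, b, c, w}" for s
      proof -
        have "{x, s} \<in> insert {u, v} (edges \<Gamma> \<union> {{x, a}, {x, b}, {x, c}})"
          using that unfolding w by auto
        then have "\<phi> ` {x, s} \<in> edges (skeleton Q)" unfolding EQ by (rule imageI)
        then have "{\<phi> s, \<phi> x} \<in> edges (skeleton Q)" by (simp add: insert_commute)
        then show ?thesis using skeleton_edgeE[OF Q] by metis
      qed
      then obtain T where T: "\<And>s. s \<in> {a, b, c, w} \<Longrightarrow> T s \<in> parcs Q"
        "\<And>s. s \<in> {a, b, c, w} \<Longrightarrow> arc_between (T s) (\<phi> s) (\<phi> x)"
        "\<And>s. s \<in> {a, b, c, w} \<Longrightarrow> T s \<inter> pverts Q = {\<phi> s, \<phi> x}" by metis
      have sV: "s \<in> verts \<Gamma>" if "s \<in> {a, b, c, w}" for s using that abcV w by blast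
      have Tint: "T s \<inter> B \<subseteq> {\<phi> s}" if s: "s \<in> {a, b, c, w}" and B: "B \<in> parcs Q" "\<phi> x \<notin> B" for s B
      proof -
        have "T s \<noteq> B" using T(3)[OF s] B by blast
        then have "T s \<inter> B = {\<phi> s, \<phi> x} \<inter> (B \<inter> pverts Q)"
          using plane_arcs_inter[OF Q T(1)[OF s] B(1)] T(3)[OF s] by simp
        with B show ?thesis by blast
      qed
      have Tsup: "T s \<inter> support R \<subseteq> {\<phi> s}" if s: "s \<in> {a, b, c, w}" for s
      proof -
        have "T s \<inter> (pverts Q - {\<phi> x}) \<subseteq> {\<phi> s}" using T(3)[OF s] by blast
        then show ?thesis using Tint[OF s] by (auto simp: support_def R_def)
      qed
      have adj: "{s, w} \<in> edges \<Gamma>" if s: "s \<in> {a, b, c}" for s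
      proof (rule maximal_planar_adjacent[OF max R bijR ER'])
        have s': "s \<in> {a, b, c, w}" "s \<noteq> w" using s wabc by auto
        have "\<phi> s \<noteq> \<phi> w" using inj s' sV[OF s'(1)] w(2) by (metis inj_onD insertI2)
        then have "T s \<noteq> T w" using T(3)[OF s'(1)] T(3)[of w] \<phi>x[OF sV[OF s'(1)]] by auto
        then have "T s \<inter> T w = {\<phi> s, \<phi> x} \<inter> {\<phi> w, \<phi> x}"
          using plane_arcs_inter[OF Q T(1)[OF s'(1)] T(1)[of w]] T(3)[OF s'(1)] T(3)[of w] by auto
        then have "T s \<inter> T w \<subseteq> {\<phi> x}" using \<open>\<phi> s \<noteq> \<phi> w\<close> by auto
        then show "arc_between (T s \<union> T w) (\<phi> s) (\<phi> w)"
          using arc_between_join[OF T(2)[OF s'(1)] arc_between_sym[OF T(2)[of w]]] by auto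
        show "(T s \<union> T w) \<inter> support R \<subseteq> {\<phi> s, \<phi> w}" using Tsup[OF s'(1)] Tsup[of w] by auto
        show "s \<in> verts \<Gamma>" "w \<in> verts \<Gamma>" "s \<noteq> w" using s' sV w by auto
      qed
      \<comment> \<open>The outer ends are left out so that \<open>C\<close> avoids all edges among
        the four vertices while still having these vertices in its closure.\<close>
      define C where "C = (\<Union>s\<in>{a, b, c, w}. T s - {\<phi> s})"
      have Tcon: "connected (T s - {\<phi> s})" "\<phi> x \<in> T s - {\<phi> s}" "\<phi> s \<in> closure (T s - {\<phi> s})"
        if s: "s \<in> {a, b, c, w}" for s
      proof -
        have cl: "closure (T s - {\<phi> s, \<phi> x}) = T s" by (rule arc_between_interior[OF T(2)[OF s]])
        show "connected (T s - {\<phi> s})"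
          by (rule connected_intermediate_closure[OF arc_between_interior(1)[OF T(2)[OF s]]])
             (use cl in auto)
        show "\<phi> x \<in> T s - {\<phi> s}" using arc_between_ends[OF T(2)[OF s]] by auto
        have "closure (T s - {\<phi> s, \<phi> x}) \<subseteq> closure (T s - {\<phi> s})" by (intro closure_mono) auto
        then show "\<phi> s \<in> closure (T s - {\<phi> s})" using arc_between_ends[OF T(2)[OF s]] cl by auto
      qed
      show False
      proof (rule plane_graph_K4_face[OF Q, where a = "\<phi> a" and b = "\<phi> b" and c = "\<phi> c" and d = "\<phi> w" and C = C])
        show "distinct [\<phi> a, \<phi> b, \<phi> c, \<phi> w]"
          using abc(4) wabc abcV w(2) inj by (auto simp: inj_on_eq_iff)
        have e: "{\<phi> s, \<phi> t} \<in> edges (skeleton Q)" if "{s, t} \<in> edges \<Gamma>" for s t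
        proof -
          have "\<phi> ` {s, t} \<in> edges (skeleton Q)" unfolding EQ using that by (intro imageI) auto
          then show ?thesis by simp
        qed
        show "{\<phi> a, \<phi> b} \<in> edges (skeleton Q)" "{\<phi> a, \<phi> c} \<in> edges (skeleton Q)" "{\<phi> b, \<phi> c} \<in> edges (skeleton Q)"
          "{\<phi> a, \<phi> w} \<in> edges (skeleton Q)" "{\<phi> b, \<phi> w} \<in> edges (skeleton Q)" "{\<phi> c, \<phi> w} \<in> edges (skeleton Q)"
          using abc adj by (auto intro!: e)
        show "connected C" unfolding C_def
        proof (rule connected_Union)
          fix S assume "S \<in> (\<lambda>s. T s - {\<phi> s}) ` {a, b, c, w}"
          then obtain s where s: "S = T s - {\<phi> s}" "s \<in> {a, b, c, w}" by (rule imageE)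
          show "connected S" unfolding s(1) by (rule Tcon(1)[OF s(2)])
        next
          have "\<phi> x \<in> (\<Inter>s\<in>{a, b, c, w}. T s - {\<phi> s})" using Tcon(2) by blast
          then show "(\<Inter>s\<in>{a, b, c, w}. T s - {\<phi> s}) \<noteq> {}" by blast
        qed
        show "{\<phi> a, \<phi> b, \<phi> c, \<phi> w} \<subseteq> closure C"
        proof -
          have "\<phi> s \<in> closure C" if s: "s \<in> {a, b, c, w}" for s
            using Tcon(3)[OF s] closure_mono[of "T s - {\<phi> s}" C] s by (auto simp: C_def)
          then show ?thesis by simp
        qed
        fix A assume A: "A \<in> parcs Q" "A \<inter> pverts Q \<subseteq> {\<phi> a, \<phi> b, \<phi> c, \<phi> w}"
        have "\<phi> x \<in> pverts Q" using bij by (auto simp: bij_betw_def)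
        then have "\<phi> x \<in> A \<Longrightarrow> \<phi> x \<in> {\<phi> a, \<phi> b, \<phi> c, \<phi> w}" using A(2) by blast
        then have "\<phi> x \<notin> A" using \<phi>x[OF abcV(1)] \<phi>x[OF abcV(2)] \<phi>x[OF abcV(3)] \<phi>x[OF w(2)] by auto
        then show "C \<inter> A = {}" using Tint A(1) by (auto simp: C_def)
      qed
    qed
  qed
qed (rule planar)

lemma plane_graph_add_vertex:
  assumes P: "is_plane_graph P" and x: "x \<notin> support P"
  defines "P' \<equiv> P\<lparr>pverts := insert x (pverts P)\<rparr>"
  shows "is_plane_graph P'" "edges (skeleton P') = edges (skeleton P)"
proof -
  have sel: "pverts P' = insert x (pverts P)" "parcs P' = parcs P" by (simp_all add: P'_def)
  have A: "A \<inter> insert x (pverts P) = A \<inter> pverts P" if "A \<in> parcs P" for A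
    using x that by (auto simp: support_def)
  have "plane_edge (pverts P') B" if "B \<in> parcs P" for B
    using P that A[OF that] unfolding is_plane_graph_def plane_edge_def sel by auto
  moreover have "B \<inter> C \<subseteq> pverts P' \<and> B \<inter> pverts P' \<noteq> C \<inter> pverts P'"
    if "B \<in> parcs P" "C \<in> parcs P" "B \<noteq> C" for B C
    using P that A[OF that(1)] A[OF that(2)] unfolding is_plane_graph_def sel by blast
  moreover have "finite (pverts P')" "finite (parcs P')" using P by (auto simp: is_plane_graph_def sel)
  ultimately show "is_plane_graph P'"
    unfolding is_plane_graph_def sel(2) by blast
  show "edges (skeleton P') = edges (skeleton P)"
    using A by (simp add: edges_skeleton sel)
qed

lemma components_subset_superset:
  assumes "C \<in> components S" "C \<subseteq> T" "T \<subseteq> S"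
  shows "C \<in> components T"
  using assms unfolding in_components_maximal by (metis order_trans)

text \<open>For two corners, their legs to \<open>x\<close> and the edge between them form a Jordan
  curve with a side free of the third leg. Close to \<open>x\<close> this side contains points of
  \<open>f\<close>, and the component of such a point is the new face; the bound of three vertices
  per face then determines its corners. Faces other than \<open>f\<close> are disjoint from the legs
  and survive.\<close>

lemma stack_face:
  assumes P: "maximal_plane P" and f: "f \<in> faces P"
    and abc: "pverts P \<inter> frontier f = {a, b, c}" and dist: "distinct [a, b, c]"
  obtains P' x where "maximal_plane P'" "plane_subgraph P P'" "x \<notin> pverts P"
    "pverts P' = insert x (pverts P)"
    "edges (skeleton P') = edges (skeleton P) \<union> {{x, a}, {x, b}, {x, c}}"
    "\<And>h. \<lbrakk>h \<in> faces P; h \<noteq> f\<rbrakk> \<Longrightarrow> h \<in> faces P' \<and> pverts P' \<inter> frontier h = pverts P \<inter> frontier h"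
    "\<And>s. s \<in> {a, b, c} \<Longrightarrow> \<exists>g\<in>faces P'. pverts P' \<inter> frontier g = insert x ({a, b, c} - {s})"
proof -
  have pl: "is_plane_graph P" using P by (simp add: maximal_plane_def)
  note fp = face_props[OF pl f]
  have V: "a \<in> pverts P" "b \<in> pverts P" "c \<in> pverts P" using abc by auto
  have nf: "a \<notin> f" "b \<notin> f" "c \<notin> f" using V fp(4) by (auto simp: support_def)
  have E: "{a, b} \<in> edges (skeleton P)" "{a, c} \<in> edges (skeleton P)" "{b, c} \<in> edges (skeleton P)"
    using abc dist by (auto intro!: face_vertices_adjacent[OF P f])
  obtain x Ta Tb Tc where x: "x \<in> f"
    and T: "arc_between Ta x a" "arc_between Tb x b" "arc_between Tc x c"
    and Tf: "Ta - {a} \<subseteq> f" "Tb - {b} \<subseteq> f" "Tc - {c} \<subseteq> f"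
    and TT: "Ta \<inter> Tb = {x}" "Ta \<inter> Tc = {x}" "Tb \<inter> Tc = {x}"
    using face_tripod[OF pl f dist] abc by blast
  have xs: "x \<notin> support P" using x fp(4) by blast
  then have xV: "x \<notin> pverts P" by (simp add: support_def)
  have Tsup: "Ta \<inter> support P = {a}" "Tb \<inter> support P = {b}" "Tc \<inter> support P = {c}"
    using Tf fp(4) V arc_between_ends[OF T(1)] arc_between_ends[OF T(2)] arc_between_ends[OF T(3)]
    by (auto simp: support_def)
  define P0 where "P0 = P\<lparr>pverts := insert x (pverts P)\<rparr>"
  have P0: "is_plane_graph P0" "edges (skeleton P0) = edges (skeleton P)"
    using plane_graph_add_vertex[OF pl xs] by (auto simp: P0_def)
  have xE: "{x, s} \<notin> edges (skeleton P)" for s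
    using simple_graph_skeleton[OF pl] xV by (auto simp: simple_graph_def)
  have sup0: "support P0 = insert x (support P)" by (auto simp: P0_def support_def)
  define P1 where "P1 = P0\<lparr>parcs := insert Ta (parcs P0)\<rparr>"
  have pv0: "pverts P0 = insert x (pverts P)" by (simp add: P0_def)
  have "Ta \<inter> support P0 = {x, a}" unfolding sup0 using Tsup arc_between_ends[OF T(1)] by blast
  moreover have "{x, a} \<notin> edges (skeleton P0)" using xE by (simp add: P0(2))
  ultimately have "is_plane_graph P1 \<and> skeleton P1 = (skeleton P0)\<lparr>edges := insert {x, a} (edges (skeleton P0))\<rparr>"
    unfolding P1_def using plane_graph_add_arc[OF P0(1) _ _ T(1)] V pv0 by simp
  then have P1: "is_plane_graph P1" "edges (skeleton P1) = insert {x, a} (edges (skeleton P))"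
    by (auto simp: P0(2))
  have pv1: "pverts P1 = insert x (pverts P)" by (simp add: P1_def pv0)
  have sup1: "support P1 = insert x (support P) \<union> Ta" by (auto simp: P1_def P0_def support_def)
  define P2 where "P2 = P1\<lparr>parcs := insert Tb (parcs P1)\<rparr>"
  have "Tb \<inter> support P1 = {x, b}" unfolding sup1 using Tsup TT arc_between_ends[OF T(2)] by blast
  moreover have "{x, b} \<notin> edges (skeleton P1)" using xE dist xV V by (auto simp: P1(2) doubleton_eq_iff)
  ultimately have "is_plane_graph P2 \<and> skeleton P2 = (skeleton P1)\<lparr>edges := insert {x, b} (edges (skeleton P1))\<rparr>"
    unfolding P2_def using plane_graph_add_arc[OF P1(1) _ _ T(2)] V pv1 by simp
  then have P2: "is_plane_graph P2" "edges (skeleton P2) = insert {x, b} (insert {x, a} (edges (skeleton P)))"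
    by (auto simp: P1(2))
  have pv2: "pverts P2 = insert x (pverts P)" by (simp add: P2_def pv1)
  have sup2: "support P2 = insert x (support P) \<union> Ta \<union> Tb" by (auto simp: P2_def P1_def P0_def support_def)
  define P' where "P' = P2\<lparr>parcs := insert Tc (parcs P2)\<rparr>"
  have "Tc \<inter> support P2 = {x, c}" unfolding sup2 using Tsup TT arc_between_ends[OF T(3)] by blast
  moreover have "{x, c} \<notin> edges (skeleton P2)" using xE dist xV V by (auto simp: P2(2) doubleton_eq_iff)
  ultimately have "is_plane_graph P' \<and> skeleton P' = (skeleton P2)\<lparr>edges := insert {x, c} (edges (skeleton P2))\<rparr>"
    unfolding P'_def using plane_graph_add_arc[OF P2(1) _ _ T(3)] V pv2 by simp
  then have P': "is_plane_graph P'"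
    "edges (skeleton P') = edges (skeleton P) \<union> {{x, a}, {x, b}, {x, c}}"
    by (auto simp: P2(2))
  have sel: "pverts P' = insert x (pverts P)" "parcs P' = {Ta, Tb, Tc} \<union> parcs P"
    by (auto simp: P'_def P2_def P1_def P0_def)
  have sup': "support P' = support P \<union> Ta \<union> Tb \<union> Tc"
    using arc_between_ends[OF T(1)] by (auto simp: support_def sel)
  have max': "maximal_plane P'"
    unfolding maximal_plane_def
  proof
    show "maximal_planar (skeleton P')"
    proof (rule maximal_planar_stack)
      show "maximal_planar (skeleton P)" using P by (simp add: maximal_plane_def)
      show "x \<notin> verts (skeleton P)" using xV by simp
      show "skeleton P' = \<lparr>verts = insert x (verts (skeleton P)), edges = edges (skeleton P) \<union> {{x, a}, {x, b}, {x, c}}\<rparr>"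
        using P'(2) sel by simp
      show "planar (skeleton P')"
        unfolding planar_def graph_iso_def using simple_graph_skeleton[OF P'(1)] P'(1)
        by (intro conjI exI[of _ P'] exI[of _ id]) auto
    qed (use E dist in auto)
  qed (rule P'(1))
  have Tsub: "Ta \<union> Tb \<union> Tc \<subseteq> f \<union> support P"
  proof -
    have "{a, b, c} \<subseteq> support P" using V by (auto simp: support_def)
    then show ?thesis using Tf by blast
  qed
  have old: "h \<in> faces P' \<and> pverts P' \<inter> frontier h = pverts P \<inter> frontier h" if h: "h \<in> faces P" "h \<noteq> f" for h
  proof
    have hf: "h \<inter> f = {}" using h f components_nonoverlap unfolding faces_support by blast
    note hp = face_props[OF pl h(1)]
    have "h \<subseteq> - support P'"
      using hp(4) hf Tsub unfolding sup' by blast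
    moreover have "- support P' \<subseteq> - support P" unfolding sup' by blast
    ultimately show "h \<in> faces P'"
      using h(1) unfolding faces_support by (rule components_subset_superset[rotated])
    have "f \<inter> closure h = {}" using fp(1) hf by (metis Int_commute open_Int_closure_eq_empty)
    then have "x \<notin> frontier h" using x by (auto simp: frontier_def)
    then show "pverts P' \<inter> frontier h = pverts P \<inter> frontier h" by (auto simp: sel)
  qed
  have new: "\<exists>g\<in>faces P'. pverts P' \<inter> frontier g = {x, t, t'}"
    if st: "arc_between S x s" "arc_between Tt x t" "arc_between Tt' x t'"
      and f': "Tt - {t} \<subseteq> f" "Tt' - {t'} \<subseteq> f" "S - {s} \<subseteq> f"
      and d: "distinct [s, t, t']" "{s, t, t'} \<subseteq> pverts P"
      and i: "Tt \<inter> Tt' = {x}" "S \<inter> Tt = {x}" "S \<inter> Tt' = {x}" and e: "{t, t'} \<in> edges (skeleton P)"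
      and su: "S \<union> Tt \<union> Tt' = Ta \<union> Tb \<union> Tc" for S Tt Tt' s t t'
  proof -
    obtain F where F: "F \<in> parcs P" "arc_between F t t'" "F \<inter> pverts P = {t, t'}"
      using skeleton_edgeE[OF pl e] .
    have nft: "t \<notin> f" "t' \<notin> f" "s \<notin> f" using d fp(4) by (auto simp: support_def)
    define B where "B = Tt \<union> Tt'"
    have B: "arc_between B t t'" unfolding B_def
      using arc_between_join[OF arc_between_sym[OF st(2)] st(3)] i by blast
    have Bsup: "B \<inter> support P = {t, t'}"
      using f' fp(4) d arc_between_ends[OF st(2)] arc_between_ends[OF st(3)]
      by (auto simp: B_def support_def)
    have BF: "B \<inter> F = {t, t'}"
    proof
      show "B \<inter> F \<subseteq> {t, t'}" using Bsup F(1) by (auto simp: support_def)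
      show "{t, t'} \<subseteq> B \<inter> F" using arc_between_ends[OF B] arc_between_ends[OF F(2)] by auto
    qed
    have Fsup: "F \<subseteq> support P" using F(1) by (auto simp: support_def)
    have sF: "s \<notin> F" using F(3) d by auto
    have con: "connected (S - {x})"
      by (rule connected_intermediate_closure[OF arc_between_interior(1)[OF st(1)]])
         (use arc_between_interior(3)[OF st(1)] in auto)
    have sB: "s \<notin> B" using Bsup d by (auto simp: support_def)
    have "(S - {x}) \<inter> (B \<union> F) = {}"
      using i sF sB f'(3) fp(4) Fsup by (auto simp: B_def)
    then obtain W where W: "open W" "connected W" "W \<noteq> {}" "frontier W = B \<union> F" "W \<inter> (B \<union> F) = {}"
      "closure W \<inter> (S - {x}) = {}"
      using jordan_side_avoiding[OF B F(2) BF con] by metis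
    have xB: "x \<in> B" using arc_between_ends[OF st(2)] by (simp add: B_def)
    then have "x \<in> closure W" using W(4) by (auto simp: frontier_def)
    \<comment> \<open>\<open>f\<close> is an open neighbourhood of \<open>x\<close>, and
      \<open>x\<close> lies on the boundary of \<open>W\<close>.\<close>
    then obtain p where p: "p \<in> f" "p \<in> W" using fp(1) x by (metis IntE closure_iff_nhds_not_empty equals0I order_refl disjoint_iff open_Int_closure_eq_empty)
    obtain g where g: "arc g" "path_image g = B" "pathstart g = t" "pathfinish g = t'"
      using B unfolding arc_between_def by blast
    have "x \<in> g ` {0<..<1}" using arc_interior_image[OF g(1)] g xB nft x by auto
    then obtain \<tau> where \<tau>: "0 < \<tau>" "\<tau> < 1" "x = g \<tau>" by auto
    \<comment> \<open>A face of the drawing in which only the two legs have been added. It has these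
      legs on its frontier, and being confined to \<open>W\<close> it is untouched by the third
      leg.\<close>
    define h where "h = connected_component_set (- (support P \<union> B)) p"
    have pB: "p \<notin> support P \<union> B" using p W(5) fp(4) by blast
    have "path_image g \<subseteq> frontier (connected_component_set (- (support P \<union> path_image g)) p)"
    proof (rule arc_subset_frontier_component[OF closed_support[OF pl] g(1) _ _ \<tau>(1,2)])
      show "connected_component (- support P) p (g \<tau>)"
        unfolding connected_component_def using p x fp \<tau>(3) by (intro exI[of _ f]) auto
    qed (use Bsup g pB in auto)
    then have Bh: "B \<subseteq> frontier h" by (simp add: g h_def)
    have hc: "connected h" "h \<subseteq> - (support P \<union> B)"
      unfolding h_def by (rule connected_connected_component connected_component_subset)+
    have ph: "p \<in> h" unfolding h_def using pB by simp
    have "h \<subseteq> W"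
      by (rule connected_subset_if_disjoint_frontier[OF hc(1)]) (use hc ph p W(4) Fsup in blast)+
    then have "h \<inter> S = {}" using W(6) closure_subset[of W] hc(2) xB by blast
    then have "h \<subseteq> - support P'" using hc(2) su unfolding sup' B_def by blast
    moreover have "h \<in> components (- (support P \<union> B))" unfolding h_def components_iff using pB by auto
    ultimately have hP': "h \<in> faces P'"
      unfolding faces_support by (elim components_subset_superset) (use su in \<open>auto simp: sup' B_def\<close>)
    have sub: "{x, t, t'} \<subseteq> pverts P' \<inter> frontier h"
      using Bh xB arc_between_ends[OF B] d by (auto simp: sel)
    have "x \<noteq> t" "x \<noteq> t'" "t \<noteq> t'" using d xV by auto
    then have "card {x, t, t'} = 3" by simp
    moreover have "finite (pverts P' \<inter> frontier h)" using P'(1) by (simp add: is_plane_graph_def)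
    ultimately have "{x, t, t'} = pverts P' \<inter> frontier h"
      using face_vertices_card_le_3[OF max' hP'] sub by (metis card_seteq)
    with hP' show ?thesis by blast
  qed
  have n1: "\<exists>g\<in>faces P'. pverts P' \<inter> frontier g = {x, b, c}"
    by (rule new[OF T(1,2,3) Tf(2,3,1)]) (use dist V TT E in auto)
  have n2: "\<exists>g\<in>faces P'. pverts P' \<inter> frontier g = {x, a, c}"
    by (rule new[OF T(2,1,3) Tf(1,3,2)]) (use dist V TT E in \<open>auto simp: Int_commute\<close>)
  have n3: "\<exists>g\<in>faces P'. pverts P' \<inter> frontier g = {x, a, b}"
    by (rule new[OF T(3,1,2) Tf(1,2,3)]) (use dist V TT E in \<open>auto simp: Int_commute\<close>)
  have "{a, b, c} - {a} = {b, c}" "{a, b, c} - {b} = {a, c}" "{a, b, c} - {c} = {a, b}" using dist by auto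
  then have "\<exists>g\<in>faces P'. pverts P' \<inter> frontier g = insert x ({a, b, c} - {s})" if s: "s \<in> {a, b, c}" for s
    using s n1 n2 n3 by (elim insertE emptyE) simp_all
  moreover have "plane_subgraph P P'" by (auto simp: plane_subgraph_def sel)
  ultimately show thesis using that[OF max' _ xV sel(1) P'(2) old] by blast
qed

section \<open>Raising eccentricities\<close>

lemma gdist_predecessor:
  assumes "u \<noteq> x" "gdist G u x \<noteq> \<infinity>"
  obtains s where "s \<in> verts G" "{s, x} \<in> edges G" "gdist G u s + 1 \<le> gdist G u x"
proof -
  obtain n where n: "gdist G u x = enat n" using assms by auto
  then obtain xs where xs: "walk G xs" "hd xs = u" "last xs = x" "length xs \<le> Suc n"
    using gdist_le_iff[of G u x n] by auto
  define ys where "ys = butlast xs"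
  have "xs \<noteq> []" using xs(1) by (simp add: walk_def)
  then have split: "xs = ys @ [x]" using xs(3) by (metis append_butlast_last_id ys_def)
  then have "ys \<noteq> []" using xs(2) assms(1) by auto
  then have w: "walk G ys" "{last ys, x} \<in> edges G" "hd ys = u"
    using xs(1,2) walk_append_iff[of ys "[x]"] unfolding split by auto
  have "last ys \<in> verts G" using w(1) \<open>ys \<noteq> []\<close> last_in_set[of ys] by (auto simp: walk_def)
  moreover have "gdist G u (last ys) \<le> enat (length ys - 1)"
    by (rule gdist_le_walk[OF w(1,3)]) auto
  moreover have "length ys - 1 + 1 \<le> n" using xs(4) split \<open>ys \<noteq> []\<close> by (cases ys) auto
  ultimately show thesis using w(2) n that[of "last ys"]
    by (metis add_right_mono enat_ord_simps(1) one_enat_def order_trans plus_enat_simps(1))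
qed

text \<open>Counts down the stacking still possible for an unfinished vertex. The three distances
  are at most \<alpha> each, and the extra \<open>1\<close> keeps the value positive until the
  vertex is finished, so that finishing is a strict decrease as well.\<close>

definition defect :: "plane_graph \<Rightarrow> nat \<Rightarrow> complex set \<Rightarrow> complex \<Rightarrow> nat" where
  "defect G \<alpha> f u = (if ecc (skeleton G) u < enat \<alpha>
     then 3 * \<alpha> + 1 - (\<Sum>s\<in>pverts G \<inter> frontier f. the_enat (gdist (skeleton G) u s)) else 0)"

text \<open>With \<open>V\<close> all vertices this is \<open>u \<in> qcc\<close> of the boundary of \<open>f\<close>; the quantifier stays on the
  original vertices while \<open>G\<close> grows.\<close>

definition face_serves :: "plane_graph \<Rightarrow> complex set \<Rightarrow> complex set \<Rightarrow> complex \<Rightarrow> bool" where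
  "face_serves G V f u \<longleftrightarrow> f \<in> faces G \<and>
     (\<forall>v\<in>V. \<exists>s\<in>pverts G \<inter> frontier f. gdist (skeleton G) v s \<le> gdist (skeleton G) u s)"

text \<open>A new vertex \<open>x\<close> in the face of an unfinished vertex: every unfinished vertex using
  the same face moves to the new triangle that replaces its nearest corner by \<open>x\<close>. This keeps the
  invariant and raises the sum of its distances to the corners by one.\<close>

lemma stacking_step:
  assumes G: "maximal_plane G" "3 \<le> card (pverts G)" and V: "V \<subseteq> pverts G"
    and le: "\<And>v. v \<in> V \<Longrightarrow> ecc (skeleton G) v \<le> enat \<alpha>"
    and F: "\<And>u. \<lbrakk>u \<in> V; ecc (skeleton G) u < enat \<alpha>\<rbrakk> \<Longrightarrow> face_serves G V (F u) u"
    and u: "u \<in> V" "ecc (skeleton G) u < enat \<alpha>"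
  obtains G' F' where "maximal_plane G'" "3 \<le> card (pverts G')" "plane_subgraph G G'"
    "\<And>v. v \<in> V \<Longrightarrow> ecc (skeleton G') v \<le> enat \<alpha>"
    "\<And>u. \<lbrakk>u \<in> V; ecc (skeleton G') u < enat \<alpha>\<rbrakk> \<Longrightarrow> face_serves G' V (F' u) u"
    "\<And>v. v \<in> V \<Longrightarrow> defect G' \<alpha> (F' v) v \<le> defect G \<alpha> (F v) v"
    "defect G' \<alpha> (F' u) u < defect G \<alpha> (F u) u"
proof -
  define f where "f = F u"
  have fs: "face_serves G V f u" using F[OF u] by (simp add: f_def)
  then have f: "f \<in> faces G" by (simp add: face_serves_def)
  define S where "S = pverts G \<inter> frontier f"
  have "card S = 3" unfolding S_def by (rule triangular_face[OF G(1) f G(2)])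
  then obtain a b c where abc: "S = {a, b, c}" "distinct [a, b, c]" by (auto simp: card_3_iff)
  have finS: "finite S" by (simp add: abc)
  have SV: "S \<subseteq> pverts G" by (simp add: S_def)
  obtain G' x where G': "maximal_plane G'" "plane_subgraph G G'" "x \<notin> pverts G"
    "pverts G' = insert x (pverts G)"
    "edges (skeleton G') = edges (skeleton G) \<union> {{x, a}, {x, b}, {x, c}}"
    "\<And>h. \<lbrakk>h \<in> faces G; h \<noteq> f\<rbrakk> \<Longrightarrow> h \<in> faces G' \<and> pverts G' \<inter> frontier h = pverts G \<inter> frontier h"
    "\<And>s. s \<in> {a, b, c} \<Longrightarrow> \<exists>g\<in>faces G'. pverts G' \<inter> frontier g = insert x ({a, b, c} - {s})"
    using stack_face[OF G(1) f abc(1)[unfolded S_def] abc(2)] by metis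
  interpret ext: plane_extension G G'
    using G G' by unfold_locales (auto simp: maximal_plane_def)
  let ?d = "gdist (skeleton G)" and ?d' = "gdist (skeleton G')"
  have old: "?d' v y = ?d v y" if "v \<in> pverts G" "y \<in> pverts G" for v y
    by (rule ext.gdist_eq[OF G(1) that])
  have dle: "?d v y \<le> enat \<alpha>" if "v \<in> V" "y \<in> pverts G" for v y
    using le[OF that(1)] ecc_ge[of y "skeleton G" v] that(2) by (metis order_trans verts_skeleton)
  have xup: "?d' v x \<le> ?d v s + 1" if "v \<in> V" "s \<in> S" for v s
  proof -
    have "{s, x} \<in> edges (skeleton G')" using that(2) unfolding G'(5) abc(1) by (auto simp: insert_commute)
    then have "?d' s x \<le> 1" using that(2) SV by (intro gdist_edge) (auto simp: G'(4))
    then show ?thesis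
      using gdist_triangle[of "skeleton G'" v x s] old[of v s] that V SV
      by (metis add_left_mono order_trans subsetD)
  qed
  \<comment> \<open>The last step of a shortest walk to \<open>x\<close> comes from a neighbour of
    \<open>x\<close>, and these are the corners in \<open>S\<close>.\<close>
  have xlow: "\<exists>s\<in>S. ?d v s + 1 \<le> ?d' v x" if v: "v \<in> V" for v
  proof -
    have "?d v a \<le> enat \<alpha>" using dle[OF v, of a] SV abc(1) by auto
    then have "?d' v x \<noteq> \<infinity>" using xup[OF v, of a] abc(1)
      by (cases "?d v a"; cases "?d' v x") (auto simp: one_enat_def)
    moreover have "v \<noteq> x" using v V G'(3) by auto
    ultimately obtain s where s: "{s, x} \<in> edges (skeleton G')" "?d' v s + 1 \<le> ?d' v x"
      by (metis gdist_predecessor)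
    have "{s, x} \<notin> edges (skeleton G)"
      using simple_graph_skeleton[of G] G(1) G'(3) by (auto simp: simple_graph_def maximal_plane_def)
    then have "s \<in> S" using s(1) unfolding G'(5) abc(1) by (auto simp: doubleton_eq_iff)
    moreover from this have "?d' v s = ?d v s" using v V SV by (intro old) auto
    ultimately show ?thesis using s(2) by (intro bexI[of _ s]) simp_all
  qed
  define near where "near v = (SOME s. s \<in> S \<and> (\<forall>t\<in>S. ?d v s \<le> ?d v t))" for v
  have near: "near v \<in> S" "\<And>t. t \<in> S \<Longrightarrow> ?d v (near v) \<le> ?d v t" for v
  proof -
    have "\<exists>s. s \<in> S \<and> (\<forall>t\<in>S. ?d v s \<le> ?d v t)"
      using finS abc(1) arg_min_if_finite[of S "?d v"] by (metis insert_not_empty not_le)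
    then have "near v \<in> S \<and> (\<forall>t\<in>S. ?d v (near v) \<le> ?d v t)" unfolding near_def by (rule someI_ex)
    then show "near v \<in> S" "\<And>t. t \<in> S \<Longrightarrow> ?d v (near v) \<le> ?d v t" by auto
  qed
  have dx: "?d' v x = ?d v (near v) + 1" if v: "v \<in> V" for v
  proof (rule antisym)
    show "?d' v x \<le> ?d v (near v) + 1" by (rule xup[OF v near(1)])
    obtain s where s: "s \<in> S" "?d v s + 1 \<le> ?d' v x" using xlow[OF v] by blast
    have "?d v (near v) + 1 \<le> ?d v s + 1" using near(2)[OF s(1)] by (rule add_right_mono)
    with s(2) show "?d v (near v) + 1 \<le> ?d' v x" by (rule order_trans[rotated])
  qed
  have ex: "\<exists>g\<in>faces G'. pverts G' \<inter> frontier g = insert x (S - {near v})" for v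
    using G'(7)[of "near v"] near(1)[of v] unfolding abc(1) by blast
  define g where "g v = (SOME g. g \<in> faces G' \<and> pverts G' \<inter> frontier g = insert x (S - {near v}))" for v
  have g: "g v \<in> faces G'" "pverts G' \<inter> frontier (g v) = insert x (S - {near v})" for v
    using someI_ex[of "\<lambda>g. g \<in> faces G' \<and> pverts G' \<inter> frontier g = insert x (S - {near v})"] ex[of v]
    unfolding g_def by blast+
  define F' where "F' v = (if F v = f then g v else F v)" for v
  have ecc_mono: "ecc (skeleton G) v \<le> ecc (skeleton G') v" if v: "v \<in> V" for v
    unfolding ecc_def
  proof (rule SUP_least)
    fix y assume "y \<in> verts (skeleton G)"
    then have "?d v y = ?d' v y" using old[of v y] v V by auto
    also have "\<dots> \<le> (SUP x\<in>verts (skeleton G'). ?d' v x)"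
      using \<open>y \<in> _\<close> by (intro SUP_upper) (auto simp: G'(4))
    finally show "?d v y \<le> (SUP x\<in>verts (skeleton G'). ?d' v x)" .
  qed
  have le': "ecc (skeleton G') v \<le> enat \<alpha>" if v: "v \<in> V" for v
    unfolding ecc_def
  proof (rule SUP_least)
    fix y assume "y \<in> verts (skeleton G')"
    then consider "y \<in> pverts G" | "y = x" by (auto simp: G'(4))
    then show "?d' v y \<le> enat \<alpha>"
    proof cases
      case 1
      then show ?thesis using dle[OF v 1] old[of v y] v V by auto
    next
      case 2
      \<comment> \<open>As \<open>f\<close> serves the unfinished \<open>u\<close>, some corner is
        no farther from \<open>v\<close> than from \<open>u\<close>, hence at distance below
        \<alpha>. So \<open>x\<close> is at distance at most \<alpha> from \<open>v\<close>.\<close>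
      obtain s where s: "s \<in> S" "?d v s \<le> ?d u s"
        using fs v unfolding face_serves_def S_def by blast
      have "?d u s \<le> ecc (skeleton G) u" using ecc_ge[of s "skeleton G" u] s(1) SV by auto
      then have "?d v s < enat \<alpha>" using s(2) u(2) by (meson order_le_less_trans)
      then have "?d v s + 1 \<le> enat \<alpha>" by (cases "?d v s") (auto simp: one_enat_def)
      then show ?thesis using xup[OF v s(1)] 2 by (metis order_trans)
    qed
  qed
  have serve: "face_serves G' V (F' v) v" if v: "v \<in> V" "ecc (skeleton G') v < enat \<alpha>" for v
  proof -
    have uf: "ecc (skeleton G) v < enat \<alpha>" using ecc_mono[OF v(1)] v(2) by (rule order_le_less_trans)
    note fv = F[OF v(1) uf]
    show ?thesis
    proof (cases "F v = f")
      case False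
      have "F v \<in> faces G" using fv by (simp add: face_serves_def)
      note h = G'(6)[OF this False]
      have "\<exists>s\<in>pverts G \<inter> frontier (F v). ?d' w s \<le> ?d' v s" if w: "w \<in> V" for w
      proof -
        obtain s where s: "s \<in> pverts G \<inter> frontier (F v)" "?d w s \<le> ?d v s"
          using fv w unfolding face_serves_def by blast
        have "?d' w s = ?d w s" "?d' v s = ?d v s" using old s(1) w v V by auto
        with s show ?thesis by (intro bexI[of _ s]) simp_all
      qed
      then show ?thesis using h False unfolding face_serves_def F'_def by simp
    next
      case True
      have "\<exists>s\<in>insert x (S - {near v}). ?d' w s \<le> ?d' v s" if w: "w \<in> V" for w
      proof -
        obtain s where s: "s \<in> S" "?d w s \<le> ?d v s"
          using fv w unfolding face_serves_def True S_def by blast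
        show ?thesis
        proof (cases "s = near v")
          case True
          have "?d' w x \<le> ?d w s + 1" by (rule xup[OF w s(1)])
          also have "\<dots> \<le> ?d v s + 1" using s(2) by (rule add_right_mono)
          also have "\<dots> = ?d' v x" using dx[OF v(1)] True by simp
          finally show ?thesis by blast
        next
          case False
          have "?d' w s = ?d w s" "?d' v s = ?d v s" using old s(1) w v V SV by auto
          with s False show ?thesis by (intro bexI[of _ s]) simp_all
        qed
      qed
      then show ?thesis unfolding face_serves_def F'_def using True g by simp
    qed
  qed
  have sum_le: "(\<Sum>s\<in>S. the_enat (?d v s)) \<le> 3 * \<alpha>" if v: "v \<in> V" for v
  proof -
    have "the_enat (?d v s) \<le> \<alpha>" if "s \<in> S" for s
      using dle[OF v, of s] that SV by (cases "?d v s") auto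
    then have "(\<Sum>s\<in>S. the_enat (?d v s)) \<le> of_nat (card S) * \<alpha>" by (rule sum_bounded_above)
    then show ?thesis using \<open>card S = 3\<close> by simp
  qed
  have sum': "(\<Sum>s\<in>insert x (S - {near v}). the_enat (?d' v s)) = Suc (\<Sum>s\<in>S. the_enat (?d v s))" if v: "v \<in> V" for v
  proof -
    have "x \<notin> S - {near v}" using G'(3) SV by auto
    then have "(\<Sum>s\<in>insert x (S - {near v}). the_enat (?d' v s)) =
      the_enat (?d' v x) + (\<Sum>s\<in>S - {near v}. the_enat (?d' v s))" using finS by simp
    also have "(\<Sum>s\<in>S - {near v}. the_enat (?d' v s)) = (\<Sum>s\<in>S - {near v}. the_enat (?d v s))"
      using v V SV by (intro sum.cong refl arg_cong[where f = the_enat] old) auto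
    also have "the_enat (?d' v x) = Suc (the_enat (?d v (near v)))"
      using dx[OF v] dle[OF v, of "near v"] near(1)[of v] SV
      by (cases "?d v (near v)") (auto simp: one_enat_def)
    also have "Suc (the_enat (?d v (near v))) + (\<Sum>s\<in>S - {near v}. the_enat (?d v s)) = Suc (\<Sum>s\<in>S. the_enat (?d v s))"
      using sum.remove[OF finS near(1)[of v], of "\<lambda>s. the_enat (?d v s)"] by simp
    finally show ?thesis .
  qed
  have less: "defect G' \<alpha> (F' v) v < defect G \<alpha> (F v) v"
    if v: "v \<in> V" "ecc (skeleton G) v < enat \<alpha>" "F v = f" for v
  proof (cases "ecc (skeleton G') v < enat \<alpha>")
    case True
    then show ?thesis
      using v g sum'[OF v(1)] sum_le[OF v(1)] by (simp add: defect_def F'_def S_def[symmetric])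
  next
    case False
    then show ?thesis using v sum_le[OF v(1)] by (simp add: defect_def S_def[symmetric])
  qed
  have leq: "defect G' \<alpha> (F' v) v \<le> defect G \<alpha> (F v) v" if v: "v \<in> V" for v
  proof (cases "ecc (skeleton G') v < enat \<alpha>")
    case True
    have uf: "ecc (skeleton G) v < enat \<alpha>" using ecc_mono[OF v] True by (rule order_le_less_trans)
    show ?thesis
    proof (cases "F v = f")
      case True
      then show ?thesis using less[OF v uf] by simp
    next
      case False
      have "F v \<in> faces G" using F[OF v uf] by (simp add: face_serves_def)
      note h = G'(6)[OF this False]
      have "(\<Sum>s\<in>pverts G \<inter> frontier (F v). the_enat (?d' v s)) = (\<Sum>s\<in>pverts G \<inter> frontier (F v). the_enat (?d v s))"
        using old v V by (intro sum.cong) auto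
      then show ?thesis using h uf False by (simp add: defect_def F'_def)
    qed
  qed (simp add: defect_def)
  have "finite (pverts G)" using G(1) by (simp add: maximal_plane_def is_plane_graph_def)
  then have "3 \<le> card (pverts G')" using G(2) G'(3,4) by simp
  then show thesis
    using that[OF G'(1) _ G'(2) le' serve leq] less[OF u] by (simp add: f_def)
qed

lemma plane_subgraph_trans:
  "plane_subgraph P Q \<Longrightarrow> plane_subgraph Q R \<Longrightarrow> plane_subgraph P R"
  by (auto simp: plane_subgraph_def)

text \<open>Induction on the total defect over the finite set \<open>V\<close>: a stacking makes no
  vertex worse and improves the chosen one. The choice \<open>F\<close> of faces changes along with
  \<open>G\<close>.\<close>

lemma eccentric_extension_exists:
  assumes "maximal_plane G" "3 \<le> card (pverts G)" "V \<subseteq> pverts G"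
    "\<And>v. v \<in> V \<Longrightarrow> ecc (skeleton G) v \<le> enat \<alpha>"
    "\<And>u. \<lbrakk>u \<in> V; ecc (skeleton G) u < enat \<alpha>\<rbrakk> \<Longrightarrow> face_serves G V (F u) u"
  shows "\<exists>G'. maximal_plane G' \<and> plane_subgraph G G' \<and> V \<subseteq> ecc_class (skeleton G') \<alpha>"
  using assms
proof (induction "\<Sum>v\<in>V. defect G \<alpha> (F v) v" arbitrary: G F rule: less_induct)
  case less
  show ?case
  proof (cases "\<exists>u\<in>V. ecc (skeleton G) u < enat \<alpha>")
    case False
    then have "V \<subseteq> ecc_class (skeleton G) \<alpha>"
      using less.prems(3,4) by (force simp: ecc_class_def order_le_less)
    moreover have "plane_subgraph G G" by (simp add: plane_subgraph_def)
    ultimately show ?thesis using less.prems(1) by blast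
  next
    case True
    then obtain u where u: "u \<in> V" "ecc (skeleton G) u < enat \<alpha>" by blast
    obtain G' F' where G': "maximal_plane G'" "3 \<le> card (pverts G')" "plane_subgraph G G'"
      "\<And>v. v \<in> V \<Longrightarrow> ecc (skeleton G') v \<le> enat \<alpha>"
      "\<And>u. \<lbrakk>u \<in> V; ecc (skeleton G') u < enat \<alpha>\<rbrakk> \<Longrightarrow> face_serves G' V (F' u) u"
      "\<And>v. v \<in> V \<Longrightarrow> defect G' \<alpha> (F' v) v \<le> defect G \<alpha> (F v) v"
      "defect G' \<alpha> (F' u) u < defect G \<alpha> (F u) u"
      using stacking_step[OF less.prems(1-5) u] by blast
    have "finite V" using less.prems(1,3) finite_subset
      by (auto simp: maximal_plane_def is_plane_graph_def)
    then have "(\<Sum>v\<in>V. defect G' \<alpha> (F' v) v) < (\<Sum>v\<in>V. defect G \<alpha> (F v) v)"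
      using G'(6,7) u(1) by (intro sum_strict_mono_ex1) auto
    moreover have "V \<subseteq> pverts G'" using less.prems(3) G'(3) by (auto simp: plane_subgraph_def)
    ultimately obtain G'' where "maximal_plane G''" "plane_subgraph G' G''" "V \<subseteq> ecc_class (skeleton G'') \<alpha>"
      using less.hyps[of G' F'] G'(1,2,4,5) by blast
    then show ?thesis using plane_subgraph_trans[OF G'(3)] by blast
  qed
qed

section \<open>Extending small graphs to a triangle\<close>

text \<open>There is no non-adjacent pair to which an edge could be added.\<close>

lemma complete_maximal_plane:
  assumes P: "is_plane_graph P"
    and "\<And>u v. \<lbrakk>u \<in> pverts P; v \<in> pverts P; u \<noteq> v\<rbrakk> \<Longrightarrow> {u, v} \<in> edges (skeleton P)"
  shows "maximal_plane P"
proof -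
  have "planar (skeleton P)"
    unfolding planar_def graph_iso_def using simple_graph_skeleton[OF P] P
    by (intro conjI exI[of _ P] exI[of _ id]) auto
  then show ?thesis using assms by (auto simp: maximal_plane_def maximal_planar_def)
qed

lemma extend_one_vertex:
  assumes H: "maximal_plane H" "pverts H = {v}"
  obtains G x where "maximal_plane G" "plane_subgraph H G" "pverts G = {v, x}" "x \<noteq> v"
proof -
  have pl: "is_plane_graph H" using H by (simp add: maximal_plane_def)
  have "parcs H = {}"
  proof (rule ccontr)
    assume "parcs H \<noteq> {}"
    then obtain A where A: "A \<in> parcs H" by blast
    obtain a b where "arc_between A a b" "a \<in> pverts H" "b \<in> pverts H" using plane_graph_arc[OF pl A] by metis
    then show False using arc_between_ends(3) H(2) by auto
  qed
  then have sup: "support H = {v}" using H(2) by (simp add: support_def)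
  \<comment> \<open>Any point other than \<open>v\<close> would do; the straight segment to it
    becomes the new edge.\<close>
  define x where "x = v + 1"
  have xv: "x \<noteq> v" by (simp add: x_def)
  define P where "P = H\<lparr>pverts := insert x (pverts H)\<rparr>"
  have P: "is_plane_graph P" "edges (skeleton P) = edges (skeleton H)"
    using plane_graph_add_vertex[OF pl, of x] sup xv by (auto simp: P_def)
  have pv: "pverts P = {v, x}" by (auto simp: P_def H(2))
  have eH: "edges (skeleton H) = {}" by (simp add: edges_skeleton \<open>parcs H = {}\<close>)
  have supP: "support P = {v, x}" using \<open>parcs H = {}\<close> by (simp add: support_def pv) (simp add: P_def)
  define A where "A = closed_segment v x"
  have A: "arc_between A v x"
    unfolding arc_between_def A_def using xv by (intro exI[of _ "linepath v x"]) auto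
  have "A \<inter> support P = {v, x}" unfolding supP by (auto simp: A_def)
  then have new: "is_plane_graph (P\<lparr>parcs := insert A (parcs P)\<rparr>)"
    "skeleton (P\<lparr>parcs := insert A (parcs P)\<rparr>) = (skeleton P)\<lparr>edges := insert {v, x} (edges (skeleton P))\<rparr>"
    using plane_graph_add_arc[OF P(1) _ _ A] pv P(2) eH by auto
  show thesis
  proof (rule that)
    show "maximal_plane (P\<lparr>parcs := insert A (parcs P)\<rparr>)"
      by (rule complete_maximal_plane[OF new(1)]) (auto simp: new(2) pv)
    show "plane_subgraph H (P\<lparr>parcs := insert A (parcs P)\<rparr>)" by (auto simp: plane_subgraph_def P_def)
    show "pverts (P\<lparr>parcs := insert A (parcs P)\<rparr>) = {v, x}" by (simp add: pv)
  qed (rule xv)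
qed

text \<open>The third vertex is placed on a second arc from \<open>a\<close> to \<open>b\<close>,
  drawn in the complement of the existing edge; its two halves become the new edges.\<close>

lemma extend_two_vertices:
  assumes H: "maximal_plane H" "pverts H = {a, b}" "a \<noteq> b"
  obtains G where "maximal_plane G" "plane_subgraph H G" "card (pverts G) = 3"
proof -
  have pl: "is_plane_graph H" using H by (simp add: maximal_plane_def)
  have ends: "A \<inter> pverts H = {a, b} \<and> arc_between A a b" if A: "A \<in> parcs H" for A
  proof -
    obtain u v where uv: "arc_between A u v" "A \<inter> pverts H = {u, v}" "u \<in> pverts H" "v \<in> pverts H"
      using plane_graph_arc[OF pl A] by metis
    then have "u = a \<and> v = b \<or> u = b \<and> v = a" using H(2) arc_between_ends(3)[OF uv(1)] by auto
    then show ?thesis using uv arc_between_sym by auto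
  qed
  have "parcs H \<noteq> {}"
  proof
    assume e: "parcs H = {}"
    have "{a, b} \<in> edges (skeleton H)"
    proof (rule maximal_plane_adjacent[OF H(1)])
      show "arc_between (closed_segment a b) a b"
        unfolding arc_between_def using H(3) by (intro exI[of _ "linepath a b"]) auto
      show "closed_segment a b \<inter> support H \<subseteq> {a, b}" by (simp add: support_def e H(2))
    qed (use H in auto)
    then show False by (simp add: edges_skeleton e)
  qed
  then obtain A where A: "A \<in> parcs H" by blast
  have "parcs H = {A}"
  proof -
    have "B = A" if "B \<in> parcs H" for B
      using ends[OF that] ends[OF A] pl that A unfolding is_plane_graph_def by metis
    with A show ?thesis by blast
  qed
  then have sup: "support H = A" using ends[OF A] H(2) by (auto simp: support_def)
  have eH: "edges (skeleton H) = {{a, b}}" using \<open>parcs H = {A}\<close> ends[OF A] by (simp add: edges_skeleton)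
  obtain g where g: "arc g" "path_image g = A" using ends[OF A] unfolding arc_between_def by blast
  have frA: "frontier (- A) = A" using frontier_arc_complement[OF g(1)] g(2) by simp
  have "connected (- A)" using connected_arc_complement[OF g(1)] g(2) by simp
  moreover have "- A \<noteq> {}" using frA g(2) by force
  \<comment> \<open>The complement of the only edge is connected, hence a face, and it has both
    vertices on its frontier.\<close>
  ultimately have f: "- A \<in> faces H" unfolding faces_support sup by (simp add: in_components_self)
  have abA: "a \<in> A" "b \<in> A" using ends[OF A] arc_between_ends by auto
  obtain B where B: "arc_between B a b" "B - {a, b} \<subseteq> - A"
    using face_chord[OF pl f H(3)] abA H(2) frA by auto
  obtain x where x: "x \<in> B - {a, b}" using arc_between_interior(2)[OF B(1)] by blast
  obtain B1 B2 where BB: "arc_between B1 a x" "arc_between B2 x b" "B1 \<union> B2 = B" "B1 \<inter> B2 = {x}"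
    using arc_between_split[OF B(1), of x] x by auto
  note ends1 = arc_between_ends[OF BB(1)] and ends2 = arc_between_ends[OF BB(2)]
  have xA: "x \<notin> A" using x B(2) by auto
  have nb: "b \<notin> B1" "a \<notin> B2" using BB(4) ends1 ends2 by (metis IntI singletonD)+
  have B1A: "B1 \<inter> A = {a}" "B2 \<inter> A = {b}"
  proof -
    have "B1 - {a} \<subseteq> B - {a, b}" "B2 - {b} \<subseteq> B - {a, b}" using nb BB(3) by auto
    then show "B1 \<inter> A = {a}" "B2 \<inter> A = {b}" using B(2) abA ends1 ends2 by blast+
  qed
  define P where "P = H\<lparr>pverts := insert x (pverts H)\<rparr>"
  have P: "is_plane_graph P" "edges (skeleton P) = {{a, b}}"
    using plane_graph_add_vertex[OF pl, of x] sup xA eH by (auto simp: P_def)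
  have pv: "pverts P = {x, a, b}" by (simp add: P_def H(2))
  have supP: "support P = insert x A" using sup by (auto simp: P_def support_def)
  define P1 where "P1 = P\<lparr>parcs := insert B1 (parcs P)\<rparr>"
  have "B1 \<inter> support P = {a, x}" unfolding supP using B1A ends1 by blast
  moreover have "{a, x} \<notin> edges (skeleton P)" using x by (auto simp: P(2) doubleton_eq_iff)
  ultimately have "is_plane_graph P1 \<and> skeleton P1 = (skeleton P)\<lparr>edges := insert {a, x} (edges (skeleton P))\<rparr>"
    unfolding P1_def using plane_graph_add_arc[OF P(1) _ _ BB(1)] pv by simp
  then have P1: "is_plane_graph P1" "edges (skeleton P1) = {{a, x}, {a, b}}" by (auto simp: P(2))
  have pv1: "pverts P1 = {x, a, b}" by (simp add: P1_def pv)
  have sup1: "support P1 = insert x A \<union> B1" using supP by (auto simp: P1_def support_def)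
  define P2 where "P2 = P1\<lparr>parcs := insert B2 (parcs P1)\<rparr>"
  have "B2 \<inter> support P1 = {x, b}" unfolding sup1 using B1A BB(4) ends2 by blast
  moreover have "{x, b} \<notin> edges (skeleton P1)" using x H(3) by (auto simp: P1(2) doubleton_eq_iff)
  ultimately have "is_plane_graph P2 \<and> skeleton P2 = (skeleton P1)\<lparr>edges := insert {x, b} (edges (skeleton P1))\<rparr>"
    unfolding P2_def using plane_graph_add_arc[OF P1(1) _ _ BB(2)] pv1 by simp
  then have P2: "is_plane_graph P2" "edges (skeleton P2) = {{x, b}, {a, x}, {a, b}}" by (auto simp: P1(2))
  have pv2: "pverts P2 = {x, a, b}" by (simp add: P2_def pv1)
  show thesis
  proof (rule that)
    show "maximal_plane P2"
      by (rule complete_maximal_plane[OF P2(1)]) (auto simp: P2(2) pv2 insert_commute)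
    show "plane_subgraph H P2" by (auto simp: plane_subgraph_def P2_def P1_def P_def)
    show "card (pverts P2) = 3" using x H(3) by (auto simp: pv2)
  qed
qed

lemma faces_nonempty:
  assumes P: "is_plane_graph P" shows "faces P \<noteq> {}"
proof -
  have "bounded A" if A: "A \<in> parcs P" for A
    using plane_graph_arc[OF P A] arc_between_compact compact_imp_bounded by metis
  then have "bounded (support P)"
    using P unfolding support_def by (auto simp: is_plane_graph_def finite_imp_bounded)
  then have "support P \<noteq> UNIV" using not_bounded_UNIV by metis
  then show ?thesis by (auto simp: faces_support)
qed

text \<open>All three vertices lie on the frontier of every face, so each \<open>v\<close> is its
  own witness at distance \<open>0\<close>, and one face serves all vertices.\<close>

lemma triangle_extension_exists:
  assumes G: "maximal_plane G" "card (pverts G) = 3" and V: "V \<subseteq> pverts G" and "1 \<le> \<alpha>"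
  shows "\<exists>G'. maximal_plane G' \<and> plane_subgraph G G' \<and> V \<subseteq> ecc_class (skeleton G') \<alpha>"
proof -
  have pl: "is_plane_graph G" using G by (simp add: maximal_plane_def)
  obtain f where f: "f \<in> faces G" using faces_nonempty[OF pl] by blast
  have fin: "finite (pverts G)" using pl by (simp add: is_plane_graph_def)
  have "card (pverts G \<inter> frontier f) = 3" using triangular_face[OF G(1) f] G(2) by simp
  then have all: "pverts G \<inter> frontier f = pverts G"
    using fin G(2) by (intro card_seteq) auto
  have "gdist (skeleton G) u v \<le> 1" if uv: "u \<in> pverts G" "v \<in> pverts G" for u v
  proof (cases "u = v")
    case True
    then show ?thesis using gdist_refl[of u "skeleton G"] uv by simp
  next
    case False
    then have "{u, v} \<in> edges (skeleton G)"
      using face_vertices_adjacent[OF G(1) f False] uv all by blast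
    then show ?thesis using uv by (intro gdist_edge) auto
  qed
  then have "ecc (skeleton G) v \<le> 1" if "v \<in> pverts G" for v
    unfolding ecc_def using that by (intro SUP_least) simp
  moreover have "(1::enat) \<le> enat \<alpha>" using \<open>1 \<le> \<alpha>\<close> by (simp add: one_enat_def)
  ultimately have "ecc (skeleton G) v \<le> enat \<alpha>" if "v \<in> V" for v
    using that V by (meson order_trans subsetD)
  moreover have "face_serves G V f u" for u
    unfolding face_serves_def all
  proof (intro conjI ballI f)
    fix v assume v: "v \<in> V"
    then have "gdist (skeleton G) v v = 0" using V by (intro gdist_refl) auto
    then show "\<exists>s\<in>pverts G. gdist (skeleton G) v s \<le> gdist (skeleton G) u s" using v V by (intro bexI[of _ v]) auto
  qed
  ultimately show ?thesis using G V by (intro eccentric_extension_exists[where F = "\<lambda>_. f"]) auto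
qed

theorem theorem22:
  fixes H :: plane_graph and d \<alpha> :: nat
  assumes "maximal_plane H"
    and "gdiam (skeleton H) = enat d"
    and "d \<le> \<alpha>"
  shows "(\<exists>G. maximal_plane G \<and> plane_subgraph H G \<and>
              pverts H \<subseteq> ecc_class (skeleton G) \<alpha>)
     \<longleftrightarrow> (\<forall>u\<in>pverts H. ecc (skeleton H) u < enat \<alpha> \<longrightarrow>
            (\<exists>f\<in>faces H. u \<in> qcc (skeleton H) (pverts (face_boundary H f))))"
proof (intro iffI ballI impI)
  fix u assume "\<exists>G. maximal_plane G \<and> plane_subgraph H G \<and> pverts H \<subseteq> ecc_class (skeleton G) \<alpha>"
    "u \<in> pverts H" "ecc (skeleton H) u < enat \<alpha>"
  then show "\<exists>f\<in>faces H. u \<in> qcc (skeleton H) (pverts (face_boundary H f))"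
    using eccentric_extension_imp_qcc[OF assms(1)] by blast
next
  assume R: "\<forall>u\<in>pverts H. ecc (skeleton H) u < enat \<alpha> \<longrightarrow>
    (\<exists>f\<in>faces H. u \<in> qcc (skeleton H) (pverts (face_boundary H f)))"
  have le: "ecc (skeleton H) v \<le> enat \<alpha>" if "v \<in> pverts H" for v
  proof -
    have "ecc (skeleton H) v \<le> gdiam (skeleton H)"
      unfolding gdiam_def using that by (intro SUP_upper) simp
    with assms(2,3) show ?thesis by (metis enat_ord_simps(1) order_trans)
  qed
  have refl: "plane_subgraph H H" by (simp add: plane_subgraph_def)
  have fin: "finite (pverts H)" using assms(1) by (simp add: maximal_plane_def is_plane_graph_def)
  show "\<exists>G. maximal_plane G \<and> plane_subgraph H G \<and> pverts H \<subseteq> ecc_class (skeleton G) \<alpha>"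
  proof (cases "\<exists>u\<in>pverts H. ecc (skeleton H) u < enat \<alpha>")
    case False
    then have "pverts H \<subseteq> ecc_class (skeleton H) \<alpha>"
      using le by (force simp: ecc_class_def order_le_less)
    with refl assms(1) show ?thesis by blast
  next
    case True
    then obtain u where u: "u \<in> pverts H" "ecc (skeleton H) u < enat \<alpha>" by blast
    \<comment> \<open>An eccentricity below \<alpha> excludes \<alpha> = 0. The triangle, with
      eccentricities at most 1, is then an admissible start for the small cases.\<close>
    then have "1 \<le> \<alpha>" by (cases \<alpha>) (auto simp: zero_enat_def[symmetric])
    have "card (pverts H) \<noteq> 0" using fin u by auto
    then consider "3 \<le> card (pverts H)" | "card (pverts H) = 1" | "card (pverts H) = 2" by linarith
    then show ?thesis
    proof cases
      case 1
      have "\<forall>u. \<exists>f. u \<in> pverts H \<and> ecc (skeleton H) u < enat \<alpha> \<longrightarrow> face_serves H (pverts H) f u"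
        using R unfolding face_serves_def qcc_def face_boundary_def by fastforce
      then obtain F where F: "\<And>u. \<lbrakk>u \<in> pverts H; ecc (skeleton H) u < enat \<alpha>\<rbrakk> \<Longrightarrow> face_serves H (pverts H) (F u) u"
        by metis
      show ?thesis
        by (rule eccentric_extension_exists[where F = F]) (use assms(1) 1 le F in auto)
    next
      case 2
      then obtain v where v: "pverts H = {v}" by (auto simp: card_1_singleton_iff)
      obtain G x where G: "maximal_plane G" "plane_subgraph H G" "pverts G = {v, x}" "x \<noteq> v"
        using extend_one_vertex[OF assms(1) v] .
      obtain K where K: "maximal_plane K" "plane_subgraph G K" "card (pverts K) = 3"
        using extend_two_vertices[OF G(1,3)] G(4) by auto
      have HK: "plane_subgraph H K" using plane_subgraph_trans[OF G(2) K(2)] .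
      then have "pverts H \<subseteq> pverts K" by (simp add: plane_subgraph_def)
      then show ?thesis
        using triangle_extension_exists[OF K(1,3) _ \<open>1 \<le> \<alpha>\<close>] plane_subgraph_trans[OF HK] by blast
    next
      case 3
      then obtain a b where ab: "pverts H = {a, b}" "a \<noteq> b" by (auto simp: card_2_iff)
      obtain K where K: "maximal_plane K" "plane_subgraph H K" "card (pverts K) = 3"
        using extend_two_vertices[OF assms(1) ab] .
      then have "pverts H \<subseteq> pverts K" by (simp add: plane_subgraph_def)
      then show ?thesis
        using triangle_extension_exists[OF K(1,3) _ \<open>1 \<le> \<alpha>\<close>] plane_subgraph_trans[OF K(2)] by blast
    qed
  qed
qed

end
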